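(* Let $d\ge1$ and let $L$ be a $d$-dimensional pure-jump Lévy process with Lévy measure $\nu$, and suppose that for some $\alpha\in[1,2)$ both of the following hold: (H1) the convolution semigroup $R_tf(x)=E[f(x+L_t)]$ satisfies $R_t(C_b(\mathbb{R}^d))\subset C^1_b(\mathbb{R}^d)$ for all $t>0$, and there is $c_0>0$ such that $\sup_{x}|DR_tf(x)|\le c_0\,t^{-1/\alpha}\sup_{x}|f(x)|$ for all $t\in(0,1]$ and $f\in C_b(\mathbb{R}^d)$; (H2) $\int_{\{|x|\le 1\}}|x|^{\sigma}\,\nu(dx)<\infty$ for every $\sigma>\alpha$. Let $\beta\in(0,1)$ be such that $\alpha+\beta\in(1,2)$, and let $b\in C_b^\beta(\mathbb{R}^d;\mathbb{R}^d)$. Then for every $\lambda>0$ and $f\in C_b^\beta(\mathbb{R}^d)$ there exists a unique solution $v=v_\lambda\in C_b^{\alpha+\beta}(\mathbb{R}^d)$ to $$\lambda v-\mathcal{L}v-b\cdot Dv=f\quad\text{on }\mathbb{R}^d.$$ Moreover, for every $\omega>0$ there exists $c=c(\omega)>0$, independent of $f$ and $v$, such that $$\lambda\|v\|_0+[Dv]_{\alpha+\beta-1}\le c\,\|f\|_\beta,\qquad \lambda\ge\omega.$$ Finally, $\lim_{\lambda\to\infty}\|Dv_\lambda\|_0=0$.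
   Context: A $d$-dimensional pure-jump Lévy process (without drift) with Lévy measure $\nu$ is a Lévy process $L$ with $E[e^{i\langle u,L_t\rangle}]=e^{-t\psi(u)}$, $\psi(u)=-\int_{\mathbb{R}^d}(e^{i\langle u,z\rangle}-1-i\langle u,z\rangle1_{\{|z|\le1\}}(z))\nu(dz)$, where $\nu$ is $\sigma$-finite on $\mathbb{R}^d$ with $\nu(\{0\})=0$ and $\int(1\wedge|z|^2)\nu(dz)<\infty$. The operator $\mathcal{L}$ is $$\mathcal{L}g(x)=\int_{\mathbb{R}^d}\big(g(x+y)-g(x)-1_{\{|y|\le1\}}\langle y,Dg(x)\rangle\big)\nu(dy);$$ under (H2) this integral converges for every $g\in C^{1+\gamma}_b(\mathbb{R}^d)$ with $\gamma\ge0$, $1+\gamma>\alpha$, and equations are understood pointwise with $\mathcal L$ given by this formula. Norms: $\|g\|_0=\sup|g|$; $[g]_\theta=\sup_{x\ne x'}|g(x)-g(x')|/|x-x'|^\theta$ for $\theta\in(0,1)$; $C_b^\beta(\mathbb{R}^d;\mathbb{R}^k)$ is the space of bounded continuous $g:\mathbb{R}^d\to\mathbb{R}^k$ with $[g]_\beta<\infty$, normed by $\|g\|_\beta=\|g\|_0+[g]_\beta$ (and $C_b^\beta(\mathbb{R}^d)$ is the case $k=1$). $C_b(\mathbb{R}^d)$ is the space of bounded continuous real functions, and $C_b^1(\mathbb{R}^d)$ the $C^1$ functions bounded together with their gradient. For $\theta\in(0,1)$, $C_b^{1+\theta}(\mathbb{R}^d)$ is the space of $g\in C^1(\mathbb{R}^d)\cap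 C^\theta_b(\mathbb{R}^d)$ with $Dg\in C_b^\theta(\mathbb{R}^d;\mathbb{R}^d)$; here $C_b^{\alpha+\beta}=C_b^{1+\theta}$ with $\theta=\alpha+\beta-1\in(0,1)$. *)

theory Defs
  imports "HOL-Probability.Probability"
begin

section \<open>Function spaces\<close>

text \<open>The supremum is that of a bounded set exactly when \<open>g\<close> is bounded; \<open>sup_norm\<close> and the
  seminorm below are only meaningful on the function spaces defined in this section.\<close>

definition sup_norm :: "('a \<Rightarrow> 'b::real_normed_vector) \<Rightarrow> real"
  where "sup_norm g = (SUP x. norm (g x))"

definition holder_quotients ::
    "real \<Rightarrow> ('a::metric_space \<Rightarrow> 'b::real_normed_vector) \<Rightarrow> real set"
  where "holder_quotients \<theta> g = {norm (g x - g x') / dist x x' powr \<theta> | x x'. x \<noteq> x'}"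

definition holder_seminorm ::
    "real \<Rightarrow> ('a::metric_space \<Rightarrow> 'b::real_normed_vector) \<Rightarrow> real"
  where "holder_seminorm \<theta> g = Sup (holder_quotients \<theta> g)"

definition holder_norm ::
    "real \<Rightarrow> ('a::metric_space \<Rightarrow> 'b::real_normed_vector) \<Rightarrow> real"
  where "holder_norm \<theta> g = sup_norm g + holder_seminorm \<theta> g"

definition Cb_holder ::
    "real \<Rightarrow> ('a::metric_space \<Rightarrow> 'b::real_normed_vector) set"
  where "Cb_holder \<theta> = {g \<in> bcontfun. bdd_above (holder_quotients \<theta> g)}"

definition grad :: "('a::euclidean_space \<Rightarrow> real) \<Rightarrow> 'a \<Rightarrow> 'a"
  where "grad g x = (THE D. GDERIV g x :> D)"

definition C1 :: "('a::euclidean_space \<Rightarrow> real) set"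
  where "C1 = {g. (\<forall>x. g differentiable (at x)) \<and> continuous_on UNIV (grad g)}"

definition Cb_1 :: "('a::euclidean_space \<Rightarrow> real) set"
  where "Cb_1 = {g \<in> C1. bounded (range g) \<and> bounded (range (grad g))}"

definition Cb_1_holder :: "real \<Rightarrow> ('a::euclidean_space \<Rightarrow> real) set"
  where "Cb_1_holder \<theta> = {g \<in> C1 \<inter> Cb_holder \<theta>. grad g \<in> Cb_holder \<theta>}"

section \<open>Levy processes\<close>

text \<open>Time is indexed by \<open>real\<close>, but only the values at times \<open>t \<ge> 0\<close> matter.  The last clause
  says that almost every path is right continuous with left limits.\<close>

definition levy_process ::
    "'w measure \<Rightarrow> (real \<Rightarrow> 'w \<Rightarrow> 'a::euclidean_space) \<Rightarrow> bool"
  where "levy_process M L \<longleftrightarrow>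
    prob_space M \<and>
    (\<forall>t\<ge>0. L t \<in> borel_measurable M) \<and>
    (AE \<omega> in M. L 0 \<omega> = 0) \<and>
    (\<forall>(n::nat) t. 0 \<le> t 0 \<and> (\<forall>i<n. t i < t (Suc i)) \<longrightarrow>
       prob_space.indep_vars M (\<lambda>_. borel) (\<lambda>i \<omega>. L (t (Suc i)) \<omega> - L (t i) \<omega>) {..<n}) \<and>
    (\<forall>s\<ge>0. \<forall>t\<ge>0. distr M borel (\<lambda>\<omega>. L (s + t) \<omega> - L s \<omega>) = distr M borel (L t)) \<and>
    (\<forall>t\<ge>0. \<forall>\<epsilon>>0. ((\<lambda>s. measure M {\<omega> \<in> space M. norm (L s \<omega> - L t \<omega>) > \<epsilon>}) \<longlongrightarrow> 0)
       (at t within {0..})) \<and>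
    (AE \<omega> in M. \<forall>t\<ge>0. ((\<lambda>s. L s \<omega>) \<longlongrightarrow> L t \<omega>) (at_right t) \<and>
       (t > 0 \<longrightarrow> (\<exists>l. ((\<lambda>s. L s \<omega>) \<longlongrightarrow> l) (at_left t))))"

definition levy_measure :: "'a::euclidean_space measure \<Rightarrow> bool"
  where "levy_measure \<nu> \<longleftrightarrow>
    sets \<nu> = sets borel \<and> sigma_finite_measure \<nu> \<and> emeasure \<nu> {0} = 0 \<and>
    (\<integral>\<^sup>+ z. ennreal (min 1 ((norm z)\<^sup>2)) \<partial>\<nu>) < \<infinity>"

definition levy_exponent :: "'a::euclidean_space measure \<Rightarrow> 'a \<Rightarrow> complex"
  where "levy_exponent \<nu> u =
    - (LINT z|\<nu>. exp (\<i> * of_real (u \<bullet> z)) - 1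
                 - \<i> * of_real (u \<bullet> z) * of_real (indicat_real (cball 0 1) z))"

definition pure_jump_levy_process ::
    "'w measure \<Rightarrow> (real \<Rightarrow> 'w \<Rightarrow> 'a::euclidean_space) \<Rightarrow> 'a measure \<Rightarrow> bool"
  where "pure_jump_levy_process M L \<nu> \<longleftrightarrow>
    levy_process M L \<and> levy_measure \<nu> \<and>
    (\<forall>t\<ge>0. \<forall>u. (LINT \<omega>|M. exp (\<i> * of_real (u \<bullet> L t \<omega>)))
                  = exp (- of_real t * levy_exponent \<nu> u))"

definition levy_semigroup ::
    "'w measure \<Rightarrow> (real \<Rightarrow> 'w \<Rightarrow> 'a::euclidean_space) \<Rightarrow> real \<Rightarrow> ('a \<Rightarrow> real) \<Rightarrow> 'a \<Rightarrow> real"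
  where "levy_semigroup M L t f x = (LINT \<omega>|M. f (x + L t \<omega>))"

text \<open>The Bochner integral is \<open>0\<close> by convention where it diverges.  This never happens for
  \<open>g \<in> Cb_1_holder \<gamma>\<close> with \<open>1 + \<gamma> > \<alpha>\<close> under hypothesis \<open>levy_H2\<close> below: the integrand is then
  \<open>O(norm y powr (1 + \<gamma>))\<close> near the origin and bounded away from it.\<close>

definition levy_generator ::
    "'a::euclidean_space measure \<Rightarrow> ('a \<Rightarrow> real) \<Rightarrow> 'a \<Rightarrow> real"
  where "levy_generator \<nu> g x =
    (LINT y|\<nu>. g (x + y) - g x - indicat_real (cball 0 1) y * (y \<bullet> grad g x))"

definition levy_H1 ::
    "'w measure \<Rightarrow> (real \<Rightarrow> 'w \<Rightarrow> 'a::euclidean_space) \<Rightarrow> real \<Rightarrow> bool"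
  where "levy_H1 M L \<alpha> \<longleftrightarrow>
    (\<forall>t>0. \<forall>f\<in>bcontfun. levy_semigroup M L t f \<in> Cb_1) \<and>
    (\<exists>c\<^sub>0>0. \<forall>t\<in>{0<..1}. \<forall>f\<in>bcontfun.
       sup_norm (grad (levy_semigroup M L t f)) \<le> c\<^sub>0 * t powr (- 1 / \<alpha>) * sup_norm f)"

definition levy_H2 :: "'a::euclidean_space measure \<Rightarrow> real \<Rightarrow> bool"
  where "levy_H2 \<nu> \<alpha> \<longleftrightarrow>
    (\<forall>\<sigma>>\<alpha>. (\<integral>\<^sup>+ x\<in>cball 0 1. ennreal (norm x powr \<sigma>) \<partial>\<nu>) < \<infinity>)"

section \<open>The resolvent equation\<close>

definition resolvent_solution ::
    "'a::euclidean_space measure \<Rightarrow> ('a \<Rightarrow> 'a) \<Rightarrow> real \<Rightarrow> real \<Rightarrow> ('a \<Rightarrow> real) \<Rightarrow> ('a \<Rightarrow> real) \<Rightarrow> bool"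
  where "resolvent_solution \<nu> b \<theta> lam f v \<longleftrightarrow>
    v \<in> Cb_1_holder \<theta> \<and>
    (\<forall>x. lam * v x - levy_generator \<nu> v x - b x \<bullet> grad v x = f x)"

end

theory Submission
  imports Defs
begin

text \<open>
  The resolvent of the semigroup \<open>R\<^sub>t\<close> with a constant drift \<open>k\<close>,
  \<open>U F x = \<integral> e\<^bsup>-lt\<^esup> R\<^sub>t F (x + t k) dt\<close>, satisfies Schauder estimates that do not depend on \<open>k\<close>: the
  hypothesis (H1) bounds first differences of \<open>R\<^sub>t F\<close>, averaging over translates interpolates this for
  Hoelder \<open>F\<close>, the semigroup property gives second differences, and one integrates in \<open>t\<close>.  That \<open>U\<close>
  inverts \<open>l - \<L> - k \<bullet> D\<close> is checked on exponentials, where it is the characteristic function of the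
  process, and passes to functions by Gaussian mollification.

  In the critical case \<open>\<alpha> = 1\<close> the drift is not of lower order, so the a priori estimate freezes \<open>b\<close> at a
  point and localizes by a Gaussian bump; the commutator of the bump with \<open>\<L>\<close> is of lower order because
  \<open>\<alpha> + \<beta> < 2\<close>.  With the maximum principle this gives estimates that are uniform over
  \<open>s b\<close>, \<open>0 \<le> s \<le> 1\<close>, and existence follows by continuation in \<open>s\<close>.  The gradient tends to zero by
  interpolation between the sup norm of the solution and the Hoelder seminorm of its gradient.
\<close>


section \<open>Quantitative Hoelder and \<open>C\<^sup>1\<close> bounds\<close>

text \<open>The exponent \<open>\<theta> = \<alpha> + \<beta> - 1\<close> comes from scaling: the
  two time bounds, for first increments of \<open>R\<^sub>t F\<close> and for second ones with step
  \<open>\<eta>\<close>, balance at time \<open>\<eta> powr \<alpha>\<close>, and integrating up to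
  and beyond that time gives \<open>\<eta> powr \<theta>\<close> from both sides. The restrictions
  on \<open>\<alpha> + \<beta>\<close> make the two integrals converge. A constant drift enters
  \<open>U\<close> only as a translation of the argument, which leaves increment bounds unchanged.

  The obstacle is that direct estimates of the nonlocal operator on functions with
  \<open>\<theta>\<close>-Hoelder gradient only reach exponents strictly below
  \<open>\<beta>\<close>. The localized right-hand side is therefore rewritten by means of the
  equation, so that the operator falls on the smooth bump alone.

  With a drift only one half of the inversion is used: \<open>U\<close> applied to the operator
  returns the function, which serves the a priori estimate. The other half is established for zero
  drift, as the starting point of the continuation.

  Explicit constants take the place of norms, so that a solution may enter with a merely qualitative
  constant, which is later iterated away.\<close>

definition holder_bd :: "real \<Rightarrow> real \<Rightarrow> ('a::metric_space \<Rightarrow> 'b::real_normed_vector) \<Rightarrow> bool"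
  where "holder_bd \<kappa> K g \<longleftrightarrow>
    (\<forall>x. norm (g x) \<le> K) \<and> (\<forall>x y. norm (g x - g y) \<le> K * dist x y powr \<kappa>)"

text \<open>The Taylor inequality replaces differentiability, so that all three conditions pass to
  pointwise limits and to averages over translations.\<close>

definition C1_bd :: "real \<Rightarrow> real \<Rightarrow> ('a::euclidean_space \<Rightarrow> real) \<Rightarrow> ('a \<Rightarrow> 'a) \<Rightarrow> bool"
  where "C1_bd \<gamma> K w w' \<longleftrightarrow> (\<forall>x. \<bar>w x\<bar> \<le> K) \<and> holder_bd \<gamma> K w' \<and>
    (\<forall>x h. \<bar>w (x + h) - w x - w' x \<bullet> h\<bar> \<le> K * norm h powr (1 + \<gamma>))"

text \<open>The two increments play different roles: the final bounds are linear in
  \<open>h\<close>, which shrinks to zero to expose the gradient, and of order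
  \<open>\<theta>\<close> in \<open>\<eta>\<close>, which then measures the Hoelder modulus of that
  gradient.\<close>

abbreviation incr2 :: "('a::plus \<Rightarrow> real) \<Rightarrow> 'a \<Rightarrow> 'a \<Rightarrow> 'a \<Rightarrow> real"
  where "incr2 f x \<eta> h \<equiv> (f (x + \<eta> + h) - f (x + \<eta>)) - (f (x + h) - f x)"

text \<open>Integrability can be left open: a divergent Bochner integral is 0 by convention, and
  \<open>B\<close> is nonnegative because it dominates a norm.\<close>

lemma (in prob_space) norm_expectation_le:
  fixes f :: "'a \<Rightarrow> 'b::{banach, second_countable_topology}"
  assumes "\<And>x. norm (f x) \<le> B"
  shows "norm (\<integral>x. f x \<partial>M) \<le> B"
proof (cases "integrable M f")
  case True
  have "norm (\<integral>x. f x \<partial>M) \<le> (\<integral>x. norm (f x) \<partial>M)" by (rule integral_norm_bound)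
  also have "\<dots> \<le> (\<integral>x. B \<partial>M)" using True assms by (intro integral_mono) auto
  finally show ?thesis by (simp add: prob_space)
next
  case False
  then show ?thesis using order_trans[OF norm_ge_zero assms] by (simp add: not_integrable_integral_eq)
qed

section \<open>Algebra of Hoelder bounds\<close>

lemma holder_bdD:
  assumes "holder_bd \<kappa> K g"
  shows "norm (g x) \<le> K" "norm (g x - g y) \<le> K * dist x y powr \<kappa>"
  using assms by (auto simp: holder_bd_def)

lemma holder_bd_nonneg: "holder_bd \<kappa> K g \<Longrightarrow> 0 \<le> K"
  by (meson holder_bdD(1) norm_ge_zero order_trans)

lemma holder_bd_mono:
  assumes "holder_bd \<kappa> K g" "K \<le> K'"
  shows "holder_bd \<kappa> K' g"
  unfolding holder_bd_def
proof (intro conjI allI)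
  show "norm (g x) \<le> K'" for x
    using holder_bdD(1)[OF assms(1), of x] assms(2) by linarith
  show "norm (g x - g y) \<le> K' * dist x y powr \<kappa>" for x y
    using holder_bdD(2)[OF assms(1), of x y] mult_right_mono[OF assms(2), of "dist x y powr \<kappa>"]
    by simp
qed

text \<open>Up to distance 1 lowering the exponent enlarges the power; beyond distance 1 the sup
  bound gives \<open>2 * K\<close>, whence the factor.\<close>

lemma holder_bd_exponent:
  assumes "holder_bd \<kappa> K g" "0 < \<kappa>'" "\<kappa>' \<le> \<kappa>"
  shows "holder_bd \<kappa>' (2 * K) g"
  unfolding holder_bd_def
proof (intro conjI allI)
  have K: "0 \<le> K" using assms(1) by (rule holder_bd_nonneg)
  show "norm (g x) \<le> 2 * K" for x
    using holder_bdD(1)[OF assms(1), of x] K by linarith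
  show "norm (g x - g y) \<le> 2 * K * dist x y powr \<kappa>'" for x y
  proof (cases "dist x y \<le> 1")
    case True
    then have "dist x y powr \<kappa> \<le> dist x y powr \<kappa>'"
      by (intro powr_mono') (use assms in auto)
    then have "K * dist x y powr \<kappa> \<le> 1 * K * dist x y powr \<kappa>'"
      using K by (simp add: mult_left_mono)
    also have "\<dots> \<le> 2 * K * dist x y powr \<kappa>'"
      using K by (intro mult_right_mono) auto
    finally show ?thesis
      using holder_bdD(2)[OF assms(1), of x y] by linarith
  next
    case False
    then have "1 \<le> dist x y powr \<kappa>'"
      using assms by (intro ge_one_powr_ge_zero) auto
    then have "2 * K * 1 \<le> 2 * K * dist x y powr \<kappa>'"
      using K by (intro mult_left_mono) auto
    moreover have "norm (g x - g y) \<le> 2 * K"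
      using norm_triangle_ineq4[of "g x" "g y"] holder_bdD(1)[OF assms(1), of x]
        holder_bdD(1)[OF assms(1), of y] by linarith
    ultimately show ?thesis by linarith
  qed
qed

lemma holder_bd_continuous:
  assumes "holder_bd \<kappa> K g" "0 < \<kappa>"
  shows "continuous_on UNIV g"
proof -
  have "isCont g x" for x
    unfolding isCont_def
  proof -
    have "((\<lambda>y. dist y x) \<longlongrightarrow> 0) (at x)"
      by (rule tendsto_dist_iff[THEN iffD1]) (rule tendsto_ident_at)
    then have "((\<lambda>y. K * dist y x powr \<kappa>) \<longlongrightarrow> K * 0 powr \<kappa>) (at x)"
      by (intro tendsto_mult tendsto_const tendsto_powr') (use assms in auto)
    then have "((\<lambda>y. K * dist y x powr \<kappa>) \<longlongrightarrow> 0) (at x)" by simp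
    then have "((\<lambda>y. g y - g x) \<longlongrightarrow> 0) (at x)"
      by (rule Lim_null_comparison[rotated])
         (auto intro!: always_eventually holder_bdD(2)[OF assms(1)])
    then show "(g \<longlongrightarrow> g x) (at x)" by (simp add: LIM_zero_iff)
  qed
  then show ?thesis by (simp add: continuous_on_eq_continuous_at)
qed

lemma holder_bd_bcontfun:
  assumes "holder_bd \<kappa> K g" "0 < \<kappa>"
  shows "g \<in> bcontfun"
  using holder_bd_continuous[OF assms] holder_bdD(1)[OF assms(1)]
  by (auto simp: bcontfun_def intro: boundedI)

lemma holder_bd_add:
  assumes "holder_bd \<kappa> K f" "holder_bd \<kappa> L g"
  shows "holder_bd \<kappa> (K + L) (\<lambda>x. f x + g x)"
  unfolding holder_bd_def
proof (intro conjI allI)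
  show "norm (f x + g x) \<le> K + L" for x
    by (intro norm_triangle_mono holder_bdD(1)[OF assms(1)] holder_bdD(1)[OF assms(2)])
  show "norm (f x + g x - (f y + g y)) \<le> (K + L) * dist x y powr \<kappa>" for x y
    using norm_triangle_mono[OF holder_bdD(2)[OF assms(1), of x y] holder_bdD(2)[OF assms(2), of x y]]
    by (simp add: algebra_simps)
qed

lemma holder_bd_minus:
  assumes "holder_bd \<kappa> K f"
  shows "holder_bd \<kappa> K (\<lambda>x. - f x)"
  using assms by (simp add: holder_bd_def norm_minus_commute)

lemma holder_bd_diff:
  assumes "holder_bd \<kappa> K f" "holder_bd \<kappa> L g"
  shows "holder_bd \<kappa> (K + L) (\<lambda>x. f x - g x)"
  using holder_bd_add[OF assms(1) holder_bd_minus[OF assms(2)]] by simp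

lemma holder_bd_const: "norm c \<le> K \<Longrightarrow> holder_bd \<kappa> K (\<lambda>x. c)"
  using order_trans[OF norm_ge_zero, of c K] by (auto simp: holder_bd_def)

lemma holder_bd_cmult:
  assumes "holder_bd \<kappa> K f"
  shows "holder_bd \<kappa> (\<bar>c\<bar> * K) (\<lambda>x. c *\<^sub>R f x)"
  unfolding holder_bd_def
proof (intro conjI allI)
  show "norm (c *\<^sub>R f x) \<le> \<bar>c\<bar> * K" for x
    using mult_left_mono[OF holder_bdD(1)[OF assms, of x], of "\<bar>c\<bar>"] by simp
  show "norm (c *\<^sub>R f x - c *\<^sub>R f y) \<le> \<bar>c\<bar> * K * dist x y powr \<kappa>" for x y
    using mult_left_mono[OF holder_bdD(2)[OF assms, of x y], of "\<bar>c\<bar>"]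
    unfolding scaleR_diff_right[symmetric] norm_scaleR by (simp add: mult.assoc)
qed

text \<open>The asymmetric constant is used to absorb a factor whose supremum is small.\<close>

lemma holder_bilinear:
  fixes f :: "'a::metric_space \<Rightarrow> 'b::real_normed_vector"
    and g :: "'a \<Rightarrow> 'c::real_normed_vector"
    and P :: "'b \<Rightarrow> 'c \<Rightarrow> 'd::real_normed_vector"
  assumes P: "bounded_bilinear P" "\<And>u v. norm (P u v) \<le> norm u * norm v"
    and f: "\<And>x. norm (f x) \<le> K0" "\<And>x y. norm (f x - f y) \<le> K1 * dist x y powr \<kappa>"
    and g: "\<And>x. norm (g x) \<le> L0" "\<And>x y. norm (g x - g y) \<le> L1 * dist x y powr \<kappa>"
  shows "norm (P (f x) (g x)) \<le> K0 * L0"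
    and "norm (P (f x) (g x) - P (f y) (g y)) \<le> (K0 * L1 + K1 * L0) * dist x y powr \<kappa>"
proof -
  interpret P: bounded_bilinear P by (rule P)
  have K0: "0 \<le> K0" using f(1) by (meson norm_ge_zero order_trans)
  show "norm (P (f x) (g x)) \<le> K0 * L0"
    by (rule order_trans[OF P(2)]) (intro mult_mono f g K0 norm_ge_zero)
  have "P (f x) (g x) - P (f y) (g y) = P (f x) (g x - g y) + P (f x - f y) (g y)"
    by (simp add: P.diff_left P.diff_right)
  also have "norm \<dots> \<le> norm (f x) * norm (g x - g y) + norm (f x - f y) * norm (g y)"
    by (intro norm_triangle_mono P(2))
  also have "\<dots> \<le> K0 * (L1 * dist x y powr \<kappa>) + (K1 * dist x y powr \<kappa>) * L0"
    by (intro add_mono mult_mono f g K0 norm_ge_zero order_trans[OF norm_ge_zero f(2)])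
  finally show "norm (P (f x) (g x) - P (f y) (g y)) \<le> (K0 * L1 + K1 * L0) * dist x y powr \<kappa>"
    by (simp add: algebra_simps)
qed

lemma holder_bd_bilinear:
  assumes P: "bounded_bilinear P" "\<And>u v. norm (P u v) \<le> norm u * norm v"
    and f: "holder_bd \<kappa> K f" and g: "holder_bd \<kappa> L g"
  shows "holder_bd \<kappa> (2 * K * L) (\<lambda>x. P (f x) (g x))"
  unfolding holder_bd_def
proof (intro conjI allI)
  note * = holder_bilinear[OF P holder_bdD(1)[OF f] holder_bdD(2)[OF f] holder_bdD(1)[OF g] holder_bdD(2)[OF g]]
  have "0 \<le> K * L"
    using holder_bd_nonneg[OF f] holder_bd_nonneg[OF g] by simp
  then show "norm (P (f x) (g x)) \<le> 2 * K * L" for x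
    using *(1)[of x] by linarith
  show "norm (P (f x) (g x) - P (f y) (g y)) \<le> 2 * K * L * dist x y powr \<kappa>" for x y
    using *(2)[of x y] by simp
qed

lemmas holder_bd_scaleR = holder_bd_bilinear[OF bounded_bilinear_scaleR norm_scaleR[THEN eq_refl, folded real_norm_def]]
lemmas holder_bd_mult = holder_bd_bilinear[OF bounded_bilinear_mult norm_mult_ineq]
lemmas holder_bd_inner = holder_bd_bilinear[OF bounded_bilinear_inner Cauchy_Schwarz_ineq2[folded real_norm_def]]

text \<open>Testing along \<open>D\<close> itself suffices: a short step in that direction changes
  \<open>f\<close> by nearly \<open>norm D\<close> times its length.\<close>

lemma norm_gradient_le:
  fixes f :: "'a::euclidean_space \<Rightarrow> real"
  assumes "(f has_derivative (\<lambda>h. D \<bullet> h)) (at x)" "\<And>h. \<bar>f (x + h) - f x\<bar> \<le> c * norm h"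
  shows "norm D \<le> c"
proof (rule ccontr)
  assume "\<not> norm D \<le> c"
  then have c: "c < norm D" by simp
  have c0: "0 \<le> c"
    using order_trans[OF abs_ge_zero assms(2)[of "SOME b. b \<in> Basis"]]
    by (simp add: zero_le_mult_iff)
  define e where "e = (norm D - c) / 2"
  have "e > 0" using c by (simp add: e_def)
  then obtain d where d: "d > 0"
    "\<And>y. norm (y - x) < d \<Longrightarrow> norm (f y - f x - D \<bullet> (y - x)) \<le> e * norm (y - x)"
    using assms(1)[unfolded has_derivative_at_alt] by blast
  have D: "norm D > 0" using c c0 by linarith
  define s where "s = d / (2 * norm D)"
  have s: "s > 0" using d D by (simp add: s_def)
  have "norm ((x + s *\<^sub>R D) - x) < d"
    using d D by (simp add: s_def)
  from d(2)[OF this] have "\<bar>f (x + s *\<^sub>R D) - f x - s * (norm D)\<^sup>2\<bar> \<le> e * (s * norm D)"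
    using s by (simp add: power2_norm_eq_inner)
  moreover have "\<bar>f (x + s *\<^sub>R D) - f x\<bar> \<le> c * (s * norm D)"
    using assms(2)[of "s *\<^sub>R D"] s by simp
  ultimately have "s * (norm D)\<^sup>2 \<le> (e + c) * (s * norm D)"
    by (simp add: algebra_simps abs_le_iff)
  then have "(s * norm D) * norm D \<le> (s * norm D) * (e + c)"
    by (simp add: power2_eq_square algebra_simps)
  then have "norm D \<le> e + c" using s D by (simp add: mult_le_cancel_left)
  then show False using c by (simp add: e_def field_simps)
qed

section \<open>Calculus with quantitative \<open>C\<^sup>1\<close> bounds\<close>

lemma C1_bdD:
  assumes "C1_bd \<gamma> K w w'"
  shows "\<bar>w x\<bar> \<le> K" "norm (w' x) \<le> K" "norm (w' x - w' y) \<le> K * dist x y powr \<gamma>"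
    "\<bar>w (x + h) - w x - w' x \<bullet> h\<bar> \<le> K * norm h powr (1 + \<gamma>)" "holder_bd \<gamma> K w'"
  using assms by (auto simp: C1_bd_def holder_bd_def)

lemma C1_bd_nonneg: "C1_bd \<gamma> K w w' \<Longrightarrow> 0 \<le> K"
  using C1_bdD(1) by (meson abs_ge_zero order_trans)

lemma C1_bd_mono:
  assumes "C1_bd \<gamma> K w w'" "K \<le> K'"
  shows "C1_bd \<gamma> K' w w'"
  unfolding C1_bd_def
proof (intro conjI allI)
  show "\<bar>w x\<bar> \<le> K'" for x using C1_bdD(1)[OF assms(1), of x] assms(2) by simp
  show "holder_bd \<gamma> K' w'" using C1_bdD(5)[OF assms(1)] assms(2) by (rule holder_bd_mono)
  show "\<bar>w (x + h) - w x - w' x \<bullet> h\<bar> \<le> K' * norm h powr (1 + \<gamma>)" for x h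
    using C1_bdD(4)[OF assms(1), of x h] mult_right_mono[OF assms(2), of "norm h powr (1 + \<gamma>)"]
    by simp
qed

lemma C1_bd_has_derivative:
  assumes "C1_bd \<gamma> K w w'" "0 < \<gamma>"
  shows "(w has_derivative (\<lambda>h. w' x \<bullet> h)) (at x)"
  unfolding has_derivative_at
proof (intro conjI)
  show "bounded_linear (\<lambda>h. w' x \<bullet> h)" by (rule bounded_linear_inner_right)
  have "((\<lambda>h. K * norm h powr \<gamma>) \<longlongrightarrow> K * norm (0::'a) powr \<gamma>) (at 0)"
    by (intro tendsto_mult tendsto_const tendsto_powr' tendsto_norm tendsto_ident_at) (use assms(2) in \<open>auto simp: tendsto_norm_zero\<close>)
  then have "((\<lambda>h. K * norm h powr \<gamma>) \<longlongrightarrow> 0) (at (0::'a))" by simp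
  then show "(\<lambda>h. norm (w (x + h) - w x - w' x \<bullet> h) / norm h) \<midarrow>0\<rightarrow> 0"
  proof (rule Lim_null_comparison[rotated])
    have "\<bar>w (x + h) - w x - w' x \<bullet> h\<bar> / norm h \<le> K * norm h powr \<gamma>" if "h \<noteq> 0" for h
      using C1_bdD(4)[OF assms(1), of x h] that
      by (simp add: powr_add field_simps)
    then show "\<forall>\<^sub>F h in at 0. norm (norm (w (x + h) - w x - w' x \<bullet> h) / norm h) \<le> K * norm h powr \<gamma>"
      by (auto simp: eventually_at_filter)
  qed
qed

lemma C1_bd_continuous:
  assumes "C1_bd \<gamma> K w w'" "0 < \<gamma>"
  shows "continuous_on UNIV w" "continuous_on UNIV w'"
  by (rule has_derivative_continuous_on[OF has_derivative_at_withinI[OF C1_bd_has_derivative[OF assms]]])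
     (rule holder_bd_continuous[OF C1_bdD(5)[OF assms(1)] assms(2)])

lemma abs_diff_le_gradient:
  fixes f :: "'a::euclidean_space \<Rightarrow> real"
  assumes "convex S" "\<And>x. x \<in> S \<Longrightarrow> (f has_derivative (\<lambda>h. D x \<bullet> h)) (at x)"
    "\<And>x. x \<in> S \<Longrightarrow> norm (D x) \<le> B" "x \<in> S" "y \<in> S"
  shows "\<bar>f x - f y\<bar> \<le> B * norm (x - y)"
proof -
  have "onorm (\<lambda>h. D z \<bullet> h) \<le> B" if "z \<in> S" for z
  proof (rule onorm_bound)
    show "0 \<le> B" using assms(3)[OF that] norm_ge_zero order_trans by blast
    show "norm (D z \<bullet> h) \<le> B * norm h" for h
      using Cauchy_Schwarz_ineq2[of "D z" h] mult_right_mono[OF assms(3)[OF that], of "norm h"]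
      by simp
  qed
  then show ?thesis
    using differentiable_bound[OF assms(1), of f "\<lambda>z h. D z \<bullet> h" B x y] assms
    by (auto intro: has_derivative_at_withinI)
qed

lemma C1_bd_lipschitz:
  assumes "C1_bd \<gamma> K w w'" "0 < \<gamma>"
  shows "holder_bd 1 K w"
  unfolding holder_bd_def
proof (intro conjI allI)
  show "norm (w x) \<le> K" for x using C1_bdD(1)[OF assms(1)] by simp
  show "norm (w x - w y) \<le> K * dist x y powr 1" for x y
    using abs_diff_le_gradient[OF convex_UNIV C1_bd_has_derivative[OF assms] C1_bdD(2)[OF assms(1)]]
    by (simp add: dist_norm)
qed

text \<open>Mean value inequality for the difference of \<open>w\<close> and its translate by
  \<open>x' - x\<close>: the gradient of that difference is controlled by the Hoelder modulus of
  \<open>w'\<close>.\<close>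

lemma C1_bd_second_difference:
  assumes "C1_bd \<gamma> K w w'" "0 < \<gamma>"
  shows "\<bar>(w (x + y) - w x) - (w (x' + y) - w x')\<bar> \<le> K * norm y * dist x x' powr \<gamma>"
proof -
  have "((\<lambda>z. w z - w (z + (x' - x))) has_derivative (\<lambda>h. (w' z - w' (z + (x' - x))) \<bullet> h)) (at z)" for z
    unfolding inner_diff_left
    by (intro has_derivative_diff C1_bd_has_derivative[OF assms]
        has_derivative_compose[of "\<lambda>z. z + (x' - x)" "\<lambda>h. h" z UNIV w, OF _ C1_bd_has_derivative[OF assms]])
       (auto intro!: derivative_eq_intros)
  moreover have "norm (w' z - w' (z + (x' - x))) \<le> K * dist x x' powr \<gamma>" for z
    using C1_bdD(3)[OF assms(1), of z "z + (x' - x)"] by (simp add: dist_norm norm_minus_commute)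
  ultimately have "\<bar>(w (x + y) - w (x + y + (x' - x))) - (w x - w (x + (x' - x)))\<bar>
      \<le> K * dist x x' powr \<gamma> * norm (x + y - x)"
    by (intro abs_diff_le_gradient[OF convex_UNIV, where D="\<lambda>z. w' z - w' (z + (x' - x))"]) auto
  moreover have "x + y + (x' - x) = x' + y" by simp
  ultimately show ?thesis by (simp add: algebra_simps)
qed

text \<open>Subtracting the linear part at \<open>x\<close> leaves a function whose gradient is at
  most \<open>N * norm h powr \<gamma>\<close> on the ball of radius \<open>norm h\<close>, which is
  convex.\<close>

lemma taylor_of_gradient_holder:
  fixes w :: "'a::euclidean_space \<Rightarrow> real"
  assumes D: "\<And>x. (w has_derivative (\<lambda>h. w' x \<bullet> h)) (at x)"
    and H: "\<And>x y. norm (w' x - w' y) \<le> N * dist x y powr \<gamma>" and "0 < \<gamma>" "0 \<le> N"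
  shows "\<bar>w (x + h) - w x - w' x \<bullet> h\<bar> \<le> N * norm h powr (1 + \<gamma>)"
proof -
  have "((\<lambda>z. w z - w' x \<bullet> z) has_derivative (\<lambda>h. (w' z - w' x) \<bullet> h)) (at z)" for z
    unfolding inner_diff_left by (intro has_derivative_diff D) (auto intro!: derivative_eq_intros)
  moreover have "norm (w' z - w' x) \<le> N * norm h powr \<gamma>" if "z \<in> cball x (norm h)" for z
  proof -
    have "dist z x powr \<gamma> \<le> norm h powr \<gamma>"
      using that assms(3) by (intro powr_mono2) (auto simp: dist_commute)
    then have "N * dist z x powr \<gamma> \<le> N * norm h powr \<gamma>"
      using assms(4) by (rule mult_left_mono)
    then show ?thesis using H[of z x] by linarith
  qed
  ultimately have "\<bar>(w (x + h) - w' x \<bullet> (x + h)) - (w x - w' x \<bullet> x)\<bar> \<le> (N * norm h powr \<gamma>) * norm (x + h - x)"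
    by (intro abs_diff_le_gradient[of "cball x (norm h)", where D="\<lambda>z. w' z - w' x"]) (auto simp: dist_norm)
  then show ?thesis
    by (simp add: inner_add_right powr_add powr_one' algebra_simps split: if_splits)
qed

lemma C1_bdI:
  fixes w :: "'a::euclidean_space \<Rightarrow> real"
  assumes D: "\<And>x. (w has_derivative (\<lambda>h. w' x \<bullet> h)) (at x)"
    and "\<And>x. \<bar>w x\<bar> \<le> K" and H: "holder_bd \<gamma> K w'" and "0 < \<gamma>"
  shows "C1_bd \<gamma> K w w'"
  unfolding C1_bd_def
  using assms(2) H taylor_of_gradient_holder[OF D holder_bdD(2)[OF H] assms(4) holder_bd_nonneg[OF H]] by blast

text \<open>With \<open>\<eta> = y - x\<close> fixed, the second difference is the increment in
  \<open>h\<close> of \<open>w\<close> translated by \<open>\<eta>\<close> minus \<open>w\<close>,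
  so it bounds the gradient of that function.\<close>

lemma gradient_holder_of_second_difference:
  fixes w :: "'a::euclidean_space \<Rightarrow> real"
  assumes D: "\<And>x. (w has_derivative (\<lambda>h. w' x \<bullet> h)) (at x)"
    and 2: "\<And>x h \<eta>. \<bar>incr2 w x \<eta> h\<bar> \<le> K * norm h * norm \<eta> powr \<gamma>"
  shows "norm (w' y - w' x) \<le> K * dist y x powr \<gamma>"
proof -
  have "((\<lambda>z. w (z + (y - x)) - w z) has_derivative (\<lambda>h. (w' (x + (y - x)) - w' x) \<bullet> h)) (at x)"
    unfolding inner_diff_left
    by (intro has_derivative_diff D has_derivative_compose[of "\<lambda>z. z + (y - x)" "\<lambda>h. h" x UNIV w, OF _ D])
       (auto intro!: derivative_eq_intros)
  then have "norm (w' (x + (y - x)) - w' x) \<le> K * norm (y - x) powr \<gamma>"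
    by (rule norm_gradient_le) (use 2[of x "y - x"] in \<open>auto simp: algebra_simps\<close>)
  then show ?thesis by (simp add: dist_norm)
qed

lemma C1_bd_of_differences:
  fixes w :: "'a::euclidean_space \<Rightarrow> real"
  assumes D: "\<And>x. (w has_derivative (\<lambda>h. w' x \<bullet> h)) (at x)"
    and "\<And>x. \<bar>w x\<bar> \<le> K" "\<And>x h. \<bar>w (x + h) - w x\<bar> \<le> K * norm h"
    and 2: "\<And>x h \<eta>. \<bar>incr2 w x \<eta> h\<bar> \<le> K * norm h * norm \<eta> powr \<gamma>"
    and "0 < \<gamma>"
  shows "C1_bd \<gamma> K w w'"
proof (rule C1_bdI[OF D assms(2) _ assms(5)])
  show "holder_bd \<gamma> K w'"
    unfolding holder_bd_def
  proof (intro conjI allI)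
    show "norm (w' x) \<le> K" for x
      by (rule norm_gradient_le[OF D assms(3)])
    show "norm (w' y - w' x) \<le> K * dist y x powr \<gamma>" for y x
      by (rule gradient_holder_of_second_difference[OF D 2])
  qed
qed

lemma C1_bd_exponent:
  assumes "C1_bd \<gamma> K w w'" "0 < \<gamma>'" "\<gamma>' \<le> \<gamma>"
  shows "C1_bd \<gamma>' (2 * K) w w'"
proof (rule C1_bdI)
  show "(w has_derivative (\<lambda>h. w' x \<bullet> h)) (at x)" for x
    by (rule C1_bd_has_derivative[OF assms(1)]) (use assms in auto)
  show "\<bar>w x\<bar> \<le> 2 * K" for x
    using C1_bdD(1)[OF assms(1), of x] C1_bd_nonneg[OF assms(1)] by linarith
  show "holder_bd \<gamma>' (2 * K) w'"
    using C1_bdD(5)[OF assms(1)] assms(2,3) by (rule holder_bd_exponent)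
qed (use assms in auto)

lemma C1_bd_add:
  assumes "C1_bd \<gamma> K v v'" "C1_bd \<gamma> L w w'" "0 < \<gamma>"
  shows "C1_bd \<gamma> (K + L) (\<lambda>x. v x + w x) (\<lambda>x. v' x + w' x)"
proof (rule C1_bdI)
  show "((\<lambda>x. v x + w x) has_derivative (\<lambda>h. (v' x + w' x) \<bullet> h)) (at x)" for x
    unfolding inner_add_left
    by (intro has_derivative_add C1_bd_has_derivative[OF assms(1,3)] C1_bd_has_derivative[OF assms(2,3)])
  show "\<bar>v x + w x\<bar> \<le> K + L" for x
    using C1_bdD(1)[OF assms(1), of x] C1_bdD(1)[OF assms(2), of x] by linarith
  show "holder_bd \<gamma> (K + L) (\<lambda>x. v' x + w' x)"
    using C1_bdD(5)[OF assms(1)] C1_bdD(5)[OF assms(2)] by (rule holder_bd_add)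
qed fact

lemma C1_bd_cmult:
  assumes "C1_bd \<gamma> K w w'" "0 < \<gamma>"
  shows "C1_bd \<gamma> (\<bar>c\<bar> * K) (\<lambda>x. c * w x) (\<lambda>x. c *\<^sub>R w' x)"
proof (rule C1_bdI)
  show "((\<lambda>x. c * w x) has_derivative (\<lambda>h. (c *\<^sub>R w' x) \<bullet> h)) (at x)" for x
    unfolding inner_scaleR_left
    by (rule has_derivative_mult_right[OF C1_bd_has_derivative[OF assms]])
  show "\<bar>c * w x\<bar> \<le> \<bar>c\<bar> * K" for x
    using C1_bdD(1)[OF assms(1), of x] by (simp add: abs_mult mult_left_mono)
  show "holder_bd \<gamma> (\<bar>c\<bar> * K) (\<lambda>x. c *\<^sub>R w' x)"
    using C1_bdD(5)[OF assms(1)] by (rule holder_bd_cmult)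
qed fact

text \<open>Both factors are Lipschitz, and \<open>\<gamma> \<le> 1\<close> lets them enter with
  exponent \<open>\<gamma>\<close> at the cost of a factor 2. Each of the two terms of the product
  gradient then costs \<open>4 * K * L\<close>.\<close>

lemma C1_bd_mult:
  assumes v: "C1_bd \<gamma> K v v'" and w: "C1_bd \<gamma> L w w'" and \<gamma>: "0 < \<gamma>" "\<gamma> \<le> 1"
  shows "C1_bd \<gamma> (8 * K * L) (\<lambda>x. v x * w x) (\<lambda>x. v x *\<^sub>R w' x + w x *\<^sub>R v' x)"
proof (rule C1_bdI)
  show "((\<lambda>x. v x * w x) has_derivative (\<lambda>h. (v x *\<^sub>R w' x + w x *\<^sub>R v' x) \<bullet> h)) (at x)" for x
    by (rule has_derivative_eq_rhs[OF has_derivative_mult[OF C1_bd_has_derivative[OF v \<gamma>(1)]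
          C1_bd_has_derivative[OF w \<gamma>(1)]]]) (simp add: fun_eq_iff inner_add_left)
  have KL: "0 \<le> K" "0 \<le> L" using C1_bd_nonneg[OF v] C1_bd_nonneg[OF w] by auto
  show "\<bar>v x * w x\<bar> \<le> 8 * K * L" for x
  proof -
    have "\<bar>v x * w x\<bar> \<le> K * L"
      unfolding abs_mult using C1_bdD(1)[OF v, of x] C1_bdD(1)[OF w, of x] KL
      by (intro mult_mono) auto
    also have "\<dots> \<le> 8 * K * L" using KL by simp
    finally show ?thesis .
  qed
  have "holder_bd \<gamma> (2 * K) v" "holder_bd \<gamma> (2 * L) w"
    using C1_bd_lipschitz[OF v \<gamma>(1)] C1_bd_lipschitz[OF w \<gamma>(1)] \<gamma> by (auto intro: holder_bd_exponent)
  then have "holder_bd \<gamma> (2 * (2 * K) * L + 2 * (2 * L) * K) (\<lambda>x. v x *\<^sub>R w' x + w x *\<^sub>R v' x)"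
    using C1_bdD(5)[OF v] C1_bdD(5)[OF w] by (intro holder_bd_add holder_bd_scaleR)
  then show "holder_bd \<gamma> (8 * K * L) (\<lambda>x. v x *\<^sub>R w' x + w x *\<^sub>R v' x)"
    by (rule holder_bd_mono) simp
qed fact

text \<open>The Taylor inequality for a step of length \<open>\<delta>\<close> in the direction of
  \<open>w' x\<close>. The scale stays free: the absorption argument fixes a small one, and the
  limit of large \<open>lam\<close> lets it depend on \<open>lam\<close>.\<close>

lemma gradient_interpolation:
  fixes w :: "'a::euclidean_space \<Rightarrow> real"
  assumes "0 < \<delta>" "\<And>x. \<bar>w x\<bar> \<le> M"
    and N: "\<And>x h. \<bar>w (x + h) - w x - w' x \<bullet> h\<bar> \<le> N * norm h powr (1 + \<gamma>)"
  shows "norm (w' x) \<le> 2 * M / \<delta> + N * \<delta> powr \<gamma>"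
proof (cases "w' x = 0")
  case True
  have "0 \<le> M" using assms(2) abs_ge_zero order_trans by blast
  moreover have "0 \<le> N"
    using order_trans[OF abs_ge_zero N[of 0 "SOME b. b \<in> Basis"]] by simp
  ultimately show ?thesis using True assms(1) by simp
next
  case False
  define h where "h = (\<delta> / norm (w' x)) *\<^sub>R w' x"
  have h: "norm h = \<delta>" "w' x \<bullet> h = \<delta> * norm (w' x)"
    using False assms(1) by (simp_all add: h_def dot_square_norm power2_eq_square)
  have "\<delta> * norm (w' x) \<le> 2 * M + N * \<delta> powr (1 + \<gamma>)"
    using N[of x h] assms(2)[of x] assms(2)[of "x + h"] unfolding h by (simp add: abs_le_iff)
  then show ?thesis
    using assms(1) by (simp add: powr_add field_simps)
qed

lemma C1_bd_avg:
  assumes w: "C1_bd \<gamma> K w w'" "0 < \<gamma>" and P: "prob_space P" "\<phi> \<in> borel_measurable P"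
  shows "C1_bd \<gamma> K (\<lambda>x. \<integral>y. w (x + \<phi> y) \<partial>P) (\<lambda>x. \<integral>y. w' (x + \<phi> y) \<partial>P)"
proof -
  interpret prob_space P by fact
  have [measurable]: "w \<in> borel_measurable borel" "w' \<in> borel_measurable borel" "\<phi> \<in> borel_measurable P"
    using C1_bd_continuous[OF w] P by (auto intro: borel_measurable_continuous_onI)
  have i: "integrable P (\<lambda>y. w (x + \<phi> y))" "integrable P (\<lambda>y. w' (x + \<phi> y))" for x
    using C1_bdD(1,2)[OF w(1)] by (auto intro!: integrable_const_bound[where B=K])
  show ?thesis
    unfolding C1_bd_def holder_bd_def
  proof (intro conjI allI)
    show "\<bar>\<integral>y. w (x + \<phi> y) \<partial>P\<bar> \<le> K" for x
      using norm_expectation_le[of "\<lambda>y. w (x + \<phi> y)" K] C1_bdD(1)[OF w(1)] by simp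
    show "norm (\<integral>y. w' (x + \<phi> y) \<partial>P) \<le> K" for x
      using C1_bdD(2)[OF w(1)] by (intro norm_expectation_le)
    show "norm ((\<integral>y. w' (x + \<phi> y) \<partial>P) - (\<integral>y. w' (z + \<phi> y) \<partial>P)) \<le> K * dist x z powr \<gamma>" for x z
    proof -
      have "norm (\<integral>y. w' (x + \<phi> y) - w' (z + \<phi> y) \<partial>P) \<le> K * dist x z powr \<gamma>"
        using C1_bdD(3)[OF w(1), of "x + \<phi> y" "z + \<phi> y" for y] by (intro norm_expectation_le) auto
      then show ?thesis using i by simp
    qed
    show "\<bar>(\<integral>y. w (x + h + \<phi> y) \<partial>P) - (\<integral>y. w (x + \<phi> y) \<partial>P) - (\<integral>y. w' (x + \<phi> y) \<partial>P) \<bullet> h\<bar>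
        \<le> K * norm h powr (1 + \<gamma>)" for x h
    proof -
      have "(\<integral>y. w (x + h + \<phi> y) \<partial>P) - (\<integral>y. w (x + \<phi> y) \<partial>P) - (\<integral>y. w' (x + \<phi> y) \<partial>P) \<bullet> h
          = (\<integral>y. w (x + h + \<phi> y) - w (x + \<phi> y) - w' (x + \<phi> y) \<bullet> h \<partial>P)"
        using i by simp
      moreover have "norm (\<integral>y. w (x + h + \<phi> y) - w (x + \<phi> y) - w' (x + \<phi> y) \<bullet> h \<partial>P) \<le> K * norm h powr (1 + \<gamma>)"
      proof (rule norm_expectation_le)
        show "norm (w (x + h + \<phi> y) - w (x + \<phi> y) - w' (x + \<phi> y) \<bullet> h) \<le> K * norm h powr (1 + \<gamma>)" for y
          using C1_bdD(4)[OF w(1), of "x + \<phi> y" h] by (simp add: add_ac)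
      qed
      ultimately show ?thesis by simp
    qed
  qed
qed

text \<open>The Taylor inequality bounds the gradient of \<open>w\<^sub>m - w\<^sub>n\<close> by difference quotients of
  \<open>w\<^sub>m - w\<^sub>n\<close>, so the gradients form a Cauchy sequence.\<close>

lemma C1_bd_limit:
  fixes w :: "nat \<Rightarrow> 'a::euclidean_space \<Rightarrow> real"
  assumes w: "\<And>n. C1_bd \<gamma> K (w n) (w' n)" and "0 < \<gamma>" and lim: "\<And>x. (\<lambda>n. w n x) \<longlonglongrightarrow> u x"
  obtains u' where "C1_bd \<gamma> K u u'" "\<And>x. (\<lambda>n. w' n x) \<longlonglongrightarrow> u' x"
proof -
  have K: "0 \<le> K" using C1_bd_nonneg[OF w] .
  have "convergent (\<lambda>n. w' n x)" for x
  proof (rule Cauchy_convergent)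
    have "convergent (\<lambda>n. w' n x \<bullet> b)" if b: "b \<in> Basis" for b
    proof (rule Cauchy_convergent, rule metric_CauchyI)
      fix e :: real assume e: "e > 0"
      \<comment> \<open>At this scale each of the two Taylor errors is at most
        \<open>s * (e / 4)\<close>, and the convergent increments between the two fixed points may
        use the remaining \<open>s * (e / 2)\<close>. The \<open>+ 1\<close> guards against
        \<open>K = 0\<close>.\<close>
      define s where "s = (e / (4 * (K + 1))) powr (1 / \<gamma>)"
      have s: "s > 0" "s powr \<gamma> = e / (4 * (K + 1))"
        using e K assms(2) by (auto simp: s_def powr_powr)
      have Ks: "K * s powr \<gamma> \<le> e / 4"
        unfolding s using e K by (simp add: field_simps)
      have "Cauchy (\<lambda>n. w n (x + s *\<^sub>R b) - w n x)"
        by (intro LIMSEQ_imp_Cauchy[OF tendsto_diff[OF lim lim]])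
      then obtain N where N: "\<And>m n. m \<ge> N \<Longrightarrow> n \<ge> N \<Longrightarrow>
          dist (w m (x + s *\<^sub>R b) - w m x) (w n (x + s *\<^sub>R b) - w n x) < s * (e / 2)"
        using metric_CauchyD[of "\<lambda>n. w n (x + s *\<^sub>R b) - w n x" "s * (e / 2)"] s(1) e by auto
      show "\<exists>N. \<forall>m\<ge>N. \<forall>n\<ge>N. dist (w' m x \<bullet> b) (w' n x \<bullet> b) < e"
      proof (intro exI[of _ N] allI impI)
        fix m n assume mn: "m \<ge> N" "n \<ge> N"
        have *: "\<bar>w k (x + s *\<^sub>R b) - w k x - s * (w' k x \<bullet> b)\<bar> \<le> s * (e / 4)" for k
        proof -
          have "\<bar>w k (x + s *\<^sub>R b) - w k x - s * (w' k x \<bullet> b)\<bar> \<le> K * (s * s powr \<gamma>)"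
            using C1_bdD(4)[OF w, of k x "s *\<^sub>R b"] b s by (simp add: powr_add)
          also have "\<dots> \<le> s * (e / 4)"
            using mult_left_mono[OF Ks, of s] s by (simp add: algebra_simps)
          finally show ?thesis .
        qed
        have "s * \<bar>w' m x \<bullet> b - w' n x \<bullet> b\<bar> = \<bar>s * (w' m x \<bullet> b) - s * (w' n x \<bullet> b)\<bar>"
          using s by (simp add: abs_mult right_diff_distrib[symmetric])
        also have "\<dots> < s * e"
          using *[of m] *[of n] N[OF mn] unfolding dist_real_def times_divide_eq_right by linarith
        finally show "dist (w' m x \<bullet> b) (w' n x \<bullet> b) < e"
          using s by (simp add: dist_real_def)
      qed
    qed
    then have "(\<lambda>n. \<Sum>b\<in>Basis. (w' n x \<bullet> b) *\<^sub>R b) \<longlonglongrightarrow> (\<Sum>b\<in>Basis. lim (\<lambda>n. w' n x \<bullet> b) *\<^sub>R b)"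
      by (intro tendsto_sum tendsto_scaleR tendsto_const convergent_LIMSEQ_iff[THEN iffD1])
    then show "Cauchy (\<lambda>n. w' n x)"
      unfolding euclidean_representation by (rule LIMSEQ_imp_Cauchy)
  qed
  then have lim': "(\<lambda>n. w' n x) \<longlonglongrightarrow> lim (\<lambda>n. w' n x)" for x
    by (rule convergent_LIMSEQ_iff[THEN iffD1])
  have "C1_bd \<gamma> K u (\<lambda>x. lim (\<lambda>n. w' n x))"
    unfolding C1_bd_def holder_bd_def
  proof (intro conjI allI)
    show "\<bar>u x\<bar> \<le> K" for x
      by (rule LIMSEQ_le_const2[OF tendsto_rabs[OF lim]]) (use C1_bdD(1)[OF w] in auto)
    show "norm (lim (\<lambda>n. w' n x)) \<le> K" for x
      by (rule LIMSEQ_le_const2[OF tendsto_norm[OF lim']]) (use C1_bdD(2)[OF w] in auto)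
    show "norm (lim (\<lambda>n. w' n x) - lim (\<lambda>n. w' n y)) \<le> K * dist x y powr \<gamma>" for x y
      by (rule LIMSEQ_le_const2[OF tendsto_norm[OF tendsto_diff[OF lim' lim']]])
         (use C1_bdD(3)[OF w] in auto)
    show "\<bar>u (x + h) - u x - lim (\<lambda>n. w' n x) \<bullet> h\<bar> \<le> K * norm h powr (1 + \<gamma>)" for x h
      by (rule LIMSEQ_le_const2[OF tendsto_rabs[OF tendsto_diff[OF tendsto_diff[OF lim lim] tendsto_inner[OF lim' tendsto_const]]]])
         (use C1_bdD(4)[OF w] in auto)
  qed
  then show ?thesis using that lim' by blast
qed

subsection \<open>Gaussian bumps\<close>

text \<open>One Gaussian family serves three purposes: large \<open>c\<close> localizes near
  \<open>x0\<close> when the drift is frozen, \<open>c = 1\<close> produces an attained maximum, and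
  \<open>c\<close> tending to 0 approximates the constant 1 by integrable weights.\<close>

definition bump :: "real \<Rightarrow> 'a::euclidean_space \<Rightarrow> 'a \<Rightarrow> real"
  where "bump c x0 x = exp (- c * (norm (x - x0))\<^sup>2)"

definition bump_grad :: "real \<Rightarrow> 'a::euclidean_space \<Rightarrow> 'a \<Rightarrow> 'a"
  where "bump_grad c x0 x = (- 2 * c * bump c x0 x) *\<^sub>R (x - x0)"

lemma mult_exp_minus_le_1: "(s::real) * exp (- s) \<le> 1"
proof -
  have "s \<le> exp s" using exp_ge_add_one_self[of s] by linarith
  then show ?thesis by (simp add: exp_minus field_simps)
qed

lemma bump_bounds: "0 < bump c x0 x" "0 \<le> c \<Longrightarrow> bump c x0 x \<le> 1"
  by (simp_all add: bump_def)

lemma bump_center: "bump c x0 x0 = 1"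
  by (simp_all add: bump_def)

lemma bump_decay: "c * (norm (x - x0))\<^sup>2 * bump c x0 x \<le> 1"
  using mult_exp_minus_le_1[of "c * (norm (x - x0))\<^sup>2"] by (simp add: bump_def)

lemma bump_has_derivative: "(bump c x0 has_derivative (\<lambda>h. bump_grad c x0 x \<bullet> h)) (at x)"
  unfolding bump_def bump_grad_def power2_norm_eq_inner
  by (auto intro!: derivative_eq_intros simp: inner_commute algebra_simps)

text \<open>The Hessian is at most
  \<open>4 * c * (c * s\<^sup>2 * exp (- c * s\<^sup>2)) + 2 * c\<close> with \<open>s\<close> the
  distance to the centre, and the bracket is at most 1. Stating the bound through \<open>C\<close>
  keeps it uniform as \<open>c\<close> tends to 0.\<close>

lemma C1_bd_bump:
  assumes c: "0 \<le> c" "c \<le> C" "1 \<le> C"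
  shows "C1_bd 1 (6 * C) (bump c x0) (bump_grad c x0)"
proof (rule C1_bdI[OF bump_has_derivative])
  show "\<bar>bump c x0 x\<bar> \<le> 6 * C" for x
    using bump_bounds(1)[of c x0 x] bump_bounds(2)[OF c(1), of x0 x] c by linarith
  have 1: "(c * norm (x - x0) * bump c x0 x) \<le> C" for x
  proof (cases "norm (x - x0) \<le> 1")
    case True
    have "c * norm (x - x0) * bump c x0 x \<le> C * 1 * 1"
      using True c bump_bounds[of c x0 x] by (intro mult_mono) (auto simp: less_imp_le)
    then show ?thesis by simp
  next
    case False
    then have "c * norm (x - x0) * bump c x0 x \<le> c * (norm (x - x0))\<^sup>2 * bump c x0 x"
      using c bump_bounds(1)[of c x0 x]
      using mult_left_mono[of 1 "norm (x - x0)" "norm (x - x0)"]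
      by (intro mult_right_mono mult_left_mono) (auto simp: power2_eq_square less_imp_le)
    then show ?thesis using bump_decay[of c x x0] c by linarith
  qed
  show "holder_bd 1 (6 * C) (bump_grad c x0)"
    unfolding holder_bd_def
  proof (intro conjI allI)
    show "norm (bump_grad c x0 x) \<le> 6 * C" for x
    proof -
      have "norm (bump_grad c x0 x) = 2 * (c * norm (x - x0) * bump c x0 x)"
        using c bump_bounds(1)[of c x0 x] by (simp add: bump_grad_def abs_mult)
      then show ?thesis using 1[of x] c by linarith
    qed
    define D where "D x h = (- 2 * c * (bump_grad c x0 x \<bullet> h)) *\<^sub>R (x - x0) + (- 2 * c * bump c x0 x) *\<^sub>R h" for x h
    have D: "(bump_grad c x0 has_derivative D x) (at x)" for x
      unfolding bump_grad_def[of c x0, abs_def] D_def[abs_def]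
      by (auto intro!: derivative_eq_intros bump_has_derivative simp: bump_grad_def algebra_simps)
    have "onorm (D x) \<le> 6 * C" for x
    proof (rule onorm_bound)
      show "0 \<le> 6 * C" using c by simp
      fix h
      have "norm (D x h) \<le> \<bar>2 * c * (bump_grad c x0 x \<bullet> h)\<bar> * norm (x - x0) + \<bar>2 * c * bump c x0 x\<bar> * norm h"
        unfolding D_def by (rule order_trans[OF norm_triangle_ineq]) simp
      also have "\<dots> \<le> 2 * c * (norm (bump_grad c x0 x) * norm h) * norm (x - x0) + 2 * c * norm h"
        using c bump_bounds[of c x0 x] Cauchy_Schwarz_ineq2[of "bump_grad c x0 x" h]
        by (intro add_mono mult_mono) (auto simp: abs_mult mult_left_mono mult_left_le)
      also have "\<dots> = 4 * c * (c * (norm (x - x0))\<^sup>2 * bump c x0 x) * norm h + 2 * c * norm h"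
        using c bump_bounds(1)[of c x0 x] by (simp add: bump_grad_def power2_eq_square)
      also have "\<dots> \<le> 4 * c * 1 * norm h + 2 * c * norm h"
        using c by (intro add_mono mult_right_mono mult_left_mono bump_decay) auto
      also have "\<dots> \<le> 6 * C * norm h"
        using c mult_right_mono[of c C "norm h"] by simp
      finally show "norm (D x h) \<le> 6 * C * norm h" .
    qed
    then show "norm (bump_grad c x0 x - bump_grad c x0 y) \<le> 6 * C * dist x y powr 1" for x y
      using differentiable_bound[of UNIV "bump_grad c x0" D "6 * C" x y] D
      by (auto simp: dist_norm)
  qed
qed simp

text \<open>Beyond radius \<open>r\<close> the Gaussian beats the power. Seen through the bump, the
  oscillation of a \<open>\<beta>\<close>-Hoelder coefficient around the centre is thus of order
  \<open>r powr \<beta>\<close>, although the bump has no compact support.\<close>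

lemma bump_weight_le:
  fixes r s \<beta> :: real
  assumes "0 < r" "0 \<le> s" "0 < \<beta>" "\<beta> \<le> 1"
  shows "exp (- (1 / r\<^sup>2) * s\<^sup>2) * s powr \<beta> \<le> r powr \<beta>"
proof -
  have "(s / r) powr \<beta> \<le> exp ((s / r)\<^sup>2)"
  proof (cases "s \<le> r")
    case True
    then have "(s / r) powr \<beta> \<le> 1"
      using powr_mono2[of \<beta> "s / r" 1] assms True by simp
    also have "1 \<le> exp ((s / r)\<^sup>2)" by simp
    finally show ?thesis .
  next
    case False
    then have "(s / r) powr \<beta> \<le> (s / r) powr 2"
      using assms by (intro powr_mono) auto
    also have "\<dots> = (s / r)\<^sup>2"
      using assms False by (simp add: powr_numeral)
    also have "\<dots> \<le> exp ((s / r)\<^sup>2)"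
      using exp_ge_add_one_self[of "(s / r)\<^sup>2"] by linarith
    finally show ?thesis .
  qed
  then show ?thesis
    using assms by (simp add: powr_divide exp_minus field_simps)
qed

section \<open>The nonlocal operator\<close>

text \<open>The gradient is a separate argument, so that pairs of function and gradient can be
  averaged, multiplied and passed to the limit without differentiating again.\<close>

definition gen :: "'a::euclidean_space measure \<Rightarrow> ('a \<Rightarrow> real) \<Rightarrow> ('a \<Rightarrow> 'a) \<Rightarrow> 'a \<Rightarrow> real"
  where "gen \<nu> w w' x = (LINT y|\<nu>. w (x + y) - w x - indicat_real (cball 0 1) y * (y \<bullet> w' x))"

lemma levy_generator_eq_gen: "levy_generator \<nu> g = gen \<nu> g (grad g)"
  by (simp add: levy_generator_def gen_def fun_eq_iff)

text \<open>The carre du champ of \<open>r\<close> and \<open>v\<close>, that is, the defect in the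
  Leibniz rule for the nonlocal operator. It needs no compensator because a product of two
  increments is already quadratic in the jump.\<close>

definition comm :: "'a::euclidean_space measure \<Rightarrow> ('a \<Rightarrow> real) \<Rightarrow> ('a \<Rightarrow> real) \<Rightarrow> 'a \<Rightarrow> real"
  where "comm \<nu> r v x = (LINT y|\<nu>. (r (x + y) - r x) * (v (x + y) - v x))"

definition trunc_powr :: "real \<Rightarrow> 'a::euclidean_space \<Rightarrow> real"
  where "trunc_powr \<sigma> y = min 1 (norm y powr \<sigma>)"

lemma trunc_powr_simps:
  "0 \<le> \<sigma> \<Longrightarrow> norm y \<le> 1 \<Longrightarrow> trunc_powr \<sigma> y = norm y powr \<sigma>"
  "0 \<le> \<sigma> \<Longrightarrow> \<not> norm y \<le> 1 \<Longrightarrow> trunc_powr \<sigma> y = 1"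
  using powr_mono2[of \<sigma> "norm y" 1] ge_one_powr_ge_zero[of "norm y" \<sigma>]
  by (auto simp: trunc_powr_def)

lemma trunc_powr_nonneg: "0 \<le> trunc_powr \<sigma> y"
  by (simp add: trunc_powr_def)

lemma trunc_powr_measurable [measurable]: "trunc_powr \<sigma> \<in> borel_measurable borel"
  unfolding trunc_powr_def by measurable

lemma trunc_powr_antimono:
  assumes "0 \<le> \<sigma>" "\<sigma> \<le> \<sigma>'"
  shows "trunc_powr \<sigma>' y \<le> trunc_powr \<sigma> y"
proof (cases "norm y \<le> 1")
  case True
  then have "norm y powr \<sigma>' \<le> norm y powr \<sigma>"
    by (intro powr_mono') (use assms in auto)
  then show ?thesis
    using True assms by (simp add: trunc_powr_simps)
next
  case False
  then show ?thesis using assms by (simp add: trunc_powr_simps)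
qed

text \<open>A minimum lies below every weighted geometric mean. This is how powers of the jump size
  are traded for powers of the distance between two base points.\<close>

lemma min_le_powr_mult:
  fixes a d :: real
  assumes "0 \<le> a" "0 \<le> d" "0 \<le> s" "s \<le> 1"
  shows "min a d \<le> a powr (1 - s) * d powr s"
proof (cases "a \<le> d")
  case True
  have "a = a powr (1 - s) * a powr s"
    using assms by (simp add: powr_add[symmetric])
  also have "\<dots> \<le> a powr (1 - s) * d powr s"
    using True assms by (intro mult_left_mono powr_mono2) auto
  finally show ?thesis using True by simp
next
  case False
  have "d = d powr (1 - s) * d powr s"
    using assms by (simp add: powr_add[symmetric])
  also have "\<dots> \<le> a powr (1 - s) * d powr s"
    using False assms by (intro mult_right_mono powr_mono2) auto
  finally show ?thesis using False by simp
qed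

text \<open>The integrability assumption merges (H2) on the unit ball with the finiteness of the
  Levy measure away from the origin. The process does not enter at this level.\<close>

locale jump_measure = sigma_finite_measure \<nu> for \<nu> :: "'a::euclidean_space measure" +
  fixes \<alpha> :: real
  assumes sets_nu [measurable_cong]: "sets \<nu> = sets borel"
    and alpha: "1 \<le> \<alpha>" "\<alpha> < 2"
    and integrable_trunc_powr: "\<alpha> < \<sigma> \<Longrightarrow> integrable \<nu> (trunc_powr \<sigma>)"
begin

definition mom :: "real \<Rightarrow> real"
  where "mom \<sigma> = (\<integral>y. trunc_powr \<sigma> y \<partial>\<nu>)"

lemma mom_nonneg: "0 \<le> mom \<sigma>"
  unfolding mom_def by (simp add: trunc_powr_nonneg)

lemma integrable_of_trunc_bound:
  assumes "\<alpha> < \<sigma>" "f \<in> borel_measurable borel" "\<And>y. \<bar>f y\<bar> \<le> C * trunc_powr \<sigma> y"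
  shows "integrable \<nu> f" "\<bar>\<integral>y. f y \<partial>\<nu>\<bar> \<le> C * mom \<sigma>"
proof -
  have [measurable]: "f \<in> borel_measurable \<nu>"
    using assms(2) sets_nu by (simp cong: measurable_cong_sets)
  have i: "integrable \<nu> (\<lambda>y. C * trunc_powr \<sigma> y)"
    using integrable_trunc_powr[OF assms(1)] by simp
  show *: "integrable \<nu> f"
    by (rule Bochner_Integration.integrable_bound[OF i]) (use assms(3) in \<open>auto intro!: AE_I2 order_trans[OF assms(3)]\<close>)
  have "\<bar>\<integral>y. f y \<partial>\<nu>\<bar> \<le> (\<integral>y. \<bar>f y\<bar> \<partial>\<nu>)"
    using integral_norm_bound[of \<nu> f] by simp
  also have "\<dots> \<le> (\<integral>y. C * trunc_powr \<sigma> y \<partial>\<nu>)"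
    using * i assms(3) by (intro integral_mono) auto
  finally show "\<bar>\<integral>y. f y \<partial>\<nu>\<bar> \<le> C * mom \<sigma>" by (simp add: mom_def)
qed

abbreviation jump :: "('a \<Rightarrow> real) \<Rightarrow> ('a \<Rightarrow> 'a) \<Rightarrow> 'a \<Rightarrow> 'a \<Rightarrow> real"
  where "jump w w' x y \<equiv> w (x + y) - w x - indicat_real (cball 0 1) y * (y \<bullet> w' x)"

lemma jump_bound:
  assumes "C1_bd \<gamma> K w w'" "0 < \<gamma>"
  shows "\<bar>jump w w' x y\<bar> \<le> 2 * K * trunc_powr (1 + \<gamma>) y"
proof (cases "norm y \<le> 1")
  case True
  have "\<bar>jump w w' x y\<bar> \<le> K * norm y powr (1 + \<gamma>)"
    using C1_bdD(4)[OF assms(1), of x y] True by (simp add: inner_commute)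
  also have "\<dots> \<le> 2 * K * norm y powr (1 + \<gamma>)"
    using C1_bd_nonneg[OF assms(1)] by (intro mult_right_mono) auto
  finally show ?thesis using True assms by (simp add: trunc_powr_simps)
next
  case False
  then show ?thesis
    using C1_bdD(1)[OF assms(1), of x] C1_bdD(1)[OF assms(1), of "x + y"] assms(2)
    by (simp add: trunc_powr_simps)
qed

lemma jump_measurable:
  assumes "C1_bd \<gamma> K w w'" "0 < \<gamma>"
  shows "jump w w' x \<in> borel_measurable borel"
proof -
  have [measurable]: "w \<in> borel_measurable borel"
    using C1_bd_continuous[OF assms] by (intro borel_measurable_continuous_onI)
  have [measurable]: "(\<lambda>y. y \<bullet> w' x) \<in> borel_measurable borel"
    by (intro borel_measurable_continuous_onI continuous_intros)
  have [measurable]: "(indicat_real (cball 0 1) :: 'a \<Rightarrow> real) \<in> borel_measurable borel"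
    by (intro borel_measurable_indicator borel_closed closed_cball)
  show ?thesis by measurable
qed

lemma jump_integrable:
  assumes "C1_bd \<gamma> K w w'" "0 < \<gamma>" "\<alpha> < 1 + \<gamma>"
  shows "integrable \<nu> (jump w w' x)"
  using integrable_of_trunc_bound(1)[OF assms(3) jump_measurable[OF assms(1,2)] jump_bound[OF assms(1,2)]] .

lemma gen_bound:
  assumes "C1_bd \<gamma> K w w'" "0 < \<gamma>" "\<alpha> < 1 + \<gamma>"
  shows "\<bar>gen \<nu> w w' x\<bar> \<le> 2 * K * mom (1 + \<gamma>)"
  unfolding gen_def
  using integrable_of_trunc_bound(2)[OF assms(3) jump_measurable[OF assms(1,2)] jump_bound[OF assms(1,2)]] .

text \<open>For small jumps the difference of the integrands is at most
  \<open>2 * K * norm y\<close> times either \<open>norm y powr \<gamma>\<close> or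
  \<open>dist x x' powr \<gamma>\<close>. The geometric mean with weight
  \<open>\<kappa> / \<gamma>\<close> leaves the moment of order
  \<open>1 + \<gamma> - \<kappa>\<close>, which must exceed \<open>\<alpha>\<close>. For
  \<open>\<gamma> = \<alpha> + \<beta> - 1\<close> this keeps \<open>\<kappa>\<close> strictly below
  \<open>\<beta>\<close>, while a smooth function with \<open>\<gamma> = 1\<close> admits
  \<open>\<kappa> = \<beta>\<close>.\<close>

lemma gen_holder:
  assumes w: "C1_bd \<gamma> K w w'" and \<gamma>: "0 < \<gamma>" and \<kappa>: "0 < \<kappa>" "\<kappa> \<le> \<gamma>" "\<kappa> \<le> 1" "\<alpha> < 1 + \<gamma> - \<kappa>"
  shows "holder_bd \<kappa> (4 * K * mom (1 + \<gamma> - \<kappa>)) (gen \<nu> w w')"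
  unfolding holder_bd_def
proof (intro conjI allI)
  have K: "0 \<le> K" using w by (rule C1_bd_nonneg)
  fix x x'
  have "\<bar>jump w w' x y\<bar> \<le> 4 * K * trunc_powr (1 + \<gamma> - \<kappa>) y" for y
  proof -
    have "2 * K * trunc_powr (1 + \<gamma>) y \<le> 4 * K * trunc_powr (1 + \<gamma> - \<kappa>) y"
      using K \<kappa> by (intro mult_mono trunc_powr_antimono trunc_powr_nonneg) auto
    then show ?thesis using jump_bound[OF w \<gamma>, of x y] by linarith
  qed
  then show "norm (gen \<nu> w w' x) \<le> 4 * K * mom (1 + \<gamma> - \<kappa>)"
    unfolding gen_def real_norm_def
    by (rule integrable_of_trunc_bound(2)[OF \<kappa>(4) jump_measurable[OF w \<gamma>]])
  have i: "integrable \<nu> (jump w w' z)" for z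
    using \<kappa> by (intro jump_integrable[OF w \<gamma>]) auto
  have *: "\<bar>jump w w' x y - jump w w' x' y\<bar> \<le> (4 * K * dist x x' powr \<kappa>) * trunc_powr (1 + \<gamma> - \<kappa>) y" for y
  proof (cases "norm y \<le> 1")
    case True
    have "\<bar>jump w w' x y - jump w w' x' y\<bar> \<le> 2 * K * (norm y * norm y powr \<gamma>)"
      using jump_bound[OF w \<gamma>, of x y] jump_bound[OF w \<gamma>, of x' y] C1_bdD(4)[OF w, of x y]
        C1_bdD(4)[OF w, of x' y] True \<gamma> by (simp add: inner_commute powr_add abs_le_iff)
    moreover have "\<bar>jump w w' x y - jump w w' x' y\<bar> \<le> 2 * K * (norm y * dist x x' powr \<gamma>)"
    proof -
      have "\<bar>y \<bullet> (w' x - w' x')\<bar> \<le> norm y * (K * dist x x' powr \<gamma>)"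
        by (rule order_trans[OF Cauchy_Schwarz_ineq2 mult_left_mono[OF C1_bdD(3)[OF w]]]) simp
      then show ?thesis
        using C1_bd_second_difference[OF w \<gamma>, of x y x'] True by (simp add: inner_diff_right abs_le_iff algebra_simps)
    qed
    ultimately have "\<bar>jump w w' x y - jump w w' x' y\<bar> \<le> 2 * K * (norm y * min (norm y powr \<gamma>) (dist x x' powr \<gamma>))"
      by (simp add: min_def)
    also have "\<dots> \<le> 2 * K * (norm y * ((norm y powr \<gamma>) powr (1 - \<kappa> / \<gamma>) * (dist x x' powr \<gamma>) powr (\<kappa> / \<gamma>)))"
      using K \<kappa> \<gamma> by (intro mult_left_mono min_le_powr_mult) auto
    also have "\<dots> = 2 * K * (norm y powr (1 + (\<gamma> - \<kappa>)) * dist x x' powr \<kappa>)"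
      using \<gamma> by (simp add: powr_powr right_diff_distrib powr_add)
    also have "\<dots> \<le> 4 * K * (norm y powr (1 + (\<gamma> - \<kappa>)) * dist x x' powr \<kappa>)"
      using K by (intro mult_right_mono) auto
    finally show ?thesis using True \<kappa> by (simp add: trunc_powr_simps algebra_simps)
  next
    case False
    have "holder_bd \<kappa> (2 * K) w"
      by (rule holder_bd_exponent[OF C1_bd_lipschitz[OF w \<gamma>] \<kappa>(1,3)])
    from holder_bdD(2)[OF this, of x x'] holder_bdD(2)[OF this, of "x + y" "x' + y"]
    show ?thesis using False \<kappa> by (simp add: trunc_powr_simps abs_le_iff)
  qed
  have "\<bar>\<integral>y. jump w w' x y - jump w w' x' y \<partial>\<nu>\<bar> \<le> (4 * K * dist x x' powr \<kappa>) * mom (1 + \<gamma> - \<kappa>)"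
    by (rule integrable_of_trunc_bound(2)[OF \<kappa>(4) borel_measurable_diff[OF jump_measurable[OF w \<gamma>] jump_measurable[OF w \<gamma>]] *])
  then show "norm (gen \<nu> w w' x - gen \<nu> w w' x') \<le> 4 * K * mom (1 + \<gamma> - \<kappa>) * dist x x' powr \<kappa>"
    unfolding gen_def using i by (simp add: mult_ac)
qed

lemma gen_tendsto:
  assumes w: "\<And>n. C1_bd \<gamma> K (w n) (w' n)" and \<gamma>: "0 < \<gamma>" "\<alpha> < 1 + \<gamma>"
    and lim: "\<And>x. (\<lambda>n. w n x) \<longlonglongrightarrow> u x" "\<And>x. (\<lambda>n. w' n x) \<longlonglongrightarrow> u' x"
  shows "(\<lambda>n. gen \<nu> (w n) (w' n) x) \<longlonglongrightarrow> gen \<nu> u u' x"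
  unfolding gen_def
proof (rule integral_dominated_convergence[where w="\<lambda>y. 2 * K * trunc_powr (1 + \<gamma>) y"])
  have *: "(\<lambda>n. jump (w n) (w' n) x y) \<longlonglongrightarrow> jump u u' x y" for y
    by (intro tendsto_intros lim)
  have m: "jump (w n) (w' n) x \<in> borel_measurable \<nu>" for n
    using jump_measurable[OF w \<gamma>(1)] sets_nu by (simp cong: measurable_cong_sets)
  show "jump (w n) (w' n) x \<in> borel_measurable \<nu>" for n by (rule m)
  show "jump u u' x \<in> borel_measurable \<nu>"
    by (rule borel_measurable_LIMSEQ_real[OF _ m]) (rule *)
  show "AE y in \<nu>. (\<lambda>n. jump (w n) (w' n) x y) \<longlonglongrightarrow> jump u u' x y" using * by simp
  show "AE y in \<nu>. norm (jump (w n) (w' n) x y) \<le> 2 * K * trunc_powr (1 + \<gamma>) y" for n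
    using jump_bound[OF w \<gamma>(1)] by simp
  show "integrable \<nu> (\<lambda>y. 2 * K * trunc_powr (1 + \<gamma>) y)"
    using integrable_trunc_powr[OF \<gamma>(2)] by simp
qed

lemma gen_add:
  assumes "C1_bd \<gamma> K v v'" "C1_bd \<gamma> L w w'" "0 < \<gamma>" "\<alpha> < 1 + \<gamma>"
  shows "gen \<nu> (\<lambda>x. v x + w x) (\<lambda>x. v' x + w' x) x = gen \<nu> v v' x + gen \<nu> w w' x"
proof -
  have "gen \<nu> (\<lambda>x. v x + w x) (\<lambda>x. v' x + w' x) x = (\<integral>y. jump v v' x y + jump w w' x y \<partial>\<nu>)"
    unfolding gen_def by (intro Bochner_Integration.integral_cong refl) (simp add: inner_add_right algebra_simps)
  also have "\<dots> = gen \<nu> v v' x + gen \<nu> w w' x"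
    unfolding gen_def using jump_integrable[OF assms(1,3,4)] jump_integrable[OF assms(2,3,4)]
    by (rule Bochner_Integration.integral_add)
  finally show ?thesis .
qed

lemma gen_cmult: "gen \<nu> (\<lambda>x. c * w x) (\<lambda>x. c *\<^sub>R w' x) x = c * gen \<nu> w w' x"
  unfolding gen_def integral_mult_right_zero[symmetric]
  by (intro Bochner_Integration.integral_cong refl) (simp add: algebra_simps)

text \<open>The product of two Lipschitz increments is quadratic in the jump. Giving up the power
  \<open>\<beta>\<close> of the jump in exchange for \<open>dist x x' powr \<beta>\<close> leaves
  the order \<open>2 - \<beta>\<close>, still above \<open>\<alpha>\<close>; this is where
  \<open>\<alpha> + \<beta> < 2\<close> makes the commutator harmless.\<close>

lemma comm_integrand:
  fixes r v :: "'a \<Rightarrow> real"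
  assumes r: "holder_bd 1 P r" and v: "holder_bd 1 Q v" and \<beta>: "0 < \<beta>" "\<beta> < 1" "\<alpha> < 2 - \<beta>"
  shows "\<bar>(r (x + y) - r x) * (v (x + y) - v x)\<bar> \<le> 4 * P * Q * trunc_powr (2 - \<beta>) y" (is ?bd)
    and "\<bar>(r (x + y) - r x) * (v (x + y) - v x) - (r (x' + y) - r x') * (v (x' + y) - v x')\<bar>
      \<le> (16 * P * Q * dist x x' powr \<beta>) * trunc_powr (2 - \<beta>) y" (is ?hd)
    and "(\<lambda>y. (r (x + y) - r x) * (v (x + y) - v x)) \<in> borel_measurable borel"
proof -
  have PQ: "0 \<le> P" "0 \<le> Q" using holder_bd_nonneg r v by auto
  have [measurable]: "r \<in> borel_measurable borel" "v \<in> borel_measurable borel"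
    using holder_bd_continuous[OF r] holder_bd_continuous[OF v] by (auto intro: borel_measurable_continuous_onI)
  show "(\<lambda>y. (r (x + y) - r x) * (v (x + y) - v x)) \<in> borel_measurable borel" by measurable
  have lip: "\<bar>g (z + h) - g z\<bar> \<le> R * norm h" if "holder_bd 1 R g" for g :: "'a \<Rightarrow> real" and R z h
    using holder_bdD(2)[OF that, of "z + h" z] by (simp add: dist_norm)
  have sup: "\<bar>g (z + h) - g z\<bar> \<le> 2 * R" if "holder_bd 1 R g" for g :: "'a \<Rightarrow> real" and R z h
    using holder_bdD(1)[OF that, of "z + h"] holder_bdD(1)[OF that, of z] by (simp add: abs_le_iff)
  show ?bd
  proof (cases "norm y \<le> 1")
    case True
    have "\<bar>(r (x + y) - r x) * (v (x + y) - v x)\<bar> \<le> (P * norm y) * (Q * norm y)"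
      unfolding abs_mult by (intro mult_mono lip[OF r] lip[OF v]) (use PQ in auto)
    also have "\<dots> = P * Q * norm y powr 2"
      by (simp add: powr_numeral power2_eq_square)
    also have "\<dots> \<le> 4 * P * Q * norm y powr (2 - \<beta>)"
      using True \<beta> PQ by (intro mult_mono powr_mono') auto
    finally show ?thesis using True \<beta> by (simp add: trunc_powr_simps)
  next
    case False
    have "\<bar>(r (x + y) - r x) * (v (x + y) - v x)\<bar> \<le> (2 * P) * (2 * Q)"
      unfolding abs_mult by (intro mult_mono sup[OF r] sup[OF v]) (use PQ in auto)
    then show ?thesis using False \<beta> by (simp add: trunc_powr_simps)
  qed
  have split: "\<bar>(r (x + y) - r x) * (v (x + y) - v x) - (r (x' + y) - r x') * (v (x' + y) - v x')\<bar>
      \<le> A * D + C * B"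
    if "\<bar>(r (x + y) - r x) - (r (x' + y) - r x')\<bar> \<le> A" "\<bar>v (x + y) - v x\<bar> \<le> D"
      "\<bar>r (x' + y) - r x'\<bar> \<le> C" "\<bar>(v (x + y) - v x) - (v (x' + y) - v x')\<bar> \<le> B" for A B C D
  proof -
    have "(r (x + y) - r x) * (v (x + y) - v x) - (r (x' + y) - r x') * (v (x' + y) - v x')
      = ((r (x + y) - r x) - (r (x' + y) - r x')) * (v (x + y) - v x)
      + (r (x' + y) - r x') * ((v (x + y) - v x) - (v (x' + y) - v x'))"
      by (simp add: algebra_simps)
    also have "\<bar>\<dots>\<bar> \<le> \<bar>(r (x + y) - r x) - (r (x' + y) - r x')\<bar> * \<bar>v (x + y) - v x\<bar>
      + \<bar>r (x' + y) - r x'\<bar> * \<bar>(v (x + y) - v x) - (v (x' + y) - v x')\<bar>"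
      unfolding abs_mult[symmetric] by (rule abs_triangle_ineq)
    also have "\<dots> \<le> A * D + C * B"
      by (intro add_mono mult_mono that order_trans[OF abs_ge_zero that(1)] order_trans[OF abs_ge_zero that(3)] abs_ge_zero)
    finally show ?thesis .
  qed
  show ?hd
  proof (cases "norm y \<le> 1")
    case True
    have *: "\<bar>(g (x + y) - g x) - (g (x' + y) - g x')\<bar> \<le> 2 * R * (norm y powr (1 - \<beta>) * dist x x' powr \<beta>)"
      if g: "holder_bd 1 R g" for g :: "'a \<Rightarrow> real" and R
    proof -
      have "\<bar>(g (x + y) - g x) - (g (x' + y) - g x')\<bar> \<le> 2 * R * min (norm y) (dist x x')"
        using lip[OF g, of x y] lip[OF g, of x' y] lip[OF g, of x' "x - x'"] lip[OF g, of "x' + y" "x - x'"]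
        by (simp add: min_def dist_norm abs_le_iff algebra_simps)
      also have "\<dots> \<le> 2 * R * (norm y powr (1 - \<beta>) * dist x x' powr \<beta>)"
        using holder_bd_nonneg[OF g] \<beta> by (intro mult_left_mono min_le_powr_mult) auto
      finally show ?thesis .
    qed
    have "\<bar>(r (x + y) - r x) * (v (x + y) - v x) - (r (x' + y) - r x') * (v (x' + y) - v x')\<bar>
      \<le> (2 * P * (norm y powr (1 - \<beta>) * dist x x' powr \<beta>)) * (Q * norm y)
        + (P * norm y) * (2 * Q * (norm y powr (1 - \<beta>) * dist x x' powr \<beta>))"
      by (intro split *[OF r] *[OF v] lip[OF r] lip[OF v])
    also have "\<dots> = 4 * P * Q * (norm y powr (1 + (1 - \<beta>)) * dist x x' powr \<beta>)"
      by (simp only: powr_add) simp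
    also have "\<dots> \<le> 16 * P * Q * (norm y powr (1 + (1 - \<beta>)) * dist x x' powr \<beta>)"
      using PQ by (intro mult_right_mono) auto
    finally show ?thesis using True \<beta> by (simp add: trunc_powr_simps algebra_simps)
  next
    case False
    have *: "\<bar>(g (x + y) - g x) - (g (x' + y) - g x')\<bar> \<le> 4 * R * dist x x' powr \<beta>"
      if g: "holder_bd 1 R g" for g :: "'a \<Rightarrow> real" and R
    proof -
      have "holder_bd \<beta> (2 * R) g" using g \<beta> by (intro holder_bd_exponent) auto
      from holder_bdD(2)[OF this, of x x'] holder_bdD(2)[OF this, of "x + y" "x' + y"]
      show ?thesis by (simp add: abs_le_iff)
    qed
    have "\<bar>(r (x + y) - r x) * (v (x + y) - v x) - (r (x' + y) - r x') * (v (x' + y) - v x')\<bar>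
      \<le> (4 * P * dist x x' powr \<beta>) * (2 * Q) + (2 * P) * (4 * Q * dist x x' powr \<beta>)"
      by (intro split *[OF r] *[OF v] sup[OF r] sup[OF v])
    then show ?thesis using False \<beta> by (simp add: trunc_powr_simps)
  qed
qed

lemma comm_integrable:
  fixes r v :: "'a \<Rightarrow> real"
  assumes "holder_bd 1 P r" "holder_bd 1 Q v"
  shows "integrable \<nu> (\<lambda>y. (r (x + y) - r x) * (v (x + y) - v x))"
proof -
  \<comment> \<open>Integrability alone leaves the exponent free in the interval from 0 to
    \<open>2 - \<alpha>\<close>; the midpoint is taken.\<close>
  define \<beta> where "\<beta> = (2 - \<alpha>) / 2"
  have \<beta>: "0 < \<beta>" "\<beta> < 1" "\<alpha> < 2 - \<beta>" using alpha by (auto simp: \<beta>_def field_simps)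
  show ?thesis
    by (rule integrable_of_trunc_bound(1)[OF \<beta>(3) comm_integrand(3)[OF assms \<beta>] comm_integrand(1)[OF assms \<beta>]])
qed

lemma comm_holder:
  assumes r: "holder_bd 1 P r" and v: "holder_bd 1 Q v" and \<beta>: "0 < \<beta>" "\<beta> < 1" "\<alpha> < 2 - \<beta>"
  shows "holder_bd \<beta> (16 * P * Q * mom (2 - \<beta>)) (comm \<nu> r v)"
  unfolding holder_bd_def
proof (intro conjI allI)
  note m = comm_integrand(3)[OF r v \<beta>]
  fix x x'
  have "\<bar>comm \<nu> r v x\<bar> \<le> 4 * P * Q * mom (2 - \<beta>)"
    unfolding comm_def by (rule integrable_of_trunc_bound(2)[OF \<beta>(3) m comm_integrand(1)[OF r v \<beta>]])
  also have "\<dots> \<le> 16 * P * Q * mom (2 - \<beta>)"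
    using holder_bd_nonneg[OF r] holder_bd_nonneg[OF v] mom_nonneg by (intro mult_right_mono) auto
  finally show "norm (comm \<nu> r v x) \<le> 16 * P * Q * mom (2 - \<beta>)" by simp
  have "\<bar>\<integral>y. (r (x + y) - r x) * (v (x + y) - v x) - (r (x' + y) - r x') * (v (x' + y) - v x') \<partial>\<nu>\<bar>
      \<le> (16 * P * Q * dist x x' powr \<beta>) * mom (2 - \<beta>)"
    by (rule integrable_of_trunc_bound(2)[OF \<beta>(3) borel_measurable_diff[OF m m] comm_integrand(2)[OF r v \<beta>]])
  then show "norm (comm \<nu> r v x - comm \<nu> r v x') \<le> 16 * P * Q * mom (2 - \<beta>) * dist x x' powr \<beta>"
    unfolding comm_def using comm_integrable[OF r v] by (simp add: mult_ac)
qed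

text \<open>For each jump the increment of the product is \<open>r x\<close> times that of
  \<open>v\<close>, plus \<open>v x\<close> times that of \<open>r\<close>, plus the product of
  both. The compensator follows the ordinary Leibniz rule, so only the last term is new.\<close>

lemma gen_mult:
  assumes r: "C1_bd \<gamma> P r r'" and v: "C1_bd \<gamma> Q v v'" and \<gamma>: "0 < \<gamma>" "\<alpha> < 1 + \<gamma>"
  shows "gen \<nu> (\<lambda>x. r x * v x) (\<lambda>x. r x *\<^sub>R v' x + v x *\<^sub>R r' x) x
    = r x * gen \<nu> v v' x + v x * gen \<nu> r r' x + comm \<nu> r v x"
proof -
  note i = jump_integrable[OF r \<gamma>, of x] jump_integrable[OF v \<gamma>, of x]
    comm_integrable[OF C1_bd_lipschitz[OF r \<gamma>(1)] C1_bd_lipschitz[OF v \<gamma>(1)], of x]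
  have "gen \<nu> (\<lambda>x. r x * v x) (\<lambda>x. r x *\<^sub>R v' x + v x *\<^sub>R r' x) x
    = (\<integral>y. r x * jump v v' x y + v x * jump r r' x y + (r (x + y) - r x) * (v (x + y) - v x) \<partial>\<nu>)"
    unfolding gen_def by (intro Bochner_Integration.integral_cong refl) (simp add: inner_add_right algebra_simps)
  also have "\<dots> = (\<integral>y. r x * jump v v' x y + v x * jump r r' x y \<partial>\<nu>)
      + (\<integral>y. (r (x + y) - r x) * (v (x + y) - v x) \<partial>\<nu>)"
    by (rule Bochner_Integration.integral_add)
       (intro Bochner_Integration.integrable_add integrable_mult_right i, rule i)
  also have "(\<integral>y. r x * jump v v' x y + v x * jump r r' x y \<partial>\<nu>)
      = (\<integral>y. r x * jump v v' x y \<partial>\<nu>) + (\<integral>y. v x * jump r r' x y \<partial>\<nu>)"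
    by (rule Bochner_Integration.integral_add) (intro integrable_mult_right i)+
  finally show ?thesis
    unfolding gen_def comm_def integral_mult_right_zero by simp
qed

text \<open>A small bump makes the supremum of \<open>v\<close> attained, and there the gradient vanishes and the
  nonlocal operator is nonpositive.\<close>

lemma maximum_principle:
  assumes v: "C1_bd \<gamma> N v v'" and \<gamma>: "0 < \<gamma>" "\<gamma> \<le> 1" "\<alpha> < 1 + \<gamma>" and "0 < lam"
    and b: "\<And>x. norm (b x) \<le> B"
    and eq: "\<And>x. lam * v x - gen \<nu> v v' x - b x \<bullet> v' x \<le> M"
  shows "lam * v x \<le> M"
proof -
  define s where "s = (SUP x. v x)"
  have bdd: "bdd_above (range v)"
    using C1_bdD(1)[OF v] by (intro bdd_aboveI[of _ N]) (auto simp: abs_le_iff)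
  have v_le: "v x \<le> s" for x unfolding s_def using bdd by (intro cSUP_upper) auto
  have B: "0 \<le> B" using order_trans[OF norm_ge_zero b] .
  \<comment> \<open>Bounds the operator and the drift term on the bump, whose \<open>C1_bd\<close>
    constant is 12: the constant 6 for \<open>c = 1\<close>, doubled when the exponent is lowered to
    \<open>\<gamma>\<close>.\<close>
  define C where "C = 2 * 12 * mom (1 + \<gamma>) + B * 12"
  have *: "lam * s \<le> M + \<delta> * (lam + C)" if \<delta>: "0 < \<delta>" for \<delta>
  proof -
    obtain x1 where x1: "v x1 > s - \<delta> / 2"
      using less_cSUP_iff[OF _ bdd, of "s - \<delta> / 2"] \<delta> unfolding s_def[symmetric] by auto
    have bump: "C1_bd \<gamma> 12 (bump 1 x1) (bump_grad 1 x1)"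
      using C1_bd_exponent[OF C1_bd_bump[of 1 1 x1] \<gamma>(1,2)] by simp
    define m where "m x = v x + \<delta> * bump 1 x1 x" for x
    define m' where "m' x = v' x + \<delta> *\<^sub>R bump_grad 1 x1 x" for x
    have m: "C1_bd \<gamma> (N + \<bar>\<delta>\<bar> * 12) m m'"
      unfolding m_def[abs_def] m'_def[abs_def] by (intro C1_bd_add C1_bd_cmult v bump \<gamma>)
    have "continuous_on (cball x1 1) m"
      using C1_bd_continuous(1)[OF m \<gamma>(1)] continuous_on_subset by blast
    then obtain z where z: "z \<in> cball x1 1" "\<And>x. x \<in> cball x1 1 \<Longrightarrow> m x \<le> m z"
      using continuous_attains_sup[OF compact_cball, of x1 1 m] by auto
    have mx1: "m x1 > s + \<delta> / 2" using x1 by (simp add: m_def bump_center)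
    \<comment> \<open>Outside the unit ball the bump is at most
      \<open>exp (- 1) \<le> 1 / 2\<close>, so there \<open>m\<close> stays below
      \<open>s + \<delta> / 2\<close>, a level exceeded at \<open>x1\<close>. The maximum over the
      ball is therefore global.\<close>
    have max: "m x \<le> m z" for x
    proof (cases "x \<in> cball x1 1")
      case False
      then have "1 \<le> (norm (x - x1))\<^sup>2"
        by (simp add: dist_norm norm_minus_commute)
      then have "bump 1 x1 x \<le> exp (- 1)" by (simp add: bump_def)
      also have "\<dots> \<le> 1 / 2" using exp_ge_add_one_self[of 1] by (simp add: exp_minus field_simps)
      finally have "\<delta> * bump 1 x1 x \<le> \<delta> / 2" using \<delta> by simp
      then have "m x \<le> s + \<delta> / 2" using v_le[of x] by (simp add: m_def)
      then show ?thesis using mx1 z(2)[of x1] by simp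
    qed (rule z(2))
    have "(\<lambda>h. m' z \<bullet> h) = (\<lambda>h. 0)"
      by (rule differential_zero_maxmin[OF _ open_UNIV C1_bd_has_derivative[OF m \<gamma>(1)]]) (use max in auto)
    then have "m' z \<bullet> m' z = 0" by metis
    then have m'z: "m' z = 0" by simp
    have "gen \<nu> m m' z \<le> 0"
      unfolding gen_def m'z
    proof -
      have "0 \<le> (\<integral>y. - (m (z + y) - m z - indicat_real (cball 0 1) y * (y \<bullet> 0)) \<partial>\<nu>)"
        using max by (intro Bochner_Integration.integral_nonneg) auto
      then show "(\<integral>y. m (z + y) - m z - indicat_real (cball 0 1) y * (y \<bullet> 0) \<partial>\<nu>) \<le> 0"
        unfolding Bochner_Integration.integral_minus by simp
    qed
    moreover have "gen \<nu> m m' z = gen \<nu> v v' z + \<delta> * gen \<nu> (bump 1 x1) (bump_grad 1 x1) z"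
      unfolding m_def[abs_def] m'_def[abs_def]
      by (subst gen_add[OF v C1_bd_cmult[OF bump \<gamma>(1)] \<gamma>(1,3)]) (simp add: gen_cmult)
    moreover have "\<delta> * gen \<nu> (bump 1 x1) (bump_grad 1 x1) z \<ge> - \<delta> * (2 * 12 * mom (1 + \<gamma>))"
      using mult_left_mono[OF gen_bound[OF bump \<gamma>(1,3), of z, unfolded abs_le_iff, THEN conjunct2], of \<delta>] \<delta> by simp
    ultimately have g: "gen \<nu> v v' z \<le> \<delta> * (2 * 12 * mom (1 + \<gamma>))" by linarith
    have "v' z = - \<delta> *\<^sub>R bump_grad 1 x1 z" using m'z by (simp add: m'_def eq_neg_iff_add_eq_0)
    then have "b z \<bullet> v' z = - \<delta> * (b z \<bullet> bump_grad 1 x1 z)" by simp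
    also have "\<dots> \<le> \<delta> * (B * 12)"
    proof -
      have "\<bar>b z \<bullet> bump_grad 1 x1 z\<bar> \<le> B * 12"
        by (rule order_trans[OF Cauchy_Schwarz_ineq2 mult_mono[OF b C1_bdD(2)[OF bump] B]]) simp
      then have "\<delta> * (- (b z \<bullet> bump_grad 1 x1 z)) \<le> \<delta> * (B * 12)"
        using \<delta> by (intro mult_left_mono) (auto simp: abs_le_iff)
      then show ?thesis by simp
    qed
    finally have "lam * v z \<le> M + \<delta> * C"
      using eq[of z] g by (simp add: C_def algebra_simps)
    moreover have "s - \<delta> \<le> v z"
    proof -
      have "\<delta> * bump 1 x1 z \<le> \<delta>" using \<delta> bump_bounds(2)[of 1 x1 z] by simp
      moreover have "s + \<delta> / 2 < m z" using max[of x1] mx1 by linarith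
      ultimately show ?thesis using \<delta> unfolding m_def by linarith
    qed
    then have "lam * (s - \<delta>) \<le> lam * v z" using assms(5) by simp
    ultimately show ?thesis by (simp add: algebra_simps)
  qed
  have "lam * s \<le> M"
  proof (rule field_le_epsilon)
    fix e :: real assume e: "0 < e"
    define \<delta> where "\<delta> = e / (\<bar>lam + C\<bar> + 1)"
    have "0 < \<delta>" using e by (simp add: \<delta>_def)
    then have "lam * s \<le> M + \<delta> * (lam + C)" by (rule *)
    also have "\<delta> * (lam + C) \<le> \<delta> * (\<bar>lam + C\<bar> + 1)" using \<open>0 < \<delta>\<close> by simp
    also have "\<dots> = e" by (simp add: \<delta>_def)
    finally show "lam * s \<le> M + e" by simp
  qed
  moreover have "lam * v x \<le> lam * s" using v_le[of x] assms(5) by simp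
  ultimately show ?thesis by linarith
qed

lemma maximum_principle_abs:
  assumes v: "C1_bd \<gamma> N v v'" and \<gamma>: "0 < \<gamma>" "\<gamma> \<le> 1" "\<alpha> < 1 + \<gamma>" and "0 < lam"
    and b: "\<And>x. norm (b x) \<le> B"
    and eq: "\<And>x. lam * v x - gen \<nu> v v' x - b x \<bullet> v' x = f x" and f: "\<And>x. \<bar>f x\<bar> \<le> M"
  shows "lam * \<bar>v x\<bar> \<le> M"
proof -
  have "lam * v x \<le> M"
    using f eq by (intro maximum_principle[OF v \<gamma> assms(5), where b=b and B=B] b) (auto simp: abs_le_iff)
  moreover have "lam * (-1 * v x) \<le> M"
  proof (rule maximum_principle[OF C1_bd_cmult[OF v \<gamma>(1)] \<gamma> assms(5), where b=b and B=B])
    show "norm (b x) \<le> B" for x by (rule b)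
    show "lam * (- 1 * v x) - gen \<nu> (\<lambda>x. - 1 * v x) (\<lambda>x. - 1 *\<^sub>R v' x) x - b x \<bullet> (- 1 *\<^sub>R v' x) \<le> M" for x
      unfolding gen_cmult using f[of x] eq[of x] by (simp add: abs_le_iff)
  qed
  ultimately show ?thesis by (simp add: abs_if)
qed

end

section \<open>The semigroup and its resolvent\<close>

lemma mult_integral_divide:
  fixes c :: real
  assumes "c \<noteq> 0"
  shows "c * (\<integral>x. f x / c \<partial>M) = (\<integral>x. f x \<partial>M)"
  using assms by simp

text \<open>The time integral is estimated for integrands divided by their constant; this restores
  the factor.\<close>

lemma abs_scaled_le:
  fixes M :: real
  assumes "0 \<le> M" "0 < l" "\<bar>I\<bar> / l \<le> B" "d = M * I / l"
  shows "\<bar>d\<bar> \<le> M * B"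
proof -
  have "\<bar>d\<bar> = M * (\<bar>I\<bar> / l)" using assms by (simp add: abs_mult)
  then show ?thesis using assms(1,3) by (simp add: mult_left_mono del: times_divide_eq_right)
qed

lemma bcontfun_measurable:
  fixes g :: "'a::euclidean_space \<Rightarrow> real"
  shows "g \<in> bcontfun \<Longrightarrow> g \<in> borel_measurable borel"
  by (auto simp: bcontfun_def intro: borel_measurable_continuous_onI)

lemma bcontfun_translate:
  fixes g :: "'a::euclidean_space \<Rightarrow> real"
  assumes "g \<in> bcontfun"
  shows "(\<lambda>x. g (x + c)) \<in> bcontfun"
proof -
  have "continuous_on UNIV (\<lambda>x. g (x + c))"
    by (rule continuous_on_compose2[of UNIV g]) (use assms in \<open>auto simp: bcontfun_def intro!: continuous_intros\<close>)
  moreover have "bounded (range (\<lambda>x. g (x + c)))"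
    using assms by (auto simp: bcontfun_def intro: bounded_subset)
  ultimately show ?thesis by (simp add: bcontfun_def)
qed

locale levy_kernel = jump_measure \<nu> \<alpha> for \<nu> :: "'a::euclidean_space measure" and \<alpha> +
  fixes \<mu> :: "real \<Rightarrow> 'a measure" and c0 :: real
  assumes prob_mu: "prob_space (\<mu> t)"
    and sets_mu [measurable_cong]: "sets (\<mu> t) = sets borel"
    and semigroup_mu: "0 < s \<Longrightarrow> 0 < t \<Longrightarrow> g \<in> bcontfun \<Longrightarrow>
      (\<integral>y. (\<integral>z. g (x + y + z) \<partial>\<mu> t) \<partial>\<mu> s) = (\<integral>y. (g (x + y) :: real) \<partial>\<mu> (s + t))"
    and continuous_mu: "0 < \<kappa> \<Longrightarrow> holder_bd \<kappa> K g \<Longrightarrow>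
      continuous_on UNIV (\<lambda>t. \<integral>y. (g (x + y) :: real) \<partial>\<mu> t)"
    and char_mu: "0 \<le> t \<Longrightarrow>
      (\<integral>y. exp (\<i> * of_real (u \<bullet> y)) \<partial>\<mu> t) = exp (- of_real t * levy_exponent \<nu> u)"
    and lipschitz_mu: "0 < t \<Longrightarrow> t \<le> 1 \<Longrightarrow> g \<in> bcontfun \<Longrightarrow> (\<And>x. \<bar>g x\<bar> \<le> K) \<Longrightarrow>
      \<bar>(\<integral>y. g (x + h + y) \<partial>\<mu> t) - (\<integral>y. g (x + y) \<partial>\<mu> t)\<bar> \<le> c0 * t powr (- 1 / \<alpha>) * K * norm h"
    and c0_nonneg: "0 \<le> c0"
begin

section \<open>Smoothing of Hoelder functions by the semigroup\<close>

definition R :: "real \<Rightarrow> ('a \<Rightarrow> real) \<Rightarrow> 'a \<Rightarrow> real"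
  where "R t g x = (\<integral>y. g (x + y) \<partial>\<mu> t)"

lemma integrable_mu:
  fixes g :: "'a \<Rightarrow> 'b::{banach, second_countable_topology}"
  assumes "g \<in> borel_measurable borel" "\<And>x. norm (g x) \<le> K"
  shows "integrable (\<mu> t) (\<lambda>y. g (x + y))"
proof -
  interpret prob_space "\<mu> t" by (rule prob_mu)
  have [measurable]: "g \<in> borel_measurable borel" by fact
  show ?thesis
    by (rule integrable_const_bound[where B=K]) (use assms(2) in auto)
qed

lemma R_integrable:
  fixes g :: "'a \<Rightarrow> real"
  assumes "g \<in> bcontfun"
  shows "integrable (\<mu> t) (\<lambda>y. g (x + y))"
proof -
  obtain K where "\<And>x. norm (g x) \<le> K"
    using assms by (auto simp: bcontfun_def bounded_iff)
  then show ?thesis using bcontfun_measurable[OF assms] by (intro integrable_mu)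
qed

lemma integral_mu_le:
  fixes g :: "'a \<Rightarrow> real"
  assumes "\<And>x. \<bar>g x\<bar> \<le> K"
  shows "\<bar>\<integral>y. g (x + y) \<partial>\<mu> t\<bar> \<le> K"
  using prob_space.norm_expectation_le[OF prob_mu, of "\<lambda>y. g (x + y)" K t] assms by simp

lemma R_bound: "(\<And>x. \<bar>g x\<bar> \<le> K) \<Longrightarrow> \<bar>R t g x\<bar> \<le> K"
  unfolding R_def by (rule integral_mu_le)

lemma R_diff:
  assumes "f \<in> bcontfun" "g \<in> bcontfun"
  shows "R t (\<lambda>z. f z - g z) x = R t f x - R t g x"
  unfolding R_def by (intro Bochner_Integration.integral_diff R_integrable assms)

lemma R_translate: "R t (\<lambda>z. g (z + c)) x = R t g (x + c)"
  unfolding R_def by (simp add: add_ac)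

lemma R_holder:
  assumes "holder_bd \<kappa> K g" "0 < \<kappa>"
  shows "holder_bd \<kappa> K (R t g)"
  unfolding holder_bd_def
proof (intro conjI allI)
  show "norm (R t g x) \<le> K" for x
    using R_bound[of g K t x] holder_bdD(1)[OF assms(1)] by simp
  show "norm (R t g x - R t g y) \<le> K * dist x y powr \<kappa>" for x y
  proof -
    note g = holder_bd_bcontfun[OF assms]
    have "R t g x - R t g (x + (y - x)) = R t (\<lambda>z. g z - g (z + (y - x))) x"
      using R_diff[OF g bcontfun_translate[OF g], of t "y - x" x] by (simp only: R_translate)
    moreover have "\<bar>R t (\<lambda>z. g z - g (z + (y - x))) x\<bar> \<le> K * dist x y powr \<kappa>"
    proof (rule R_bound)
      show "\<bar>g z - g (z + (y - x))\<bar> \<le> K * dist x y powr \<kappa>" for z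
        using holder_bdD(2)[OF assms(1), of z "z + (y - x)"] by (simp add: dist_norm norm_minus_commute)
    qed
    ultimately show ?thesis by simp
  qed
qed

lemma R_semigroup:
  assumes "0 < s" "0 < t" "g \<in> bcontfun"
  shows "R s (R t g) x = R (s + t) g x"
  using semigroup_mu[OF assms] by (simp add: R_def)

lemma R_lipschitz:
  assumes "0 < t" "t \<le> 1" "g \<in> bcontfun" "\<And>x. \<bar>g x\<bar> \<le> K"
  shows "\<bar>R t g (x + h) - R t g x\<bar> \<le> c0 * t powr (- 1 / \<alpha>) * K * norm h"
  unfolding R_def by (rule lipschitz_mu[OF assms])

text \<open>Averaging \<open>F\<close> over \<open>N\<close> translates by multiples of \<open>h\<close>, with \<open>N * norm h\<close> of order
  \<open>t powr (1 / \<alpha>)\<close>, interpolates between the bounded and the Lipschitz case.\<close>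

lemma R_increment_small_time:
  assumes F: "holder_bd \<beta> K F" and \<beta>: "0 < \<beta>" "\<beta> < 1" and t: "0 < t" "t \<le> 1"
  shows "\<bar>R t F (x + h) - R t F x\<bar> \<le> (c0 + 2) * K * t powr ((\<beta> - 1) / \<alpha>) * norm h"
proof -
  have K: "0 \<le> K" using F by (rule holder_bd_nonneg)
  define \<tau> where "\<tau> = t powr (1 / \<alpha>)"
  have \<tau>: "0 < \<tau>" "t powr ((\<beta> - 1) / \<alpha>) = \<tau> powr (\<beta> - 1)" "t powr (- 1 / \<alpha>) = 1 / \<tau>"
    using t by (auto simp: \<tau>_def powr_powr powr_minus_divide)
  have inc: "\<bar>F (z + c) - F z\<bar> \<le> K * norm c powr \<beta>" for z c
    using holder_bdD(2)[OF F, of "z + c" z] by (simp add: dist_norm)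
  have Fb: "F \<in> bcontfun" using holder_bd_bcontfun[OF F \<beta>(1)] .
  consider "h = 0" | "\<tau> < norm h" | "h \<noteq> 0" "norm h \<le> \<tau>" by linarith
  then show ?thesis
  proof cases
    case 1
    then show ?thesis by simp
  next
    case 2
    have "\<bar>R t F (x + h) - R t F x\<bar> \<le> K * norm h powr \<beta>"
      using holder_bdD(2)[OF R_holder[OF F \<beta>(1)], of t "x + h" x] by (simp add: dist_norm)
    also have "norm h powr \<beta> = norm h powr (\<beta> - 1) * norm h"
    proof -
      have "norm h powr (\<beta> - 1 + 1) = norm h powr (\<beta> - 1) * norm h powr 1" by (rule powr_add)
      then show ?thesis using 2 \<tau>(1) by simp
    qed
    also have "K * (norm h powr (\<beta> - 1) * norm h) \<le> K * (\<tau> powr (\<beta> - 1) * norm h)"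
      using 2 \<tau>(1) \<beta> K by (intro mult_left_mono mult_right_mono powr_mono2') auto
    also have "\<dots> \<le> ((c0 + 2) * K) * (\<tau> powr (\<beta> - 1) * norm h)"
      using K c0_nonneg by (intro mult_right_mono) (auto simp: algebra_simps)
    finally show ?thesis by (simp add: \<tau> mult_ac)
  next
    case 3
    then have h: "0 < norm h" by simp
    \<comment> \<open>The total shift \<open>N * norm h\<close> then lies between
      \<open>\<tau> / 2\<close> and \<open>\<tau>\<close>: not too long for \<open>FN\<close> to
      stay close to \<open>F\<close>, and long enough for the telescoped increment to gain.\<close>
    define N where "N = nat \<lfloor>\<tau> / norm h\<rfloor>"
    have "1 \<le> \<tau> / norm h" using 3 by (simp add: field_simps)
    then have N1: "1 \<le> N" "real N \<le> \<tau> / norm h" "\<tau> / norm h < real N + 1"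
      unfolding N_def by linarith+
    then have N: "0 < real N" "real N * norm h \<le> \<tau>" "\<tau> < real N * norm h + norm h" "norm h \<le> real N * norm h"
      using h by (auto simp: field_simps)
    then have N2: "\<tau> / 2 \<le> real N * norm h" by linarith
    define FN where "FN z = (\<Sum>j<N. F (z + real j *\<^sub>R h)) / real N" for z
    have FNb: "FN \<in> bcontfun"
    proof -
      have "continuous_on UNIV FN"
        unfolding FN_def using bcontfun_translate[OF Fb] N(1)
        by (intro continuous_intros) (auto simp: bcontfun_def)
      moreover have "\<bar>FN z\<bar> \<le> K" for z
      proof -
        have "\<bar>\<Sum>j<N. F (z + real j *\<^sub>R h)\<bar> \<le> (\<Sum>j<N. K)"
          using holder_bdD(1)[OF F] by (intro order_trans[OF sum_abs] sum_mono) simp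
        then show ?thesis using N(1) by (simp add: FN_def field_simps)
      qed
      ultimately show ?thesis by (auto simp: bcontfun_def bounded_iff)
    qed
    have diff: "\<bar>F z - FN z\<bar> \<le> K * \<tau> powr \<beta>" for z
    proof -
      have "F z - FN z = (\<Sum>j<N. F z - F (z + real j *\<^sub>R h)) / real N"
        using N(1) by (simp add: FN_def sum_subtractf field_simps)
      moreover have "\<bar>\<Sum>j<N. F z - F (z + real j *\<^sub>R h)\<bar> \<le> (\<Sum>j<N. K * \<tau> powr \<beta>)"
      proof (intro order_trans[OF sum_abs] sum_mono)
        fix j assume "j \<in> {..<N}"
        then have "real j * norm h \<le> \<tau>"
          using N(2) mult_right_mono[of "real j" "real N" "norm h"] by auto
        then have "K * norm (real j *\<^sub>R h) powr \<beta> \<le> K * \<tau> powr \<beta>"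
          using K \<beta> by (intro mult_left_mono powr_mono2) auto
        then show "\<bar>F z - F (z + real j *\<^sub>R h)\<bar> \<le> K * \<tau> powr \<beta>"
          using inc[of z "real j *\<^sub>R h"] by linarith
      qed
      then have "\<bar>\<Sum>j<N. F z - F (z + real j *\<^sub>R h)\<bar> / real N \<le> K * \<tau> powr \<beta>"
        using N(1) by (simp add: field_simps)
      ultimately show ?thesis by simp
    qed
    have incN: "\<bar>FN (z + h) - FN z\<bar> \<le> 2 * K * \<tau> powr (\<beta> - 1) * norm h" for z
    proof -
      have "(\<Sum>j<N. F (z + h + real j *\<^sub>R h)) - (\<Sum>j<N. F (z + real j *\<^sub>R h))
          = (\<Sum>j<N. F (z + real (Suc j) *\<^sub>R h) - F (z + real j *\<^sub>R h))"
        by (simp add: sum_subtractf algebra_simps)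
      also have "\<dots> = F (z + real N *\<^sub>R h) - F z"
        using sum_lessThan_telescope[of "\<lambda>j. F (z + real j *\<^sub>R h)" N] by simp
      finally have "\<bar>FN (z + h) - FN z\<bar> = \<bar>F (z + real N *\<^sub>R h) - F z\<bar> / real N"
        using N(1) by (simp add: FN_def diff_divide_distrib[symmetric])
      also have "\<dots> \<le> K * (real N * norm h) powr \<beta> / real N"
        using inc[of z "real N *\<^sub>R h"] N(1) by (intro divide_right_mono) auto
      also have "(real N * norm h) powr \<beta> = (real N * norm h) powr (\<beta> - 1) * (real N * norm h)"
      proof -
        have "(real N * norm h) powr (\<beta> - 1 + 1) = (real N * norm h) powr (\<beta> - 1) * (real N * norm h) powr 1"
          by (rule powr_add)
        then show ?thesis by simp
      qed
      also have "K * ((real N * norm h) powr (\<beta> - 1) * (real N * norm h)) / real N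
          = K * (real N * norm h) powr (\<beta> - 1) * norm h"
        using N(1) by simp
      also have "\<dots> \<le> K * (\<tau> / 2) powr (\<beta> - 1) * norm h"
        using N2 K \<beta> \<tau>(1) by (intro mult_right_mono mult_left_mono powr_mono2') auto
      also have "(\<tau> / 2) powr (\<beta> - 1) \<le> 2 * \<tau> powr (\<beta> - 1)"
      proof -
        have "(\<tau> / 2) powr (\<beta> - 1) = \<tau> powr (\<beta> - 1) * 2 powr (1 - \<beta>)"
          using \<tau>(1) by (simp add: powr_divide powr_diff field_simps)
        also have "(2::real) powr (1 - \<beta>) \<le> 2 powr 1" using \<beta> by (intro powr_mono) auto
        finally show ?thesis by (simp add: mult_left_mono)
      qed
      finally show ?thesis using K by (simp add: mult_left_mono mult_right_mono)
    qed
    \<comment> \<open>\<open>F - FN\<close> is of size \<open>K * \<tau> powr \<beta>\<close> and is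
      smoothed by (H1). The increment of \<open>FN\<close> telescopes to a single Hoelder increment
      of \<open>F\<close> over \<open>N * norm h\<close>, divided by \<open>N\<close>, and needs no
      smoothing.\<close>
    have "R t F (x + h) - R t F x = (R t (\<lambda>z. F z - FN z) (x + h) - R t (\<lambda>z. F z - FN z) x)
        + R t (\<lambda>z. FN (z + h) - FN z) x"
      using R_diff[OF Fb FNb] R_diff[OF bcontfun_translate[OF FNb] FNb] by (simp add: R_translate)
    moreover have "\<bar>R t (\<lambda>z. F z - FN z) (x + h) - R t (\<lambda>z. F z - FN z) x\<bar>
        \<le> c0 * t powr (- 1 / \<alpha>) * (K * \<tau> powr \<beta>) * norm h"
      by (intro R_lipschitz t diff) (intro Bounded_Continuous_Function.minus_cont Fb FNb)
    moreover have "c0 * t powr (- 1 / \<alpha>) * (K * \<tau> powr \<beta>) * norm h = c0 * K * \<tau> powr (\<beta> - 1) * norm h"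
      using \<tau> by (simp add: powr_diff)
    moreover have "\<bar>R t (\<lambda>z. FN (z + h) - FN z) x\<bar> \<le> 2 * K * \<tau> powr (\<beta> - 1) * norm h"
      by (rule R_bound) (rule incN)
    ultimately have "\<bar>R t F (x + h) - R t F x\<bar> \<le> c0 * K * \<tau> powr (\<beta> - 1) * norm h + 2 * K * \<tau> powr (\<beta> - 1) * norm h"
      by linarith
    then show ?thesis by (simp add: \<tau> algebra_simps)
  qed
qed

text \<open>Half of the time is spent on each difference: the first-increment bound controls
  \<open>G\<close>, the \<open>\<eta>\<close>-increment of \<open>R (t / 2) F\<close>, in sup norm,
  and (H1) at time \<open>t / 2\<close> then gives the factor \<open>norm h\<close>. The exponents
  add up to \<open>(\<beta> - 2) / \<alpha>\<close>, and the halved times cost at most 4.\<close>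

lemma R_second_increment_small_time:
  assumes F: "holder_bd \<beta> K F" and \<beta>: "0 < \<beta>" "\<beta> < 1" and t: "0 < t" "t \<le> 1"
  shows "\<bar>incr2 (R t F) x \<eta> h\<bar>
    \<le> 4 * c0 * (c0 + 2) * K * t powr ((\<beta> - 2) / \<alpha>) * norm h * norm \<eta>"
proof -
  have K: "0 \<le> K" using F by (rule holder_bd_nonneg)
  note Fb = holder_bd_bcontfun[OF F \<beta>(1)] and Rb = holder_bd_bcontfun[OF R_holder[OF F \<beta>(1)] \<beta>(1), of "t / 2"]
  have RR: "R t F z = R (t / 2) (R (t / 2) F) z" for z
    using R_semigroup[OF _ _ Fb, of "t / 2" "t / 2" z] t by simp
  define G where "G z = R (t / 2) F (z + \<eta>) - R (t / 2) F z" for z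
  have G: "G \<in> bcontfun" "R (t / 2) G z = R t F (z + \<eta>) - R t F z" for z
    unfolding G_def R_diff[OF bcontfun_translate[OF Rb] Rb] R_translate RR
    by (intro Bounded_Continuous_Function.minus_cont bcontfun_translate Rb refl)+
  have "\<bar>R (t / 2) G (x + h) - R (t / 2) G x\<bar>
     \<le> c0 * (t / 2) powr (- 1 / \<alpha>) * ((c0 + 2) * K * (t / 2) powr ((\<beta> - 1) / \<alpha>) * norm \<eta>) * norm h"
    using t by (intro R_lipschitz G) (auto simp: G_def intro!: R_increment_small_time[OF F \<beta>])
  also have "\<dots> = c0 * (c0 + 2) * K * norm h * norm \<eta> * ((t / 2) powr (- 1 / \<alpha>) * (t / 2) powr ((\<beta> - 1) / \<alpha>))"
    by simp
  also have "(t / 2) powr (- 1 / \<alpha>) * (t / 2) powr ((\<beta> - 1) / \<alpha>) = (t / 2) powr ((\<beta> - 2) / \<alpha>)"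
  proof -
    have "- 1 / \<alpha> + (\<beta> - 1) / \<alpha> = (\<beta> - 2) / \<alpha>" using alpha by (simp add: field_simps)
    then show ?thesis by (simp only: powr_add[symmetric])
  qed
  also have "\<dots> = t powr ((\<beta> - 2) / \<alpha>) * 2 powr ((2 - \<beta>) / \<alpha>)"
  proof -
    have "(2::real) powr ((2 - \<beta>) / \<alpha>) = 2 powr (- ((\<beta> - 2) / \<alpha>))"
      by (simp add: minus_divide_left)
    then show ?thesis using t by (simp add: powr_divide powr_minus field_simps)
  qed
  also have "c0 * (c0 + 2) * K * norm h * norm \<eta> * (t powr ((\<beta> - 2) / \<alpha>) * 2 powr ((2 - \<beta>) / \<alpha>))
     \<le> c0 * (c0 + 2) * K * norm h * norm \<eta> * (t powr ((\<beta> - 2) / \<alpha>) * 4)"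
  proof -
    have "(2 - \<beta>) / \<alpha> \<le> 2" using \<beta> alpha by (simp add: field_simps)
    then have "(2::real) powr ((2 - \<beta>) / \<alpha>) \<le> 2 powr 2" by (intro powr_mono) auto
    then show ?thesis using K c0_nonneg by (intro mult_left_mono) auto
  qed
  finally have "\<bar>R (t / 2) G (x + h) - R (t / 2) G x\<bar>
      \<le> 4 * c0 * (c0 + 2) * K * t powr ((\<beta> - 2) / \<alpha>) * norm h * norm \<eta>" by (simp only: mult_ac)
  moreover have "R (t / 2) G (x + h) - R (t / 2) G x
      = incr2 (R t F) x \<eta> h"
    by (simp add: G(2) add_ac)
  ultimately show ?thesis by simp
qed

text \<open>Explains \<open>min t 1\<close> in the estimates below: \<open>R (t - 1) F\<close>
  inherits the Hoelder constant of \<open>F\<close>, so the bound at time 1 persists for all later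
  times.\<close>

lemma R_step:
  assumes "holder_bd \<beta> K F" "0 < \<beta>" "1 < t"
  shows "R t F = R 1 (R (t - 1) F)"
  using R_semigroup[of 1 "t - 1" F] holder_bd_bcontfun[OF assms(1,2)] assms(3) by (auto simp: fun_eq_iff)

lemma R_increment:
  assumes F: "holder_bd \<beta> K F" and \<beta>: "0 < \<beta>" "\<beta> < 1" and t: "0 < t"
  shows "\<bar>R t F (x + h) - R t F x\<bar> \<le> (c0 + 2) * K * min t 1 powr ((\<beta> - 1) / \<alpha>) * norm h"
proof (cases "t \<le> 1")
  case True
  then show ?thesis using R_increment_small_time[OF F \<beta> t] by simp
next
  case False
  then show ?thesis
    using R_increment_small_time[OF R_holder[OF F \<beta>(1)] \<beta>, of 1 "t - 1" x h] R_step[OF F \<beta>(1), of t]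
    by simp
qed

lemma R_second_increment:
  assumes F: "holder_bd \<beta> K F" and \<beta>: "0 < \<beta>" "\<beta> < 1" and t: "0 < t"
  shows "\<bar>incr2 (R t F) x \<eta> h\<bar>
    \<le> 4 * c0 * (c0 + 2) * K * min t 1 powr ((\<beta> - 2) / \<alpha>) * norm h * norm \<eta>"
proof (cases "t \<le> 1")
  case True
  then show ?thesis using R_second_increment_small_time[OF F \<beta> t] by simp
next
  case False
  then show ?thesis
    using R_second_increment_small_time[OF R_holder[OF F \<beta>(1)] \<beta>, of 1 "t - 1" x \<eta> h] R_step[OF F \<beta>(1), of t]
    by simp
qed

section \<open>Laplace transform in time and Schauder estimates\<close>

definition expm :: "real \<Rightarrow> real measure"
  where "expm l = density lborel (exponential_density l)"

text \<open>\<open>expm l\<close> carries the factor \<open>l\<close> that makes the Laplace weight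
  a probability density, so sup bounds pass through directly; dividing by \<open>l\<close> removes
  it again.\<close>

definition U :: "real \<Rightarrow> 'a \<Rightarrow> ('a \<Rightarrow> real) \<Rightarrow> 'a \<Rightarrow> real"
  where "U l k g x = (\<integral>t. R t g (x + t *\<^sub>R k) \<partial>expm l) / l"

lemma prob_expm: "0 < l \<Longrightarrow> prob_space (expm l)"
  unfolding expm_def by (rule prob_space_exponential_density)

lemma sets_expm [measurable_cong]: "sets (expm l) = sets borel"
  by (simp add: expm_def)

lemma AE_expm_pos:
  assumes "0 < l" shows "AE t in expm l. 0 < t"
proof -
  have "AE t in lborel. t \<noteq> (0::real)" by (rule AE_lborel_singleton)
  then show ?thesis
    unfolding expm_def using assms
    by (subst AE_density) (auto simp: exponential_density_def elim!: eventually_mono split: if_splits)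
qed

lemma R_continuous:
  assumes g: "holder_bd \<kappa> K g" "0 < \<kappa>"
  shows "continuous_on UNIV (\<lambda>t. R t g (x + t *\<^sub>R k))"
proof -
  have "isCont (\<lambda>t. R t g (x + t *\<^sub>R k)) s" for s
    unfolding isCont_def
  proof -
    have "((\<lambda>t. R t g (x + s *\<^sub>R k)) \<longlongrightarrow> R s g (x + s *\<^sub>R k)) (at s)"
      using continuous_mu[OF g(2,1), of "x + s *\<^sub>R k"]
      by (simp add: R_def continuous_on_eq_continuous_at isCont_def)
    moreover have "((\<lambda>t. R t g (x + t *\<^sub>R k) - R t g (x + s *\<^sub>R k)) \<longlongrightarrow> 0) (at s)"
    proof (rule Lim_null_comparison)
      show "\<forall>\<^sub>F t in at s. norm (R t g (x + t *\<^sub>R k) - R t g (x + s *\<^sub>R k)) \<le> K * dist (x + t *\<^sub>R k) (x + s *\<^sub>R k) powr \<kappa>"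
        by (intro always_eventually allI holder_bdD(2)[OF R_holder[OF g]])
      have "((\<lambda>t. dist (x + t *\<^sub>R k) (x + s *\<^sub>R k)) \<longlongrightarrow> dist (x + s *\<^sub>R k) (x + s *\<^sub>R k)) (at s)"
        by (intro tendsto_intros)
      then have "((\<lambda>t. dist (x + t *\<^sub>R k) (x + s *\<^sub>R k) powr \<kappa>) \<longlongrightarrow> 0 powr \<kappa>) (at s)"
        using g(2) by (intro tendsto_powr') auto
      then show "((\<lambda>t. K * dist (x + t *\<^sub>R k) (x + s *\<^sub>R k) powr \<kappa>) \<longlongrightarrow> 0) (at s)"
        by (auto intro: tendsto_mult_right_zero)
    qed
    ultimately show "((\<lambda>t. R t g (x + t *\<^sub>R k)) \<longlongrightarrow> R s g (x + s *\<^sub>R k)) (at s)"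
      using tendsto_add by fastforce
  qed
  then show ?thesis by (simp add: continuous_on_eq_continuous_at)
qed

lemma U_integrable:
  assumes g: "holder_bd \<kappa> K g" "0 < \<kappa>" and "0 < l"
  shows "integrable (expm l) (\<lambda>t. R t g (x + t *\<^sub>R k))"
proof -
  interpret prob_space "expm l" using assms(3) by (rule prob_expm)
  have [measurable]: "(\<lambda>t. R t g (x + t *\<^sub>R k)) \<in> borel_measurable borel"
    by (intro borel_measurable_continuous_onI R_continuous[OF g])
  show ?thesis
    by (rule integrable_const_bound[where B=K]) (use R_bound[of g K] holder_bdD(1)[OF g(1)] in auto)
qed

lemma U_bound:
  assumes g: "\<And>x. \<bar>g x\<bar> \<le> K" and "0 < l"
  shows "\<bar>U l k g x\<bar> \<le> K / l"
proof -
  have "\<bar>\<integral>t. R t g (x + t *\<^sub>R k) \<partial>expm l\<bar> \<le> K"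
    using prob_space.norm_expectation_le[OF prob_expm[OF assms(2)], of "\<lambda>t. R t g (x + t *\<^sub>R k)" K] R_bound[OF g]
    by simp
  then show ?thesis using assms(2) by (simp add: U_def divide_right_mono)
qed

lemma U_tendsto:
  assumes g: "\<And>n. holder_bd \<kappa> K (g n)" "0 < \<kappa>" and "0 < l" and lim: "\<And>x. (\<lambda>n. g n x) \<longlonglongrightarrow> f x"
  shows "(\<lambda>n. U l k (g n) x) \<longlonglongrightarrow> U l k f x"
proof -
  interpret E: prob_space "expm l" using assms(3) by (rule prob_expm)
  have gb: "\<bar>g n x\<bar> \<le> K" for n x using holder_bdD(1)[OF g(1)] by simp
  interpret P: prob_space "\<mu> t" for t by (rule prob_mu)
  have R: "(\<lambda>n. R t (g n) z) \<longlonglongrightarrow> R t f z" for t z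
    unfolding R_def
  proof (rule integral_dominated_convergence[where w="\<lambda>_. K"])
    have [measurable]: "g n \<in> borel_measurable borel" for n
      by (intro bcontfun_measurable holder_bd_bcontfun[OF g])
    show m: "(\<lambda>y. g n (z + y)) \<in> borel_measurable (\<mu> t)" for n by measurable
    show "(\<lambda>y. f (z + y)) \<in> borel_measurable (\<mu> t)"
      by (rule borel_measurable_LIMSEQ_real[OF _ m]) (rule lim)
  qed (use gb lim in auto)
  show ?thesis
    unfolding U_def
  proof (intro tendsto_divide tendsto_const integral_dominated_convergence[where w="\<lambda>_. K"])
    have m: "(\<lambda>t. R t (g n) (x + t *\<^sub>R k)) \<in> borel_measurable (expm l)" for n
      using U_integrable[OF g assms(3)] by auto
    show "(\<lambda>t. R t (g n) (x + t *\<^sub>R k)) \<in> borel_measurable (expm l)" for n by (rule m)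
    show "(\<lambda>t. R t f (x + t *\<^sub>R k)) \<in> borel_measurable (expm l)"
      by (rule borel_measurable_LIMSEQ_real[OF _ m]) (rule R)
  qed (use R_bound[OF gb] R assms(3) in auto)
qed

text \<open>The two bounds agree at \<open>t = \<eta> powr \<alpha>\<close>. The first is integrated
  below that time, finite because \<open>1 < \<alpha> + \<beta>\<close>, the second above it, finite
  because \<open>\<alpha> + \<beta> < 2\<close>, and both give a multiple of
  \<open>\<eta> powr (\<alpha> + \<beta> - 1)\<close>. Times beyond 1 contribute at most
  \<open>\<eta> / l\<close>, whence \<open>1 / \<omega>\<close>. The density is at most
  \<open>l\<close>, which the division cancels, so the constant is uniform in
  \<open>l\<close>.\<close>

lemma potential_integral_bound:
  assumes \<beta>: "0 < \<beta>" "\<beta> < 1" "1 < \<alpha> + \<beta>" "\<alpha> + \<beta> < 2"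
    and \<omega>: "0 < \<omega>" "\<omega> \<le> l" and \<eta>: "0 < \<eta>" "\<eta> \<le> 1"
    and f1: "\<And>t. 0 < t \<Longrightarrow> \<bar>f t\<bar> \<le> min t 1 powr ((\<beta> - 1) / \<alpha>)"
    and f2: "\<And>t. 0 < t \<Longrightarrow> \<bar>f t\<bar> \<le> \<eta> * min t 1 powr ((\<beta> - 2) / \<alpha>)"
  shows "\<bar>\<integral>t. f t \<partial>expm l\<bar> / l
    \<le> (\<alpha> / (\<alpha> + \<beta> - 1) + \<alpha> / (2 - \<alpha> - \<beta>) + 1 / \<omega>) * \<eta> powr (\<alpha> + \<beta> - 1)"
proof (cases "integrable (expm l) f")
  case False
  then show ?thesis
    using assms alpha by (simp add: not_integrable_integral_eq)
next
  case True
  define \<theta> where "\<theta> = \<alpha> + \<beta> - 1"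
  have \<theta>: "0 < \<theta>" "\<theta> < 1" using \<beta> by (auto simp: \<theta>_def)
  have l: "0 < l" using \<omega> by simp
  define a where "a = \<eta> powr \<alpha>"
  have a: "0 < a" "a \<le> 1" using \<eta> alpha by (auto simp: a_def powr_le1)
  define I1 where "I1 t = indicator {0..a} t * t powr ((\<beta> - 1) / \<alpha>)" for t :: real
  \<comment> \<open>The tail runs to infinity although only times up to 1 call for it: the exponent
    is below -1, and the closed form is simpler.\<close>
  define I2 where "I2 t = indicator {a..} t * t powr ((\<beta> - 2) / \<alpha>)" for t :: real
  have m: "I1 \<in> borel_measurable borel" "I2 \<in> borel_measurable borel"
    unfolding I1_def I2_def by measurable
  note [measurable] = m
  have p: "(\<beta> - 1) / \<alpha> + 1 = \<theta> / \<alpha>" "(\<beta> - 2) / \<alpha> + 1 = (\<theta> - 1) / \<alpha>"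
    using alpha by (auto simp: \<theta>_def field_simps)
  have p1: "-1 < (\<beta> - 1) / \<alpha>" "(\<beta> - 2) / \<alpha> < -1"
    using alpha \<beta> by (auto simp: field_simps)
  have "(\<integral>\<^sup>+t. ennreal (I1 t) \<partial>lborel) = ennreal (a powr ((\<beta> - 1) / \<alpha> + 1) / ((\<beta> - 1) / \<alpha> + 1))"
    unfolding I1_def
    by (rule nn_integral_has_integral_lebesgue[OF _ has_integral_powr_from_0]) (use p1 a in auto)
  also have "a powr ((\<beta> - 1) / \<alpha> + 1) / ((\<beta> - 1) / \<alpha> + 1) = \<alpha> / \<theta> * \<eta> powr \<theta>"
    using alpha \<eta> by (simp only: p a_def powr_powr) simp
  finally have I1: "(\<integral>\<^sup>+t. ennreal (I1 t) \<partial>lborel) = ennreal (\<alpha> / \<theta> * \<eta> powr \<theta>)" .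
  have "(\<integral>\<^sup>+t. ennreal (I2 t) \<partial>lborel) = ennreal (- (a powr ((\<beta> - 2) / \<alpha> + 1)) / ((\<beta> - 2) / \<alpha> + 1))"
    unfolding I2_def
    by (rule nn_integral_has_integral_lebesgue[OF _ has_integral_powr_to_inf]) (use p1 a in auto)
  also have "- (a powr ((\<beta> - 2) / \<alpha> + 1)) / ((\<beta> - 2) / \<alpha> + 1) = \<alpha> / (1 - \<theta>) * \<eta> powr (\<theta> - 1)"
  proof -
    have "\<alpha> * ((\<theta> - 1) / \<alpha>) = \<theta> - 1" using alpha by simp
    then show ?thesis
      using alpha \<theta> by (simp only: p a_def powr_powr) (simp add: field_simps)
  qed
  finally have I2: "(\<integral>\<^sup>+t. ennreal (I2 t) \<partial>lborel) = ennreal (\<alpha> / (1 - \<theta>) * \<eta> powr (\<theta> - 1))" .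
  have I3: "(\<integral>\<^sup>+t. ennreal (exponential_density l t) \<partial>lborel) = 1"
  proof -
    interpret E: prob_space "expm l" using l by (rule prob_expm)
    show ?thesis
      using E.emeasure_space_1 by (simp add: expm_def emeasure_density)
  qed
  have pt: "exponential_density l t * \<bar>f t\<bar> \<le> l * I1 t + l * \<eta> * I2 t + \<eta> * exponential_density l t" if "t \<noteq> 0" for t
  proof -
    have I: "0 \<le> I1 t" "0 \<le> I2 t" by (auto simp: I1_def I2_def)
    have e: "0 \<le> exponential_density l t" using l by (rule exponential_density_nonneg)
    have "t < 0 \<or> 0 < t \<and> t \<le> a \<or> a < t \<and> t \<le> 1 \<or> 1 < t" using that by linarith
    then consider "t < 0" | "0 < t" "t \<le> a" | "a < t" "t \<le> 1" | "1 < t" by blast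
    then show ?thesis
    proof cases
      case 1
      then show ?thesis using I l \<eta> by (simp add: exponential_density_def)
    next
      case 2
      have "exponential_density l t * \<bar>f t\<bar> \<le> l * I1 t"
        using f1[OF 2(1)] 2 l a by (intro mult_mono) (auto simp: exponential_density_def I1_def)
      moreover have "0 \<le> l * \<eta> * I2 t" "0 \<le> \<eta> * exponential_density l t" using I l \<eta> e by auto
      ultimately show ?thesis by linarith
    next
      case 3
      have "exponential_density l t * \<bar>f t\<bar> \<le> l * (\<eta> * I2 t)"
        using f2[of t] 3 l a by (intro mult_mono) (auto simp: exponential_density_def I2_def)
      moreover have "0 \<le> l * I1 t" "0 \<le> \<eta> * exponential_density l t" using I l \<eta> e by auto
      ultimately show ?thesis by (simp add: mult.assoc)
    next
      case 4
      have "exponential_density l t * \<bar>f t\<bar> \<le> exponential_density l t * \<eta>"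
        using f2[of t] 4 e by (intro mult_left_mono) auto
      moreover have "0 \<le> l * I1 t" "0 \<le> l * \<eta> * I2 t" using I l \<eta> e by auto
      ultimately show ?thesis by (simp add: mult_ac)
    qed
  qed
  have f_m [measurable]: "f \<in> borel_measurable borel"
    using True sets_expm by (simp add: borel_measurable_integrable measurable_cong_sets[of "expm l" borel] cong: measurable_cong_sets)
  have "ennreal \<bar>\<integral>t. f t \<partial>expm l\<bar> \<le> (\<integral>\<^sup>+t. ennreal \<bar>f t\<bar> \<partial>expm l)"
    using integral_norm_bound_ennreal[OF True] by simp
  also have "\<dots> = (\<integral>\<^sup>+t. ennreal (exponential_density l t * \<bar>f t\<bar>) \<partial>lborel)"
    unfolding expm_def
    by (subst nn_integral_density)
       (auto simp: ennreal_mult exponential_density_nonneg[OF l] intro!: nn_integral_cong)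
  also have "\<dots> \<le> (\<integral>\<^sup>+t. ennreal (l * I1 t + l * \<eta> * I2 t + \<eta> * exponential_density l t) \<partial>lborel)"
    using AE_lborel_singleton[of "0::real"] pt
    by (intro nn_integral_mono_AE) (auto elim!: eventually_mono intro!: ennreal_leI)
  also have "\<dots> = (\<integral>\<^sup>+t. ennreal l * ennreal (I1 t) + ennreal (l * \<eta>) * ennreal (I2 t)
      + ennreal \<eta> * ennreal (exponential_density l t) \<partial>lborel)"
    using l \<eta> exponential_density_nonneg[OF l]
    by (intro nn_integral_cong) (auto simp: I1_def I2_def ennreal_mult[symmetric] ennreal_plus[symmetric] simp del: ennreal_plus)
  also have "\<dots> = ennreal l * (\<integral>\<^sup>+t. ennreal (I1 t) \<partial>lborel) + ennreal (l * \<eta>) * (\<integral>\<^sup>+t. ennreal (I2 t) \<partial>lborel)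
      + ennreal \<eta> * (\<integral>\<^sup>+t. ennreal (exponential_density l t) \<partial>lborel)"
    by (simp add: nn_integral_add nn_integral_cmult)
  also have "\<dots> = ennreal (l * (\<alpha> / \<theta> * \<eta> powr \<theta>) + l * \<eta> * (\<alpha> / (1 - \<theta>) * \<eta> powr (\<theta> - 1)) + \<eta>)"
    unfolding I1 I2 I3 using l \<eta> alpha \<theta>
    by (simp add: ennreal_mult[symmetric] ennreal_plus[symmetric] del: ennreal_plus)
  finally have "\<bar>\<integral>t. f t \<partial>expm l\<bar> \<le> l * (\<alpha> / \<theta> * \<eta> powr \<theta>) + l * \<eta> * (\<alpha> / (1 - \<theta>) * \<eta> powr (\<theta> - 1)) + \<eta>"
    using l \<eta> alpha \<theta> by (subst (asm) ennreal_le_iff) auto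
  also have "l * \<eta> * (\<alpha> / (1 - \<theta>) * \<eta> powr (\<theta> - 1)) = l * (\<alpha> / (1 - \<theta>) * \<eta> powr \<theta>)"
    using \<eta> by (simp add: powr_diff)
  finally have "\<bar>\<integral>t. f t \<partial>expm l\<bar> / l \<le> (l * (\<alpha> / \<theta> * \<eta> powr \<theta>) + l * (\<alpha> / (1 - \<theta>) * \<eta> powr \<theta>) + \<eta>) / l"
    using l by (intro divide_right_mono) auto
  also have "\<dots> = \<alpha> / \<theta> * \<eta> powr \<theta> + \<alpha> / (1 - \<theta>) * \<eta> powr \<theta> + \<eta> / l"
    using l by (simp add: add_divide_distrib)
  also have "\<eta> / l \<le> \<eta> powr \<theta> / \<omega>"
  proof -
    have "\<eta> powr 1 \<le> \<eta> powr \<theta>" using \<eta> \<theta> by (intro powr_mono') auto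
    then show ?thesis using \<eta> \<omega> by (intro frac_le) auto
  qed
  finally show ?thesis by (simp add: \<theta>_def algebra_simps)
qed

lemma U_increment:
  assumes F: "holder_bd \<kappa> K F" "0 < \<kappa>" and "0 < l"
  shows "U l k F (x + h) - U l k F x = (\<integral>t. R t F (x + t *\<^sub>R k + h) - R t F (x + t *\<^sub>R k) \<partial>expm l) / l"
proof -
  have "integrable (expm l) (\<lambda>t. R t F (x + t *\<^sub>R k + h))"
    using U_integrable[OF F assms(3), of "x + h" k] by (simp add: add_ac)
  from Bochner_Integration.integral_diff[OF this U_integrable[OF F assms(3)]]
  show ?thesis by (simp add: U_def diff_divide_distrib add_ac)
qed

text \<open>Phrased by differences because differentiability of \<open>U l k F\<close> is not yet
  available: it comes from a Fourier representation, or from knowing that \<open>U l k F\<close>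
  equals a given differentiable function. Independence of \<open>k\<close> is what permits freezing
  the drift at an arbitrary point.\<close>

definition schauder_const :: "real \<Rightarrow> real \<Rightarrow> real \<Rightarrow> bool"
  where "schauder_const \<beta> \<omega> C \<longleftrightarrow> 1 \<le> C \<and>
    (\<forall>l k K F. \<omega> \<le> l \<longrightarrow> holder_bd \<beta> K F \<longrightarrow>
      (\<forall>x h. \<bar>U l k F (x + h) - U l k F x\<bar> \<le> C * K * norm h) \<and>
      (\<forall>x h \<eta>. \<bar>incr2 (U l k F) x \<eta> h\<bar> \<le> C * K * norm h * norm \<eta> powr (\<alpha> + \<beta> - 1)))"

lemma schauder_constD:
  assumes "schauder_const \<beta> \<omega> C" "\<omega> \<le> l" "holder_bd \<beta> K F"
  shows "\<bar>U l k F (x + h) - U l k F x\<bar> \<le> C * K * norm h"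
    "\<bar>incr2 (U l k F) x \<eta> h\<bar> \<le> C * K * norm h * norm \<eta> powr (\<alpha> + \<beta> - 1)"
  using assms unfolding schauder_const_def by blast+

theorem ex_schauder_const:
  assumes \<beta>: "0 < \<beta>" "\<beta> < 1" "1 < \<alpha> + \<beta>" "\<alpha> + \<beta> < 2" and \<omega>: "0 < \<omega>"
  shows "\<exists>C. schauder_const \<beta> \<omega> C"
proof -
  define \<theta> where "\<theta> = \<alpha> + \<beta> - 1"
  have \<theta>: "0 < \<theta>" "\<theta> < 1" using \<beta> by (auto simp: \<theta>_def)
  define J where "J = \<alpha> / (\<alpha> + \<beta> - 1) + \<alpha> / (2 - \<alpha> - \<beta>) + 1 / \<omega>"
  have J: "0 \<le> J" using \<beta> \<omega> alpha by (simp add: J_def)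
  note J_bound = potential_integral_bound[OF \<beta> \<omega>, folded J_def \<theta>_def]
  \<comment> \<open>Dominates the constants of a first increment, of a sum of two of them, and of a
    second increment. It is positive even for \<open>c0 = 0\<close>, as needed to divide by
    it.\<close>
  define D where "D = 2 * (c0 + 2) + 4 * c0 * (c0 + 2)"
  have D: "0 < D" "c0 + 2 \<le> D" "2 * (c0 + 2) \<le> D" "4 * c0 * (c0 + 2) \<le> D"
    using c0_nonneg by (auto simp: D_def add_pos_nonneg)
  define C where "C = 2 * D * J + 1"
  have first: "\<bar>U l k F (x + h) - U l k F x\<bar> \<le> D * J * K * norm h" if l: "\<omega> \<le> l" and F: "holder_bd \<beta> K F" for l k K F x h
  proof (cases "K * norm h = 0")
    case True
    have "\<bar>U l k F (x + h) - U l k F x\<bar> \<le> 0"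
    proof (cases "h = 0")
      case False
      then have "K = 0" using True by simp
      then have "\<bar>F z\<bar> \<le> 0" for z using holder_bdD(1)[OF F, of z] by simp
      then have "\<bar>U l k F z\<bar> \<le> 0 / l" for z using l \<omega> by (intro U_bound) auto
      from this[of x] this[of "x + h"] show ?thesis by simp
    qed simp
    then show ?thesis using D J holder_bd_nonneg[OF F] by (meson mult_nonneg_nonneg norm_ge_zero order_trans less_imp_le)
  next
    case False
    have K: "0 \<le> K" using F by (rule holder_bd_nonneg)
    have Kh: "0 < K * norm h" using False K by (simp add: less_le)
    define f where "f t = (R t F (x + t *\<^sub>R k + h) - R t F (x + t *\<^sub>R k)) / (D * (K * norm h))" for t
    have f1: "\<bar>f t\<bar> \<le> min t 1 powr ((\<beta> - 1) / \<alpha>)" if "0 < t" for t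
    proof -
      have "\<bar>R t F (x + t *\<^sub>R k + h) - R t F (x + t *\<^sub>R k)\<bar> \<le> (c0 + 2) * K * min t 1 powr ((\<beta> - 1) / \<alpha>) * norm h"
        by (rule R_increment[OF F \<beta>(1,2) that])
      also have "\<dots> = (c0 + 2) * (K * norm h * min t 1 powr ((\<beta> - 1) / \<alpha>))" by simp
      also have "\<dots> \<le> D * (K * norm h * min t 1 powr ((\<beta> - 1) / \<alpha>))"
        using D Kh by (intro mult_right_mono) auto
      finally show ?thesis using D Kh by (simp add: f_def field_simps)
    qed
    \<comment> \<open>First differences are the case \<open>\<eta> = 1\<close> of the time integral:
      since \<open>min t 1 \<le> 1\<close>, the first bound already implies the second.\<close>
    have "\<bar>\<integral>t. f t \<partial>expm l\<bar> / l \<le> J * 1 powr \<theta>"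
    proof (rule J_bound[OF l _ _ f1])
      show "\<bar>f t\<bar> \<le> 1 * min t 1 powr ((\<beta> - 2) / \<alpha>)" if t: "0 < t" for t
      proof -
        have "min t 1 powr ((\<beta> - 1) / \<alpha>) \<le> min t 1 powr ((\<beta> - 2) / \<alpha>)"
          using t alpha by (intro powr_mono') (auto simp: divide_right_mono)
        then show ?thesis using f1[OF t] by simp
      qed
    qed auto
    moreover have "U l k F (x + h) - U l k F x = (D * (K * norm h)) * (\<integral>t. f t \<partial>expm l) / l"
    proof -
      have "D * (K * norm h) \<noteq> 0" using D(1) Kh by (metis mult_pos_pos less_irrefl)
      then have "(D * (K * norm h)) * (\<integral>t. f t \<partial>expm l)
          = (\<integral>t. R t F (x + t *\<^sub>R k + h) - R t F (x + t *\<^sub>R k) \<partial>expm l)"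
        unfolding f_def by (rule mult_integral_divide)
      then show ?thesis
        using U_increment[OF F \<beta>(1), of l k x h] l \<omega> by simp
    qed
    ultimately have "\<bar>U l k F (x + h) - U l k F x\<bar> \<le> (D * (K * norm h)) * (J * 1 powr \<theta>)"
      using l \<omega> by (intro abs_scaled_le[OF mult_nonneg_nonneg[OF less_imp_le[OF D(1)] less_imp_le[OF Kh]]]) auto
    then show ?thesis by (simp add: mult_ac)
  qed
  have second: "\<bar>incr2 (U l k F) x \<eta> h\<bar>
        \<le> 2 * D * J * K * norm h * norm \<eta> powr \<theta>" if l: "\<omega> \<le> l" and F: "holder_bd \<beta> K F" for l k K F x h \<eta>
  proof -
    have K: "0 \<le> K" using F by (rule holder_bd_nonneg)
    have DJ: "0 \<le> D * J * K * norm h" using D J K by simp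
    \<comment> \<open>For long \<open>\<eta>\<close> the triangle inequality suffices because
      \<open>norm \<eta> powr \<theta>\<close> is at least 1; the degenerate cases are separated
      since the integrand is divided by \<open>K * norm h\<close>.\<close>
    consider "\<eta> = 0 \<or> K * norm h = 0" | "1 < norm \<eta>" | "\<eta> \<noteq> 0" "norm \<eta> \<le> 1" "K * norm h \<noteq> 0" by linarith
    then show ?thesis
    proof cases
      case 1
      then have "\<eta> = 0 \<or> D * J * K * norm h = 0" by auto
      then show ?thesis
        using first[OF l F, of k "x + \<eta>" h] first[OF l F, of k x h] by auto
    next
      case 2
      have "\<bar>incr2 (U l k F) x \<eta> h\<bar> \<le> 2 * (D * J * K * norm h) * 1"
        using first[OF l F, of k "x + \<eta>" h] first[OF l F, of k x h] by (simp add: abs_le_iff)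
      also have "\<dots> \<le> 2 * (D * J * K * norm h) * norm \<eta> powr \<theta>"
        using 2 \<theta> DJ by (intro mult_left_mono ge_one_powr_ge_zero) auto
      finally show ?thesis by simp
    next
      case 3
      have Kh: "0 < K * norm h" using 3 K by (simp add: less_le)
      define f where "f t = (incr2 (R t F) (x + t *\<^sub>R k) \<eta> h) / (D * (K * norm h))" for t
      have f1: "\<bar>f t\<bar> \<le> min t 1 powr ((\<beta> - 1) / \<alpha>)" if "0 < t" for t
      proof -
        have "\<bar>incr2 (R t F) (x + t *\<^sub>R k) \<eta> h\<bar>
            \<le> 2 * ((c0 + 2) * K * min t 1 powr ((\<beta> - 1) / \<alpha>) * norm h)"
          using R_increment[OF F \<beta>(1,2) that, of "x + t *\<^sub>R k + \<eta>" h] R_increment[OF F \<beta>(1,2) that, of "x + t *\<^sub>R k" h]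
          by linarith
        also have "\<dots> = (2 * (c0 + 2)) * (K * norm h * min t 1 powr ((\<beta> - 1) / \<alpha>))" by simp
        also have "\<dots> \<le> D * (K * norm h * min t 1 powr ((\<beta> - 1) / \<alpha>))"
          using D Kh by (intro mult_right_mono) auto
        finally show ?thesis using D Kh by (simp add: f_def field_simps)
      qed
      have f2: "\<bar>f t\<bar> \<le> norm \<eta> * min t 1 powr ((\<beta> - 2) / \<alpha>)" if "0 < t" for t
      proof -
        have "\<bar>incr2 (R t F) (x + t *\<^sub>R k) \<eta> h\<bar>
            \<le> 4 * c0 * (c0 + 2) * K * min t 1 powr ((\<beta> - 2) / \<alpha>) * norm h * norm \<eta>"
          by (rule R_second_increment[OF F \<beta>(1,2) that])
        also have "\<dots> = (4 * c0 * (c0 + 2)) * (K * norm h * (norm \<eta> * min t 1 powr ((\<beta> - 2) / \<alpha>)))" by simp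
        also have "\<dots> \<le> D * (K * norm h * (norm \<eta> * min t 1 powr ((\<beta> - 2) / \<alpha>)))"
          using D Kh by (intro mult_right_mono) auto
        finally show ?thesis using D Kh by (simp add: f_def field_simps)
      qed
      have *: "\<bar>\<integral>t. f t \<partial>expm l\<bar> / l \<le> J * norm \<eta> powr \<theta>"
        by (rule J_bound[OF l _ _ f1 f2]) (use 3 in auto)
      have l0: "0 < l" using l \<omega> by simp
      have i: "integrable (expm l) (\<lambda>t. R t F (z + t *\<^sub>R k + c) - R t F (z + t *\<^sub>R k))" for z c
        using U_integrable[OF F \<beta>(1) l0, of "z + c" k] U_integrable[OF F \<beta>(1) l0, of z k] by (simp add: add_ac)
      have "incr2 (U l k F) x \<eta> h
        = (\<integral>t. (R t F (x + \<eta> + t *\<^sub>R k + h) - R t F (x + \<eta> + t *\<^sub>R k))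
            - (R t F (x + t *\<^sub>R k + h) - R t F (x + t *\<^sub>R k)) \<partial>expm l) / l"
        unfolding U_increment[OF F \<beta>(1) l0] Bochner_Integration.integral_diff[OF i i] by (simp add: diff_divide_distrib)
      also have "\<dots> = (D * (K * norm h)) * (\<integral>t. f t \<partial>expm l) / l"
      proof -
        have "D * (K * norm h) \<noteq> 0" using D(1) Kh by (metis mult_pos_pos less_irrefl)
        then have "(D * (K * norm h)) * (\<integral>t. f t \<partial>expm l)
            = (\<integral>t. incr2 (R t F) (x + t *\<^sub>R k) \<eta> h \<partial>expm l)"
          unfolding f_def by (rule mult_integral_divide)
        then show ?thesis by (simp add: add_ac)
      qed
      finally have "\<bar>incr2 (U l k F) x \<eta> h\<bar>
          \<le> (D * (K * norm h)) * (J * norm \<eta> powr \<theta>)"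
        by (rule abs_scaled_le[OF mult_nonneg_nonneg[OF less_imp_le[OF D(1)] less_imp_le[OF Kh]] l0 *])
      also have "\<dots> = (D * J * K * norm h) * norm \<eta> powr \<theta>" by simp
      also have "\<dots> \<le> (2 * (D * J * K * norm h)) * norm \<eta> powr \<theta>"
        using DJ by (intro mult_right_mono) auto
      finally show ?thesis by simp
    qed
  qed
  have C: "1 \<le> C" "D * J \<le> C" "2 * D * J \<le> C" using D J by (auto simp: C_def add_increasing2)
  show ?thesis
    unfolding schauder_const_def
  proof (intro exI[of _ C] conjI allI impI)
    show "1 \<le> C" by (rule C(1))
    fix l k K x h \<eta> and F :: "'a \<Rightarrow> real" assume l: "\<omega> \<le> l" and F: "holder_bd \<beta> K F"
    have K: "0 \<le> K" using F by (rule holder_bd_nonneg)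
    show "\<bar>U l k F (x + h) - U l k F x\<bar> \<le> C * K * norm h"
      by (rule order_trans[OF first[OF l F]]) (intro mult_right_mono C K norm_ge_zero)
    show "\<bar>incr2 (U l k F) x \<eta> h\<bar>
        \<le> C * K * norm h * norm \<eta> powr (\<alpha> + \<beta> - 1)"
      unfolding \<theta>_def[symmetric]
      by (rule order_trans[OF second[OF l F]]) (intro mult_right_mono C K norm_ge_zero powr_ge_zero)
  qed
qed

end

section \<open>Fourier representations\<close>

subsection \<open>Gaussian and Laplace integrals\<close>

context pair_sigma_finite
begin

text \<open>A majorant that separates the variables makes the inner integrals a multiple of one
  fixed integral. This suits the possibly infinite Levy measure, where a constant majorant would not
  do.\<close>

lemma integrable_product_bound:
  fixes f :: "'a \<times> 'b \<Rightarrow> 'c::{banach, second_countable_topology}"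
  assumes f[measurable]: "f \<in> borel_measurable (M1 \<Otimes>\<^sub>M M2)"
    and A: "integrable M1 A" and B: "integrable M2 B"
    and le: "\<And>x y. norm (f (x, y)) \<le> A x * B y"
  shows "integrable (M1 \<Otimes>\<^sub>M M2) f"
proof (rule Fubini_integrable[OF f])
  have i: "integrable M2 (\<lambda>y. f (x, y))" if "x \<in> space M1" for x
  proof (rule Bochner_Integration.integrable_bound[where f="\<lambda>y. A x * B y"])
    show "integrable M2 (\<lambda>y. A x * B y)" using B by simp
    show "(\<lambda>y. f (x, y)) \<in> borel_measurable M2" using that by measurable
    show "AE y in M2. norm (f (x, y)) \<le> norm (A x * B y)"
      using le by (auto intro!: AE_I2 order_trans[OF le])
  qed
  then show "AE x in M1. integrable M2 (\<lambda>y. f (x, y))" by (rule AE_I2)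
  show "integrable M1 (\<lambda>x. \<integral>y. norm (f (x, y)) \<partial>M2)"
  proof (rule Bochner_Integration.integrable_bound[where f="\<lambda>x. A x * (\<integral>y. B y \<partial>M2)"])
    show "integrable M1 (\<lambda>x. A x * (\<integral>y. B y \<partial>M2))" using A by simp
    show "(\<lambda>x. \<integral>y. norm (f (x, y)) \<partial>M2) \<in> borel_measurable M1" by measurable
    show "AE x in M1. norm (\<integral>y. norm (f (x, y)) \<partial>M2) \<le> norm (A x * (\<integral>y. B y \<partial>M2))"
    proof (rule AE_I2)
      fix x assume x: "x \<in> space M1"
      have "(\<integral>y. norm (f (x, y)) \<partial>M2) \<le> (\<integral>y. A x * B y \<partial>M2)"
        using i[OF x] B le by (intro integral_mono) auto
      then show "norm (\<integral>y. norm (f (x, y)) \<partial>M2) \<le> norm (A x * (\<integral>y. B y \<partial>M2))"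
        by (simp add: integral_nonneg_AE)
    qed
  qed
qed

lemma Fubini_product_bound:
  fixes f :: "'a \<Rightarrow> 'b \<Rightarrow> 'c::{banach, second_countable_topology}"
  assumes f: "case_prod f \<in> borel_measurable (M1 \<Otimes>\<^sub>M M2)"
    and A: "integrable M1 A" and B: "integrable M2 B"
    and le: "\<And>x y. norm (f x y) \<le> A x * B y"
  shows "(\<integral>y. (\<integral>x. f x y \<partial>M1) \<partial>M2) = (\<integral>x. (\<integral>y. f x y \<partial>M2) \<partial>M1)"
  by (rule Fubini_integral[OF integrable_product_bound[OF f A B]]) (use le in auto)

end

text \<open>Lebesgue measure is the image of the product measure on coordinates; Gaussian and
  Fourier integrals thereby reduce to dimension one.\<close>

lemma lborel_product_integral:
  fixes f :: "'a::euclidean_space \<Rightarrow> real \<Rightarrow> 'b::{real_normed_field, banach, second_countable_topology}"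
  assumes f: "\<And>b. b \<in> Basis \<Longrightarrow> integrable lborel (f b)"
  shows "integrable lborel (\<lambda>u. \<Prod>b\<in>Basis. f b (u \<bullet> b))"
    and "(\<integral>u. (\<Prod>b\<in>Basis. f b (u \<bullet> b)) \<partial>lborel) = (\<Prod>b\<in>Basis. \<integral>x. f b x \<partial>lborel)"
proof -
  interpret product_sigma_finite "\<lambda>_::'a. lborel :: real measure" by standard
  let ?S = "\<lambda>g. \<Sum>b\<in>Basis. g b *\<^sub>R b :: 'a"
  have [measurable]: "f b \<in> borel_measurable borel" if "b \<in> Basis" for b
    using f[OF that] by (simp add: borel_measurable_integrable)
  have m: "?S \<in> (\<Pi>\<^sub>M b\<in>Basis. lborel) \<rightarrow>\<^sub>M borel" by measurable
  have m': "(\<lambda>u. \<Prod>b\<in>Basis. f b (u \<bullet> b)) \<in> borel_measurable borel" by measurable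
  have *: "(\<Prod>b\<in>Basis. f b (?S g \<bullet> b)) = (\<Prod>b\<in>Basis. f b (g b))" for g
    by (intro prod.cong refl) simp
  have i: "integrable (\<Pi>\<^sub>M b\<in>Basis. lborel) (\<lambda>g. \<Prod>b\<in>(Basis::'a set). f b (g b))"
    using f by (intro product_integrable_prod) auto
  show "integrable lborel (\<lambda>u. \<Prod>b\<in>Basis. f b (u \<bullet> b))"
    by (subst lborel_eq) (use i in \<open>simp add: integrable_distr_eq[OF m m'] *\<close>)
  have "(\<integral>u. (\<Prod>b\<in>Basis. f b (u \<bullet> b)) \<partial>lborel) = (\<integral>g. (\<Prod>b\<in>Basis. f b (g b)) \<partial>(\<Pi>\<^sub>M b\<in>Basis. lborel))"
    by (subst lborel_eq) (simp add: integral_distr[OF m m'] *)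
  also have "\<dots> = (\<Prod>b\<in>Basis. \<integral>x. f b x \<partial>lborel)"
    using f by (intro product_integral_prod) auto
  finally show "(\<integral>u. (\<Prod>b\<in>Basis. f b (u \<bullet> b)) \<partial>lborel) = (\<Prod>b\<in>Basis. \<integral>x. f b x \<partial>lborel)" .
qed

lemma norm_squared_eq_sum: "(norm (u::'a::euclidean_space))\<^sup>2 = (\<Sum>b\<in>Basis. (u \<bullet> b)\<^sup>2)"
  unfolding power2_norm_eq_inner by (subst euclidean_inner) (simp add: power2_eq_square)

lemma integrable_gaussian:
  fixes c :: real
  assumes "0 < c"
  shows "integrable lborel (\<lambda>u::'a::euclidean_space. exp (- c * (norm u)\<^sup>2))"
proof -
  define \<sigma> where "\<sigma> = sqrt (1 / (2 * c))"
  have \<sigma>: "0 < \<sigma>" "\<sigma>\<^sup>2 = 1 / (2 * c)" using assms by (auto simp: \<sigma>_def)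
  have "integrable lborel (\<lambda>x. sqrt (2 * pi * \<sigma>\<^sup>2) * normal_density 0 \<sigma> x)"
    using \<sigma>(1) by simp
  moreover have "sqrt (2 * pi * \<sigma>\<^sup>2) * normal_density 0 \<sigma> x = exp (- c * x\<^sup>2)" for x
    using assms unfolding normal_density_def \<sigma> by simp
  ultimately have "integrable lborel (\<lambda>u::'a. \<Prod>b\<in>Basis. exp (- c * (u \<bullet> b)\<^sup>2))"
    by (intro lborel_product_integral(1)) simp
  then show ?thesis
    by (simp add: norm_squared_eq_sum sum_distrib_left exp_sum sum_negf[symmetric])
qed

lemma std_gaussian_fourier:
  "integrable lborel (\<lambda>x. exp (\<i> * of_real (x * y)) * of_real (exp (- (x\<^sup>2 / 2))))"
  "(\<integral>x. exp (\<i> * of_real (x * y)) * of_real (exp (- (x\<^sup>2 / 2))) \<partial>lborel)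
     = of_real (sqrt (2 * pi) * exp (- (y\<^sup>2 / 2)))"
proof -
  have i: "integrable lborel (\<lambda>x. std_normal_density x *\<^sub>R exp (\<i> * of_real (y * x)))"
    by (rule Bochner_Integration.integrable_bound[where f=std_normal_density]) auto
  have eq: "exp (\<i> * of_real (x * y)) * of_real (exp (- (x\<^sup>2 / 2)))
      = of_real (sqrt (2 * pi)) * (std_normal_density x *\<^sub>R exp (\<i> * of_real (y * x)))" for x
    by (simp add: normal_density_def scaleR_conv_of_real mult.commute)
  show "integrable lborel (\<lambda>x. exp (\<i> * of_real (x * y)) * of_real (exp (- (x\<^sup>2 / 2))))"
    unfolding eq using i by (rule integrable_mult_right)
  have "(\<integral>x. std_normal_density x *\<^sub>R exp (\<i> * of_real (y * x)) \<partial>lborel) = char std_normal_distribution y"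
    unfolding char_def by (subst integral_density) auto
  then show "(\<integral>x. exp (\<i> * of_real (x * y)) * of_real (exp (- (x\<^sup>2 / 2))) \<partial>lborel)
     = of_real (sqrt (2 * pi) * exp (- (y\<^sup>2 / 2)))"
    unfolding eq integral_mult_right_zero by (simp add: char_std_normal_distribution)
qed

definition gauss_const :: "'a::euclidean_space itself \<Rightarrow> real"
  where "gauss_const _ = sqrt (2 * pi) ^ DIM('a)"

definition gauss :: "'a::euclidean_space measure"
  where "gauss = density lborel (\<lambda>u. ennreal (exp (- ((norm u)\<^sup>2 / 2)) / gauss_const TYPE('a)))"

lemma gauss_const_pos: "0 < gauss_const TYPE('a::euclidean_space)"
  by (simp add: gauss_const_def)

lemma sets_gauss [measurable_cong]: "sets gauss = sets borel"
  by (simp add: gauss_def)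

lemma gaussian_fourier_lborel:
  fixes y :: "'a::euclidean_space"
  shows "(\<integral>u. exp (\<i> * of_real (u \<bullet> y)) * of_real (exp (- ((norm u)\<^sup>2 / 2))) \<partial>lborel)
     = of_real (gauss_const TYPE('a) * exp (- ((norm y)\<^sup>2 / 2)))"
proof -
  have "exp (\<i> * of_real (u \<bullet> y)) * of_real (exp (- ((norm u)\<^sup>2 / 2)))
      = (\<Prod>b\<in>Basis. exp (\<i> * of_real ((u \<bullet> b) * (y \<bullet> b))) * complex_of_real (exp (- ((u \<bullet> b)\<^sup>2 / 2))))" for u :: 'a
  proof -
    have "u \<bullet> y = (\<Sum>b\<in>Basis. (u \<bullet> b) * (y \<bullet> b))" by (rule euclidean_inner)
    then show ?thesis
      unfolding prod.distrib norm_squared_eq_sum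
      by (simp add: exp_sum[symmetric] sum_distrib_left sum_divide_distrib sum_negf of_real_prod[symmetric])
  qed
  then have "(\<integral>u. exp (\<i> * of_real (u \<bullet> y)) * of_real (exp (- ((norm u)\<^sup>2 / 2))) \<partial>lborel)
      = (\<Prod>b\<in>Basis. of_real (sqrt (2 * pi) * exp (- ((y \<bullet> b)\<^sup>2 / 2))))"
    by (simp only: lborel_product_integral(2)[OF std_gaussian_fourier(1)] std_gaussian_fourier(2))
  also have "\<dots> = of_real (gauss_const TYPE('a) * exp (- ((norm y)\<^sup>2 / 2)))"
    unfolding of_real_prod[symmetric] prod.distrib norm_squared_eq_sum
    by (simp add: gauss_const_def exp_sum[symmetric] sum_divide_distrib sum_negf)
  finally show ?thesis .
qed

lemma integral_gauss:
  fixes f :: "'a::euclidean_space \<Rightarrow> 'b::{banach, second_countable_topology}"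
  assumes "f \<in> borel_measurable borel"
  shows "(\<integral>u. f u \<partial>gauss) = (\<integral>u. (exp (- ((norm u)\<^sup>2 / 2)) / gauss_const TYPE('a)) *\<^sub>R f u \<partial>lborel)"
  unfolding gauss_def using gauss_const_pos[where 'a='a] assms by (subst integral_density) auto

lemma gauss_fourier:
  fixes y :: "'a::euclidean_space"
  shows "(\<integral>u. exp (\<i> * of_real (u \<bullet> y)) \<partial>gauss) = of_real (exp (- ((norm y)\<^sup>2 / 2)))"
proof -
  have "(\<integral>u. exp (\<i> * of_real (u \<bullet> y)) \<partial>gauss)
     = (\<integral>u. (exp (\<i> * of_real (u \<bullet> y)) * of_real (exp (- ((norm u)\<^sup>2 / 2)))) / of_real (gauss_const TYPE('a)) \<partial>lborel)"
    by (subst integral_gauss) (auto simp: scaleR_conv_of_real mult.commute)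
  also have "\<dots> = of_real (exp (- ((norm y)\<^sup>2 / 2)))"
    unfolding integral_divide_zero gaussian_fourier_lborel using gauss_const_pos[where 'a='a] by simp
  finally show ?thesis .
qed

lemma prob_gauss: "prob_space (gauss :: 'a::euclidean_space measure)"
proof
  have i: "integrable lborel (\<lambda>u::'a. exp (- ((norm u)\<^sup>2 / 2)) / gauss_const TYPE('a))"
    using integrable_gaussian[where 'a='a, of "1/2"] by simp
  have "complex_of_real (\<integral>u. exp (- ((norm (u::'a))\<^sup>2 / 2)) \<partial>lborel) = of_real (gauss_const TYPE('a))"
    using gaussian_fourier_lborel[of "0::'a"] by simp
  then have "(\<integral>u. exp (- ((norm (u::'a))\<^sup>2 / 2)) \<partial>lborel) = gauss_const TYPE('a)"
    by (simp only: of_real_eq_iff)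
  then have 1: "(\<integral>u. exp (- ((norm (u::'a))\<^sup>2 / 2)) / gauss_const TYPE('a) \<partial>lborel) = 1"
    using gauss_const_pos[where 'a='a] by simp
  have "emeasure gauss (space (gauss :: 'a measure)) = (\<integral>\<^sup>+u. ennreal (exp (- ((norm (u::'a))\<^sup>2 / 2)) / gauss_const TYPE('a)) \<partial>lborel)"
    by (simp add: gauss_def emeasure_density)
  also have "\<dots> = ennreal (\<integral>u. exp (- ((norm (u::'a))\<^sup>2 / 2)) / gauss_const TYPE('a) \<partial>lborel)"
    using i gauss_const_pos[where 'a='a] by (intro nn_integral_eq_integral) auto
  finally show "emeasure gauss (space (gauss :: 'a measure)) = 1" using 1 by simp
qed

lemma integrable_gauss_norm_squared: "integrable gauss (\<lambda>u::'a::euclidean_space. (norm u)\<^sup>2)"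
proof -
  have "integrable lborel (\<lambda>u::'a. (exp (- ((norm u)\<^sup>2 / 2)) / gauss_const TYPE('a)) *\<^sub>R (norm u)\<^sup>2)"
  proof (rule Bochner_Integration.integrable_bound[where f="\<lambda>u. 4 / gauss_const TYPE('a) * exp (- (1/4) * (norm u)\<^sup>2)"])
    show "integrable lborel (\<lambda>u::'a. 4 / gauss_const TYPE('a) * exp (- (1/4) * (norm u)\<^sup>2))"
      by (intro integrable_mult_right integrable_gaussian) simp
    have "exp (- ((norm u)\<^sup>2 / 2)) * (norm u)\<^sup>2 \<le> 4 * exp (- (1/4) * (norm u)\<^sup>2)" for u :: 'a
    proof -
      have "exp (- ((norm u)\<^sup>2 / 2)) = exp (- ((norm u)\<^sup>2 / 4)) * exp (- ((norm u)\<^sup>2 / 4))"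
        by (simp add: exp_add[symmetric])
      moreover have "(norm u)\<^sup>2 * exp (- ((norm u)\<^sup>2 / 4)) \<le> 4"
        using mult_exp_minus_le_1[of "(norm u)\<^sup>2 / 4"] by simp
      then have "exp (- ((norm u)\<^sup>2 / 4)) * ((norm u)\<^sup>2 * exp (- ((norm u)\<^sup>2 / 4))) \<le> exp (- ((norm u)\<^sup>2 / 4)) * 4"
        by (rule mult_left_mono) simp
      ultimately show ?thesis by (simp add: mult_ac)
    qed
    then show "AE u in lborel. norm ((exp (- ((norm u)\<^sup>2 / 2)) / gauss_const TYPE('a)) *\<^sub>R (norm (u::'a))\<^sup>2)
        \<le> norm (4 / gauss_const TYPE('a) * exp (- (1/4) * (norm u)\<^sup>2))"
      using gauss_const_pos[where 'a='a] by (auto simp: divide_right_mono)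
  qed measurable
  then show ?thesis
    unfolding gauss_def using gauss_const_pos[where 'a='a] by (subst integrable_density) auto
qed

text \<open>Applied with \<open>a\<close> a value of the complex symbol, where the antiderivative
  \<open>- exp (- t * a) / a\<close> vanishes at infinity because \<open>Re a\<close> is
  positive.\<close>

lemma exponential_laplace:
  fixes a :: complex
  assumes a: "0 < Re a"
  shows "(\<integral>t. indicator {0..} t *\<^sub>R exp (- of_real t * a) \<partial>lborel) = 1 / a"
proof -
  have a0: "a \<noteq> 0" using a by auto
  have norm_exp: "norm (exp (- of_real t * a)) = exp (- Re a * t)" for t :: real
    by (simp add: norm_exp_eq_Re mult.commute)
  have "integrable lborel (\<lambda>t. exponential_density (Re a) t)"
  proof -
    interpret prob_space "density lborel (exponential_density (Re a))"
      using a by (rule prob_space_exponential_density)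
    show ?thesis
      using integrable_const[of "1::real"] exponential_density_nonneg[OF a]
      by (subst (asm) integrable_density) auto
  qed
  then have "integrable lborel (\<lambda>t. exponential_density (Re a) t / Re a)" by simp
  then have i: "set_integrable lborel (einterval 0 \<infinity>) (\<lambda>t. exp (- of_real t * a))"
    unfolding set_integrable_def
  proof (rule Bochner_Integration.integrable_bound)
    show "(\<lambda>t. indicator (einterval 0 \<infinity>) t *\<^sub>R exp (- of_real t * a)) \<in> borel_measurable lborel" by measurable
    show "AE t in lborel. norm (indicator (einterval 0 \<infinity>) t *\<^sub>R exp (- of_real t * a)) \<le> norm (exponential_density (Re a) t / Re a)"
      using a by (intro AE_I2) (auto simp: norm_exp exponential_density_def einterval_def split: split_indicator)
  qed
  have "(LBINT t=0..\<infinity>. exp (- of_real t * a)) = 0 - (- 1 / a)"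
  proof (rule interval_integral_FTC_integrable[where F="\<lambda>t. - exp (- of_real t * a) / a"])
    show "((\<lambda>t. - exp (- of_real t * a) / a) has_vector_derivative exp (- of_real t * a)) (at t)" for t :: real
    proof -
      have "((\<lambda>z. - exp (- z * a) / a) has_field_derivative exp (- z * a)) (at z)" for z
        using a0 by (auto intro!: derivative_eq_intros)
      then show ?thesis
        by (rule has_vector_derivative_real_field)
    qed
    show "isCont (\<lambda>t. exp (- of_real t * a)) t" for t :: real by (intro continuous_intros)
    have "isCont (\<lambda>t. - exp (- of_real t * a) / a) (0::real)" by (intro continuous_intros a0)
    then have "((\<lambda>t::real. - exp (- of_real t * a) / a) \<longlongrightarrow> - 1 / a) (at_right 0)"
      by (auto simp: isCont_def intro: tendsto_within_subset)
    then show "(((\<lambda>t. - exp (- of_real t * a) / a) \<circ> real_of_ereal) \<longlongrightarrow> - 1 / a) (at_right 0)"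
      unfolding zero_ereal_def ereal_tendsto_simps1 .
    have "((\<lambda>t::real. - exp (- of_real t * a) / a) \<longlongrightarrow> 0) at_top"
    proof (rule tendsto_norm_zero_cancel)
      have "filterlim (\<lambda>t. - Re a * t) at_bot at_top"
        using a by (intro filterlim_tendsto_neg_mult_at_bot[OF tendsto_const _ filterlim_ident]) auto
      then have "((\<lambda>t. exp (- Re a * t) / norm a) \<longlongrightarrow> 0 / norm a) at_top"
        by (intro tendsto_divide tendsto_const filterlim_compose[OF exp_at_bot]) (use a0 in auto)
      then show "((\<lambda>t. norm (- exp (- of_real t * a) / a)) \<longlongrightarrow> 0) at_top"
        by (simp add: norm_divide mult.commute)
    qed
    then show "(((\<lambda>t. - exp (- of_real t * a) / a) \<circ> real_of_ereal) \<longlongrightarrow> 0) (at_left \<infinity>)"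
      unfolding ereal_tendsto_simps1 .
  qed (use i in auto)
  moreover have "(\<integral>t. indicator {0..} t *\<^sub>R exp (- of_real t * a) \<partial>lborel) = (LBINT t=0..\<infinity>. exp (- of_real t * a))"
    unfolding interval_lebesgue_integral_def set_lebesgue_integral_def
    by (simp, rule integral_cong_AE)
       (use AE_lborel_singleton[of "0::real"] in \<open>auto elim!: eventually_mono simp: einterval_def split: split_indicator\<close>)
  ultimately show ?thesis by simp
qed

lemma has_derivative_quadratic:
  fixes f :: "'a::real_normed_vector \<Rightarrow> 'b::real_normed_vector"
  assumes "bounded_linear D" "\<And>h. norm (f (x + h) - f x - D h) \<le> C * (norm h)\<^sup>2"
  shows "(f has_derivative D) (at x)"
  unfolding has_derivative_at
proof (intro conjI assms(1))
  show "(\<lambda>h. norm (f (x + h) - f x - D h) / norm h) \<midarrow>0\<rightarrow> 0"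
  proof (rule Lim_null_comparison)
    have "norm (f (x + h) - f x - D h) / norm h \<le> C * norm h" if "h \<noteq> 0" for h
      using assms(2)[of h] that by (simp add: power2_eq_square field_simps)
    then show "\<forall>\<^sub>F h in at 0. norm (norm (f (x + h) - f x - D h) / norm h) \<le> C * norm h"
      by (auto simp: eventually_at_filter)
    show "((\<lambda>h. C * norm h) \<longlongrightarrow> 0) (at (0::'a))"
      by (intro tendsto_mult_right_zero tendsto_norm_zero tendsto_ident_at)
  qed
qed

lemma norm_iexp_minus_linear: "norm (exp (\<i> * of_real s) - 1 - \<i> * of_real s) \<le> s\<^sup>2 / 2"
  using iexp_approx1[of s 1] by (simp add: numeral_2_eq_2 algebra_simps)

lemma norm_iexp_minus_1: "norm (exp (\<i> * of_real s) - 1) \<le> 2"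
  using norm_triangle_ineq4[of "exp (\<i> * of_real s)" 1] by simp

subsection \<open>The operator and the resolvent on Fourier integrals\<close>

lemma norm_le_1_plus_square: "norm u \<le> 1 + (norm u)\<^sup>2"
  using sum_power2_ge_zero[of "norm u - 1" 0] by (simp add: power2_diff) (smt (verit) norm_ge_zero)

lemma sigma_finite_gauss: "sigma_finite_measure (gauss :: 'a::euclidean_space measure)"
proof -
  interpret prob_space "gauss :: 'a measure" by (rule prob_gauss)
  show ?thesis by (rule sigma_finite_measure_axioms)
qed

text \<open>The Gaussian weight is kept in the measure, so that coefficients \<open>W\<close> of
  quadratic growth remain integrable; multiplication by the symbol of the operator produces exactly
  such growth.\<close>

definition fourier :: "real \<Rightarrow> ('a::euclidean_space \<Rightarrow> complex) \<Rightarrow> 'a \<Rightarrow> complex"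
  where "fourier c W z = (\<integral>u. exp (\<i> * of_real ((c *\<^sub>R u) \<bullet> z)) * W u \<partial>gauss)"

lemma integrable_gauss_quadratic:
  fixes W :: "'a::euclidean_space \<Rightarrow> 'b::{banach, second_countable_topology}"
  assumes "W \<in> borel_measurable borel" "\<And>u. norm (W u) \<le> A + B * (norm u)\<^sup>2"
  shows "integrable gauss W"
proof (rule Bochner_Integration.integrable_bound)
  interpret prob_space "gauss :: 'a measure" by (rule prob_gauss)
  show "integrable gauss (\<lambda>u::'a. A + B * (norm u)\<^sup>2)"
    by (intro Bochner_Integration.integrable_add integrable_mult_right integrable_gauss_norm_squared) simp
  show "W \<in> borel_measurable gauss" using assms(1) sets_gauss by (simp cong: measurable_cong_sets)
  show "AE u in gauss. norm (W u) \<le> norm (A + B * (norm u)\<^sup>2)"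
    using assms(2) by (auto intro!: AE_I2 order_trans[OF assms(2)])
qed

text \<open>The Taylor remainder of the exponential is at most a multiple of
  \<open>(norm u)\<^sup>2 * (norm h)\<^sup>2\<close>, and the Gaussian has a second moment;
  integrating the remainder replaces a theorem on differentiation under the integral.\<close>

lemma fourier_has_derivative:
  fixes W :: "'a::euclidean_space \<Rightarrow> complex"
  assumes W[measurable]: "W \<in> borel_measurable borel" and C: "\<And>u. norm (W u) \<le> C"
  shows "(fourier c W has_derivative
    (\<lambda>h. \<integral>u. exp (\<i> * of_real ((c *\<^sub>R u) \<bullet> z)) * W u * (\<i> * of_real ((c *\<^sub>R u) \<bullet> h)) \<partial>gauss)) (at z)"
    (is "(_ has_derivative ?D) _")
proof (rule has_derivative_quadratic)
  let ?e = "\<lambda>u z. exp (\<i> * complex_of_real ((c *\<^sub>R u) \<bullet> z))"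
  interpret prob_space "gauss :: 'a measure" by (rule prob_gauss)
  have C0: "0 \<le> C" using order_trans[OF norm_ge_zero C] .
  have i1: "integrable gauss (\<lambda>u. ?e u z * W u)" for z
    by (rule integrable_gauss_quadratic[where A=C and B=0]) (use C in \<open>auto simp: norm_mult\<close>)
  have bd: "norm (?e u z * W u * (\<i> * of_real ((c *\<^sub>R u) \<bullet> h))) \<le> C * \<bar>c\<bar> * norm h * norm u" for u h
  proof -
    have "\<bar>(c *\<^sub>R u) \<bullet> h\<bar> \<le> \<bar>c\<bar> * norm u * norm h"
      using Cauchy_Schwarz_ineq2[of "c *\<^sub>R u" h] by simp
    then have "norm (W u) * \<bar>(c *\<^sub>R u) \<bullet> h\<bar> \<le> C * (\<bar>c\<bar> * norm u * norm h)"
      by (intro mult_mono C C0) auto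
    then show ?thesis by (simp add: norm_mult abs_mult mult_ac)
  qed
  have i2: "integrable gauss (\<lambda>u. ?e u z * W u * (\<i> * of_real ((c *\<^sub>R u) \<bullet> h)))" for h
  proof (rule integrable_gauss_quadratic)
    show "norm (?e u z * W u * (\<i> * of_real ((c *\<^sub>R u) \<bullet> h)))
        \<le> C * \<bar>c\<bar> * norm h + (C * \<bar>c\<bar> * norm h) * (norm u)\<^sup>2" for u
      using bd[of u h] mult_left_mono[OF norm_le_1_plus_square[of u], of "C * \<bar>c\<bar> * norm h"] C0 by (simp add: distrib_left)
  qed measurable
  have in1: "integrable gauss (\<lambda>u::'a. norm u)"
    by (rule integrable_gauss_quadratic[where A=1 and B=1]) (use norm_le_1_plus_square in auto)
  show "bounded_linear ?D"
  proof (rule bounded_linear_intro)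
    show "?D (h + h') = ?D h + ?D h'" for h h'
      unfolding Bochner_Integration.integral_add[OF i2 i2, symmetric]
      by (intro Bochner_Integration.integral_cong refl) (simp add: inner_add_right algebra_simps)
    show "?D (r *\<^sub>R h) = r *\<^sub>R ?D h" for r h
      unfolding integral_scaleR_right[symmetric]
      by (intro Bochner_Integration.integral_cong refl) (simp add: scaleR_conv_of_real algebra_simps)
    show "norm (?D h) \<le> norm h * (C * \<bar>c\<bar> * (\<integral>u. norm (u::'a) \<partial>gauss))" for h
    proof -
      have "norm (?D h) \<le> (\<integral>u. norm (?e u z * W u * (\<i> * of_real ((c *\<^sub>R u) \<bullet> h))) \<partial>gauss)"
        by (rule integral_norm_bound)
      also have "\<dots> \<le> (\<integral>u. C * \<bar>c\<bar> * norm h * norm (u::'a) \<partial>gauss)"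
        by (rule integral_mono[OF integrable_norm[OF i2] integrable_mult_right[OF in1] bd])
      finally show ?thesis by (simp add: mult_ac)
    qed
  qed
  show "norm (fourier c W (z + h) - fourier c W z - ?D h) \<le> (C * c\<^sup>2 / 2 * (\<integral>u. (norm (u::'a))\<^sup>2 \<partial>gauss)) * (norm h)\<^sup>2" for h
  proof -
    let ?f = "\<lambda>u. ?e u z * W u * (?e u h - 1 - \<i> * of_real ((c *\<^sub>R u) \<bullet> h))"
    have eq: "?f u = ?e u (z + h) * W u - ?e u z * W u
        - ?e u z * W u * (\<i> * of_real ((c *\<^sub>R u) \<bullet> h))" for u
    proof -
      have "?e u (z + h) = ?e u z * ?e u h"
        by (simp add: exp_add[symmetric] inner_add_right distrib_left)
      then show ?thesis by (simp add: algebra_simps)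
    qed
    have i3: "integrable gauss ?f"
      unfolding eq using i1 i2 by (intro Bochner_Integration.integrable_diff)
    have "fourier c W (z + h) - fourier c W z - ?D h = (\<integral>u. ?f u \<partial>gauss)"
      unfolding eq fourier_def using i1 i2 by simp
    also have "norm \<dots> \<le> (\<integral>u. norm (?f u) \<partial>gauss)"
      by (rule integral_norm_bound)
    also have "\<dots> \<le> (\<integral>u. (C * c\<^sup>2 / 2 * (norm h)\<^sup>2) * (norm (u::'a))\<^sup>2 \<partial>gauss)"
    proof (intro integral_mono integrable_norm i3 integrable_mult_right integrable_gauss_norm_squared)
      fix u :: 'a
      have "((c *\<^sub>R u) \<bullet> h)\<^sup>2 \<le> (\<bar>c\<bar> * norm u * norm h)\<^sup>2"
        using Cauchy_Schwarz_ineq2[of "c *\<^sub>R u" h] by (intro abs_le_square_iff[THEN iffD1]) simp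
      then have "norm (?e u h - 1 - \<i> * of_real ((c *\<^sub>R u) \<bullet> h)) \<le> (\<bar>c\<bar> * norm u * norm h)\<^sup>2 / 2"
        using norm_iexp_minus_linear[of "(c *\<^sub>R u) \<bullet> h"] by linarith
      then have "norm (W u) * norm (?e u h - 1 - \<i> * of_real ((c *\<^sub>R u) \<bullet> h)) \<le> C * ((\<bar>c\<bar> * norm u * norm h)\<^sup>2 / 2)"
        by (intro mult_mono C C0) auto
      then show "norm (?f u) \<le> (C * c\<^sup>2 / 2 * (norm h)\<^sup>2) * (norm u)\<^sup>2"
        by (simp add: norm_mult power_mult_distrib mult_ac)
    qed
    also have "\<dots> = (C * c\<^sup>2 / 2 * (\<integral>u. (norm (u::'a))\<^sup>2 \<partial>gauss)) * (norm h)\<^sup>2" by simp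
    finally show ?thesis .
  qed
qed

lemma bounded_linear_real_inner:
  fixes f :: "'a::euclidean_space \<Rightarrow> real"
  assumes "bounded_linear f"
  shows "\<exists>v. f = (\<lambda>h. v \<bullet> h)"
proof
  interpret bounded_linear f by fact
  have "f h = (\<Sum>b\<in>Basis. f b *\<^sub>R b) \<bullet> h" for h
  proof -
    have "f h = f (\<Sum>b\<in>Basis. (h \<bullet> b) *\<^sub>R b)" by (simp add: euclidean_representation)
    also have "\<dots> = (\<Sum>b\<in>Basis. (h \<bullet> b) * f b)" by (simp add: sum scaleR)
    also have "\<dots> = (\<Sum>b\<in>Basis. f b *\<^sub>R b) \<bullet> h"
      unfolding inner_sum_left inner_scaleR_left by (simp add: inner_commute mult.commute)
    finally show ?thesis .
  qed
  then show "f = (\<lambda>h. (\<Sum>b\<in>Basis. f b *\<^sub>R b) \<bullet> h)" by (rule ext)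
qed

section \<open>Gaussian mollification and its Fourier form\<close>

definition op :: "'a::euclidean_space measure \<Rightarrow> real \<Rightarrow> 'a \<Rightarrow> ('a \<Rightarrow> real) \<Rightarrow> ('a \<Rightarrow> 'a) \<Rightarrow> 'a \<Rightarrow> real"
  where "op \<nu> l k w w' x = l * w x - gen \<nu> w w' x - k \<bullet> w' x"

definition mollify :: "nat \<Rightarrow> ('a::euclidean_space \<Rightarrow> 'b::{banach, second_countable_topology}) \<Rightarrow> 'a \<Rightarrow> 'b"
  where "mollify n f z = (\<integral>y. f (z + (1 / real (Suc n)) *\<^sub>R y) \<partial>gauss)"

lemma mollify_tendsto:
  fixes f :: "'a::euclidean_space \<Rightarrow> 'b::{banach, second_countable_topology}"
  assumes f: "continuous_on UNIV f" "\<And>x. norm (f x) \<le> K"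
  shows "(\<lambda>n. mollify n f z) \<longlonglongrightarrow> f z"
proof -
  interpret prob_space "gauss :: 'a measure" by (rule prob_gauss)
  have [measurable]: "f \<in> borel_measurable borel" using f(1) by (rule borel_measurable_continuous_onI)
  have "(\<lambda>n. \<integral>y. f (z + (1 / real (Suc n)) *\<^sub>R y) \<partial>gauss) \<longlonglongrightarrow> (\<integral>y. f z \<partial>(gauss :: 'a measure))"
  proof (rule integral_dominated_convergence[where w="\<lambda>_. K"])
    have "(\<lambda>n. f (z + (1 / real (Suc n)) *\<^sub>R y)) \<longlonglongrightarrow> f z" for y
    proof (rule isCont_tendsto_compose[of z f])
      show "isCont f z" using f(1) by (simp add: continuous_on_eq_continuous_at)
      have "(\<lambda>n. z + (1 / real (Suc n)) *\<^sub>R y) \<longlonglongrightarrow> z + 0 *\<^sub>R y"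
        by (intro tendsto_intros LIMSEQ_Suc[OF lim_1_over_n])
      then show "(\<lambda>n. z + (1 / real (Suc n)) *\<^sub>R y) \<longlonglongrightarrow> z" by simp
    qed
    then show "AE y in gauss. (\<lambda>n. f (z + (1 / real (Suc n)) *\<^sub>R y)) \<longlonglongrightarrow> f z" by simp
  qed (use f(2) in auto)
  then show ?thesis by (simp add: mollify_def prob_space)
qed

lemma mollify_holder:
  fixes f :: "'a::euclidean_space \<Rightarrow> real"
  assumes f: "holder_bd \<kappa> K f" "0 < \<kappa>"
  shows "holder_bd \<kappa> K (mollify n f)"
proof -
  interpret prob_space "gauss :: 'a measure" by (rule prob_gauss)
  have [measurable]: "f \<in> borel_measurable borel"
    using holder_bd_continuous[OF f] by (rule borel_measurable_continuous_onI)
  have i: "integrable gauss (\<lambda>y. f (z + (1 / real (Suc n)) *\<^sub>R y))" for z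
    using holder_bdD(1)[OF f(1)] by (intro integrable_const_bound[where B=K]) auto
  show ?thesis
    unfolding holder_bd_def mollify_def
  proof (intro conjI allI)
    show "norm (\<integral>y. f (x + (1 / real (Suc n)) *\<^sub>R y) \<partial>gauss) \<le> K" for x
      using holder_bdD(1)[OF f(1)] by (intro norm_expectation_le)
    show "norm ((\<integral>y. f (x + (1 / real (Suc n)) *\<^sub>R y) \<partial>gauss) - (\<integral>y. f (z + (1 / real (Suc n)) *\<^sub>R y) \<partial>gauss))
        \<le> K * dist x z powr \<kappa>" for x z
      unfolding Bochner_Integration.integral_diff[OF i i, symmetric]
    proof (rule norm_expectation_le)
      show "norm (f (x + (1 / real (Suc n)) *\<^sub>R y) - f (z + (1 / real (Suc n)) *\<^sub>R y)) \<le> K * dist x z powr \<kappa>" for y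
        using holder_bdD(2)[OF f(1), of "x + (1 / real (Suc n)) *\<^sub>R y" "z + (1 / real (Suc n)) *\<^sub>R y"] by simp
    qed
  qed
qed

lemma mollify_C1:
  assumes "C1_bd \<gamma> K w w'" "0 < \<gamma>"
  shows "C1_bd \<gamma> K (mollify n w) (mollify n w')"
  unfolding mollify_def by (intro C1_bd_avg assms prob_gauss) measurable

lemma lborel_integral_affine:
  fixes f :: "'a::euclidean_space \<Rightarrow> 'b::{banach, second_countable_topology}"
  assumes [measurable]: "f \<in> borel_measurable borel" and "0 < c"
  shows "(\<integral>x. f x \<partial>lborel) = (c ^ DIM('a)) *\<^sub>R (\<integral>x. f (t + c *\<^sub>R x) \<partial>lborel)"
  using assms(2)
  by (subst lborel_affine[of c t]) (simp_all add: integral_density integral_distr)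

text \<open>The Gaussian is, up to scale, its own Fourier transform, so inserting
  \<open>gauss_fourier\<close> and exchanging integrals turns the mollification into a Fourier
  integral. \<open>W\<close> is a multiple of the Fourier transform of \<open>f\<close>, and is
  bounded because \<open>f\<close> is integrable.\<close>

lemma mollify_fourier:
  fixes f :: "'a::euclidean_space \<Rightarrow> real"
  assumes f: "integrable lborel f"
  obtains W C where "W \<in> borel_measurable borel" "\<And>u. norm (W u) \<le> C"
    "\<And>z. complex_of_real (mollify n f z) = fourier (- real (Suc n)) W z"
proof -
  define c where "c = real (Suc n)"
  have c: "0 < c" by (simp add: c_def)
  have [measurable]: "f \<in> borel_measurable borel" using f by (simp add: borel_measurable_integrable)
  interpret G: prob_space "gauss :: 'a measure" by (rule prob_gauss)
  interpret pair_sigma_finite "gauss :: 'a measure" lborel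
    by (intro pair_sigma_finite.intro G.sigma_finite_measure_axioms sigma_finite_lborel)
  \<comment> \<open>The Jacobian of the substitution \<open>x = z + y / c\<close>, divided by the
    normalization of the Gaussian density.\<close>
  define A where "A = c ^ DIM('a) / gauss_const TYPE('a)"
  define W where "W u = of_real A * (\<integral>x. of_real (f x) * exp (\<i> * of_real (c * (u \<bullet> x))) \<partial>lborel)" for u
  show thesis
  proof (rule that)
    show "W \<in> borel_measurable borel" unfolding W_def by measurable
    show "norm (W u) \<le> \<bar>A\<bar> * (\<integral>x. \<bar>f x\<bar> \<partial>lborel)" for u
    proof -
      have "norm (\<integral>x. of_real (f x) * exp (\<i> * of_real (c * (u \<bullet> x))) \<partial>lborel)
          \<le> (\<integral>x. norm (of_real (f x) * exp (\<i> * of_real (c * (u \<bullet> x)))) \<partial>lborel)"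
        by (rule integral_norm_bound)
      then show ?thesis by (simp add: W_def norm_mult mult_left_mono)
    qed
    fix z
    have "mollify n f z = (\<integral>y. (exp (- ((norm y)\<^sup>2 / 2)) / gauss_const TYPE('a)) * f (z + (1 / c) *\<^sub>R y) \<partial>lborel)"
      unfolding mollify_def c_def[symmetric] by (subst integral_gauss) auto
    also have "\<dots> = (\<integral>y. (exp (- ((norm (c *\<^sub>R ((z + (1 / c) *\<^sub>R y) - z)))\<^sup>2 / 2)) / gauss_const TYPE('a)) * f (z + (1 / c) *\<^sub>R y) \<partial>lborel)"
      using c by simp
    also have "\<dots> = c ^ DIM('a) * (\<integral>x. (exp (- ((norm (c *\<^sub>R (x - z)))\<^sup>2 / 2)) / gauss_const TYPE('a)) * f x \<partial>lborel)"
      using c by (subst lborel_integral_affine[where c="1 / c" and t=z]) (auto simp: power_one_over)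
    also have "\<dots> = A * (\<integral>x. f x * exp (- ((norm (c *\<^sub>R (x - z)))\<^sup>2 / 2)) \<partial>lborel)"
      by (simp add: A_def mult.commute)
    finally have "complex_of_real (mollify n f z)
        = of_real A * (\<integral>x. of_real (f x) * of_real (exp (- ((norm (c *\<^sub>R (x - z)))\<^sup>2 / 2))) \<partial>lborel)"
      by (simp flip: of_real_mult)
    also have "(\<integral>x. of_real (f x) * complex_of_real (exp (- ((norm (c *\<^sub>R (x - z)))\<^sup>2 / 2))) \<partial>lborel)
        = (\<integral>x. (\<integral>u. of_real (f x) * exp (\<i> * of_real (u \<bullet> (c *\<^sub>R (x - z)))) \<partial>gauss) \<partial>lborel)"
      by (simp only: gauss_fourier[symmetric] integral_mult_right_zero)
    also have "\<dots> = (\<integral>u. (\<integral>x. of_real (f x) * exp (\<i> * of_real (u \<bullet> (c *\<^sub>R (x - z)))) \<partial>lborel) \<partial>gauss)"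
    proof (rule Fubini_product_bound)
      show "integrable lborel (\<lambda>x. \<bar>f x\<bar>)" using f by simp
      show "integrable gauss (\<lambda>u::'a. 1::real)" by simp
      show "norm (complex_of_real (f x) * exp (\<i> * of_real (u \<bullet> (c *\<^sub>R (x - z))))) \<le> 1 * \<bar>f x\<bar>" for u x
        by (simp add: norm_mult)
    qed measurable
    also have "\<dots> = (\<integral>u. exp (\<i> * of_real ((- c *\<^sub>R u) \<bullet> z)) * (\<integral>x. of_real (f x) * exp (\<i> * of_real (c * (u \<bullet> x))) \<partial>lborel) \<partial>gauss)"
    proof -
      have "of_real (f x) * exp (\<i> * of_real (u \<bullet> (c *\<^sub>R (x - z))))
          = exp (\<i> * of_real ((- c *\<^sub>R u) \<bullet> z)) * (of_real (f x) * exp (\<i> * of_real (c * (u \<bullet> x))))" for u x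
      proof -
        have "exp (\<i> * of_real (u \<bullet> (c *\<^sub>R (x - z)))) = exp (\<i> * of_real ((- c *\<^sub>R u) \<bullet> z)) * exp (\<i> * of_real (c * (u \<bullet> x)))"
          by (simp add: exp_add[symmetric] inner_diff_right algebra_simps)
        then show ?thesis by simp
      qed
      then show ?thesis by (simp only: integral_mult_right_zero)
    qed
    finally show "complex_of_real (mollify n f z) = fourier (- real (Suc n)) W z"
      unfolding fourier_def W_def c_def[symmetric]
      by (simp add: integral_mult_right_zero[symmetric] mult_ac del: integral_mult_right_zero)
  qed
qed

context levy_kernel
begin

section \<open>The symbol of the operator with drift\<close>

definition psi :: "'a \<Rightarrow> complex"
  where "psi u = levy_exponent \<nu> u"

text \<open>The integrand of the nonlocal operator on the exponential with frequency
  \<open>u\<close>, after division by that exponential.\<close>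

definition char_jump :: "'a \<Rightarrow> 'a \<Rightarrow> complex"
  where "char_jump u z = exp (\<i> * of_real (u \<bullet> z)) - 1
    - \<i> * of_real (u \<bullet> z) * of_real (indicat_real (cball 0 1) z)"

lemma psi_eq: "psi u = - (\<integral>z. char_jump u z \<partial>\<nu>)"
  by (simp add: psi_def levy_exponent_def char_jump_def)

lemma char_jump_bound: "norm (char_jump u z) \<le> (2 + (norm u)\<^sup>2) * trunc_powr 2 z"
proof (cases "norm z \<le> 1")
  case True
  have "(u \<bullet> z)\<^sup>2 \<le> (norm u * norm z)\<^sup>2"
    using Cauchy_Schwarz_ineq2[of u z] by (intro abs_le_square_iff[THEN iffD1]) simp
  moreover have "norm (char_jump u z) \<le> (u \<bullet> z)\<^sup>2 / 2"
    using norm_iexp_minus_linear[of "u \<bullet> z"] True by (simp add: char_jump_def)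
  ultimately have "norm (char_jump u z) \<le> (norm u * norm z)\<^sup>2"
    using zero_le_power2[of "u \<bullet> z"] by linarith
  also have "\<dots> = (norm u)\<^sup>2 * (norm z)\<^sup>2" by (rule power_mult_distrib)
  also have "\<dots> \<le> (2 + (norm u)\<^sup>2) * (norm z)\<^sup>2" by (intro mult_right_mono) auto
  finally show ?thesis using True by (simp add: trunc_powr_simps powr_numeral)
next
  case False
  then have "norm (char_jump u z) \<le> 2"
    using norm_iexp_minus_1[of "u \<bullet> z"] by (simp add: char_jump_def)
  then have "norm (char_jump u z) \<le> 2 + (norm u)\<^sup>2"
    by (rule order_trans) simp
  then show ?thesis using False by (simp add: trunc_powr_simps)
qed

lemma char_jump_measurable [measurable]:
  assumes [measurable]: "f \<in> borel_measurable N" "g \<in> borel_measurable N"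
  shows "(\<lambda>x. char_jump (f x) (g x)) \<in> borel_measurable N"
proof -
  have [measurable]: "(indicat_real (cball 0 1) :: 'a \<Rightarrow> real) \<in> borel_measurable borel"
    by (intro borel_measurable_indicator borel_closed closed_cball)
  show ?thesis unfolding char_jump_def by measurable
qed

lemma integrable_trunc2: "integrable \<nu> (trunc_powr 2)"
  using alpha by (intro integrable_trunc_powr) simp

lemma char_jump_integrable: "integrable \<nu> (char_jump u)"
proof (rule Bochner_Integration.integrable_bound[where f="\<lambda>z. (2 + (norm u)\<^sup>2) * trunc_powr 2 z"])
  show "integrable \<nu> (\<lambda>z. (2 + (norm u)\<^sup>2) * trunc_powr 2 z)" using integrable_trunc2 by simp
qed (use char_jump_bound in \<open>auto intro!: AE_I2 order_trans[OF char_jump_bound]\<close>)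

lemma psi_measurable [measurable]: "psi \<in> borel_measurable borel"
  unfolding psi_eq[abs_def] by measurable

lemma psi_bound: "norm (psi u) \<le> (2 + (norm u)\<^sup>2) * mom 2"
proof -
  have "norm (psi u) \<le> (\<integral>z. norm (char_jump u z) \<partial>\<nu>)"
    unfolding psi_eq by simp
  also have "\<dots> \<le> (\<integral>z. (2 + (norm u)\<^sup>2) * trunc_powr 2 z \<partial>\<nu>)"
    using char_jump_integrable integrable_trunc2 char_jump_bound by (intro integral_mono) auto
  finally show ?thesis by (simp add: mom_def)
qed

text \<open>Read off from the characteristic function at time 1, whose modulus is at most 1.\<close>

lemma Re_psi_nonneg: "0 \<le> Re (psi u)"
proof -
  interpret prob_space "\<mu> 1" by (rule prob_mu)
  have "norm (\<integral>y. exp (\<i> * of_real (u \<bullet> y)) \<partial>\<mu> 1) \<le> (\<integral>y. norm (exp (\<i> * of_real (u \<bullet> y))) \<partial>\<mu> 1)"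
    by (rule integral_norm_bound)
  then have "norm (exp (- psi u)) \<le> 1"
    using char_mu[of 1 u] by (simp add: psi_def prob_space)
  then show ?thesis by simp
qed

text \<open>The eigenvalue of \<open>op \<nu> l k\<close> on the exponential with frequency
  \<open>c *\<^sub>R u\<close>; \<open>psi\<close> carries a plus sign because the nonlocal operator
  has eigenvalue \<open>- psi\<close>.\<close>

definition symbol :: "real \<Rightarrow> 'a \<Rightarrow> real \<Rightarrow> 'a \<Rightarrow> complex"
  where "symbol l k c u = of_real l + psi (c *\<^sub>R u) - \<i> * of_real ((c *\<^sub>R u) \<bullet> k)"

lemma symbol_measurable [measurable]: "symbol l k c \<in> borel_measurable borel"
  unfolding symbol_def by measurable

lemma Re_symbol: "l \<le> Re (symbol l k c u)"
  using Re_psi_nonneg[of "c *\<^sub>R u"] by (simp add: symbol_def)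

lemma symbol_bound:
  "norm (symbol l k c u) \<le> (\<bar>l\<bar> + 2 * mom 2 + \<bar>c\<bar> * norm k) + (c\<^sup>2 * mom 2 + \<bar>c\<bar> * norm k) * (norm u)\<^sup>2"
proof -
  have "norm (symbol l k c u) \<le> norm (of_real l + psi (c *\<^sub>R u)) + norm (\<i> * complex_of_real ((c *\<^sub>R u) \<bullet> k))"
    unfolding symbol_def by (rule norm_triangle_ineq4)
  also have "\<dots> \<le> (\<bar>l\<bar> + norm (psi (c *\<^sub>R u))) + \<bar>(c *\<^sub>R u) \<bullet> k\<bar>"
    by (rule add_mono) (use norm_triangle_ineq[of "of_real l" "psi (c *\<^sub>R u)"] in \<open>auto simp: norm_mult\<close>)
  also have "norm (psi (c *\<^sub>R u)) \<le> (2 + c\<^sup>2 * (norm u)\<^sup>2) * mom 2"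
    using psi_bound[of "c *\<^sub>R u"] by (simp add: power_mult_distrib)
  also have "\<bar>(c *\<^sub>R u) \<bullet> k\<bar> \<le> (\<bar>c\<bar> * norm k) * norm u"
    using Cauchy_Schwarz_ineq2[of "c *\<^sub>R u" k] by (simp add: mult_ac)
  also have "(\<bar>c\<bar> * norm k) * norm u \<le> (\<bar>c\<bar> * norm k) * (1 + (norm u)\<^sup>2)"
    by (intro mult_left_mono norm_le_1_plus_square) simp
  finally show ?thesis by (simp add: algebra_simps)
qed

text \<open>Complex exponentials are eigenfunctions of the operator and, through the characteristic
  function, of its resolvent, with inverse eigenvalues.\<close>

lemma fourier_op:
  assumes W[measurable]: "W \<in> borel_measurable borel" and C: "\<And>u. norm (W u) \<le> C"
    and G: "C1_bd \<gamma> K G G'" "0 < \<gamma>"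
    and rep: "\<And>z. complex_of_real (G z) = fourier c W z"
  shows "complex_of_real (op \<nu> l k G G' z) = fourier c (\<lambda>u. W u * symbol l k c u) z"
proof -
  interpret GN: pair_sigma_finite "gauss :: 'a measure" \<nu>
    by (intro pair_sigma_finite.intro sigma_finite_measure_axioms sigma_finite_gauss)
  interpret prob_space "gauss :: 'a measure" by (rule prob_gauss)
  have C0: "0 \<le> C" using order_trans[OF norm_ge_zero C] .
  let ?e = "\<lambda>u z. exp (\<i> * complex_of_real ((c *\<^sub>R u) \<bullet> z))"
  let ?D = "\<lambda>h. \<integral>u. ?e u z * W u * (\<i> * of_real ((c *\<^sub>R u) \<bullet> h)) \<partial>gauss"
  \<comment> \<open>\<open>G'\<close> is known only as the gradient of \<open>G\<close>; uniqueness
    of the derivative identifies it with the differentiated Fourier integral.\<close>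
  have "fourier c W = (\<lambda>z. complex_of_real (G z))" by (simp add: rep fun_eq_iff)
  then have "((\<lambda>z. complex_of_real (G z)) has_derivative ?D) (at z)"
    using fourier_has_derivative[OF W C, of c z] by simp
  moreover have "((\<lambda>z. complex_of_real (G z)) has_derivative (\<lambda>h. complex_of_real (G' z \<bullet> h))) (at z)"
    by (rule bounded_linear.has_derivative[OF bounded_linear_of_real C1_bd_has_derivative[OF G]])
  ultimately have "?D = (\<lambda>h. complex_of_real (G' z \<bullet> h))" by (rule has_derivative_unique)
  then have grad: "complex_of_real (G' z \<bullet> h) = ?D h" for h by metis
  have i1: "integrable gauss (\<lambda>u. ?e u z * W u)" for z
    by (rule integrable_gauss_quadratic[where A=C and B=0]) (use C in \<open>auto simp: norm_mult\<close>)
  have i2: "integrable gauss (\<lambda>u. ?e u z * W u * (\<i> * of_real ((c *\<^sub>R u) \<bullet> h)))" for h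
  proof (rule integrable_gauss_quadratic)
    show "norm (?e u z * W u * (\<i> * of_real ((c *\<^sub>R u) \<bullet> h)))
        \<le> C * (\<bar>c\<bar> * norm h) + (C * (\<bar>c\<bar> * norm h)) * (norm u)\<^sup>2" for u
    proof -
      have "\<bar>(c *\<^sub>R u) \<bullet> h\<bar> \<le> (\<bar>c\<bar> * norm h) * norm u"
        using Cauchy_Schwarz_ineq2[of "c *\<^sub>R u" h] by (simp add: mult_ac)
      also have "\<dots> \<le> (\<bar>c\<bar> * norm h) * (1 + (norm u)\<^sup>2)" by (intro mult_left_mono norm_le_1_plus_square) simp
      finally have "norm (W u) * \<bar>(c *\<^sub>R u) \<bullet> h\<bar> \<le> C * ((\<bar>c\<bar> * norm h) * (1 + (norm u)\<^sup>2))"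
        by (intro mult_mono C C0) auto
      then show ?thesis by (simp add: norm_mult abs_mult algebra_simps)
    qed
  qed measurable
  have i3: "integrable gauss (\<lambda>u. ?e u z * (W u * (f u)))"
    if [measurable]: "f \<in> borel_measurable borel" and f: "\<And>u. norm (f u) \<le> A + B * (norm u)\<^sup>2" for f A B
  proof (rule integrable_gauss_quadratic)
    show "norm (?e u z * (W u * f u)) \<le> C * A + C * B * (norm u)\<^sup>2" for u
      using mult_mono[OF C f C0 norm_ge_zero, of u u] by (simp add: norm_mult algebra_simps)
  qed measurable
  have "complex_of_real (gen \<nu> G G' z) = (\<integral>y. complex_of_real (jump G G' z y) \<partial>\<nu>)"
    unfolding gen_def integral_complex_of_real ..
  also have "\<dots> = (\<integral>y. (\<integral>u. ?e u z * W u * char_jump (c *\<^sub>R u) y \<partial>gauss) \<partial>\<nu>)"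
  proof (rule Bochner_Integration.integral_cong[OF refl])
    fix y
    have "?e u z * W u * char_jump (c *\<^sub>R u) y = ?e u (z + y) * W u - ?e u z * W u
        - of_real (indicat_real (cball 0 1) y) * (?e u z * W u * (\<i> * of_real ((c *\<^sub>R u) \<bullet> y)))" for u
    proof -
      have "?e u (z + y) = ?e u z * ?e u y"
        by (simp add: exp_add[symmetric] inner_add_right distrib_left)
      then show ?thesis unfolding char_jump_def by (simp only:) (simp add: algebra_simps)
    qed
    then have "(\<integral>u. ?e u z * W u * char_jump (c *\<^sub>R u) y \<partial>gauss)
      = (\<integral>u. ?e u (z + y) * W u - ?e u z * W u
        - of_real (indicat_real (cball 0 1) y) * (?e u z * W u * (\<i> * of_real ((c *\<^sub>R u) \<bullet> y))) \<partial>gauss)"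
      by (simp only:)
    also have "\<dots> = (\<integral>u. ?e u (z + y) * W u \<partial>gauss) - (\<integral>u. ?e u z * W u \<partial>gauss)
        - of_real (indicat_real (cball 0 1) y) * ?D y"
      by (simp only: Bochner_Integration.integral_diff[OF Bochner_Integration.integrable_diff[OF i1 i1] integrable_mult_right[OF i2]]
          Bochner_Integration.integral_diff[OF i1 i1] integral_mult_right_zero)
    also have "\<dots> = complex_of_real (jump G G' z y)"
      using rep[of "z + y"] rep[of z] grad[of y] by (simp add: fourier_def inner_commute)
    finally show "complex_of_real (jump G G' z y) = (\<integral>u. ?e u z * W u * char_jump (c *\<^sub>R u) y \<partial>gauss)" by simp
  qed
  also have "\<dots> = (\<integral>u. (\<integral>y. ?e u z * W u * char_jump (c *\<^sub>R u) y \<partial>\<nu>) \<partial>gauss)"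
  proof (rule GN.Fubini_product_bound)
    show "integrable \<nu> (trunc_powr 2)" by (rule integrable_trunc2)
    show "integrable gauss (\<lambda>u::'a. C * (2 + c\<^sup>2 * (norm u)\<^sup>2))"
      by (intro integrable_mult_right Bochner_Integration.integrable_add integrable_gauss_norm_squared) simp
    show "norm (?e u z * W u * char_jump (c *\<^sub>R u) y) \<le> C * (2 + c\<^sup>2 * (norm u)\<^sup>2) * trunc_powr 2 y" for u y
      using mult_mono[OF C char_jump_bound C0 norm_ge_zero, of u "c *\<^sub>R u" y]
      by (simp add: norm_mult power_mult_distrib mult_ac)
  qed measurable
  also have "\<dots> = (\<integral>u. ?e u z * (W u * (- psi (c *\<^sub>R u))) \<partial>gauss)"
    by (simp add: psi_eq mult.assoc)
  finally have gen: "complex_of_real (gen \<nu> G G' z) = (\<integral>u. ?e u z * (W u * (- psi (c *\<^sub>R u))) \<partial>gauss)" .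
  have j1: "integrable gauss (\<lambda>u. ?e u z * (W u * of_real l))"
    using i3[of "\<lambda>u. of_real l" "\<bar>l\<bar>" 0] by simp
  have j2: "integrable gauss (\<lambda>u. ?e u z * (W u * (- psi (c *\<^sub>R u))))"
  proof (rule i3)
    show "norm (- psi (c *\<^sub>R u)) \<le> 2 * mom 2 + c\<^sup>2 * mom 2 * (norm u)\<^sup>2" for u
      using psi_bound[of "c *\<^sub>R u"] by (simp add: algebra_simps power_mult_distrib)
  qed measurable
  have j3: "integrable gauss (\<lambda>u. ?e u z * W u * (\<i> * of_real ((c *\<^sub>R u) \<bullet> k)))" by (rule i2)
  have "fourier c (\<lambda>u. W u * symbol l k c u) z
    = (\<integral>u. ?e u z * (W u * of_real l) - ?e u z * (W u * (- psi (c *\<^sub>R u)))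
        - ?e u z * W u * (\<i> * of_real ((c *\<^sub>R u) \<bullet> k)) \<partial>gauss)"
    unfolding fourier_def symbol_def by (intro Bochner_Integration.integral_cong refl) (simp add: algebra_simps)
  also have "\<dots> = (\<integral>u. ?e u z * (W u * of_real l) \<partial>gauss) - (\<integral>u. ?e u z * (W u * (- psi (c *\<^sub>R u))) \<partial>gauss) - ?D k"
    by (simp only: Bochner_Integration.integral_diff[OF Bochner_Integration.integrable_diff[OF j1 j2] j3]
        Bochner_Integration.integral_diff[OF j1 j2])
  also have "(\<integral>u. ?e u z * (W u * of_real l) \<partial>gauss) = of_real l * complex_of_real (G z)"
  proof -
    have "?e u z * (W u * of_real l) = of_real l * (?e u z * W u)" for u by simp
    then show ?thesis by (simp only: integral_mult_right_zero rep fourier_def)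
  qed
  finally show ?thesis
    unfolding gen[symmetric] grad[symmetric] by (simp add: op_def inner_commute)
qed

lemma fourier_R:
  assumes W: "integrable gauss W" and g: "holder_bd \<kappa> K g" "0 < \<kappa>"
    and rep: "\<And>z. complex_of_real (g z) = fourier c W z" and t: "0 \<le> t"
  shows "complex_of_real (R t g y) = fourier c (\<lambda>u. W u * exp (- of_real t * psi (c *\<^sub>R u))) y"
proof -
  interpret M: prob_space "\<mu> t" by (rule prob_mu)
  interpret GM: pair_sigma_finite "gauss :: 'a measure" "\<mu> t"
    by (intro pair_sigma_finite.intro M.sigma_finite_measure_axioms sigma_finite_gauss)
  have [measurable]: "W \<in> borel_measurable borel"
    using borel_measurable_integrable[OF W] sets_gauss by (simp cong: measurable_cong_sets)
  let ?e = "\<lambda>u z. exp (\<i> * complex_of_real ((c *\<^sub>R u) \<bullet> z))"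
  have add: "?e u (y + z) * W u = (?e u y * W u) * ?e u z" for u z
    by (simp add: exp_add[symmetric] inner_add_right distrib_left mult_ac)
  have "complex_of_real (R t g y) = (\<integral>z. complex_of_real (g (y + z)) \<partial>\<mu> t)"
    by (simp add: R_def)
  also have "\<dots> = (\<integral>z. (\<integral>u. (?e u y * W u) * ?e u z \<partial>gauss) \<partial>\<mu> t)"
    by (simp only: rep fourier_def add)
  also have "\<dots> = (\<integral>u. (\<integral>z. (?e u y * W u) * ?e u z \<partial>\<mu> t) \<partial>gauss)"
  proof (rule GM.Fubini_product_bound)
    show "integrable gauss (\<lambda>u. norm (W u))" using W by simp
    show "integrable (\<mu> t) (\<lambda>z. 1::real)" by simp
    show "norm (?e u y * W u * ?e u z) \<le> norm (W u) * 1" for u z by (simp add: norm_mult)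
  qed measurable
  also have "\<dots> = (\<integral>u. (?e u y * W u) * (\<integral>z. ?e u z \<partial>\<mu> t) \<partial>gauss)"
    by (simp only: integral_mult_right_zero)
  also have "\<dots> = (\<integral>u. (?e u y * W u) * exp (- of_real t * psi (c *\<^sub>R u)) \<partial>gauss)"
    by (simp only: char_mu[OF t] psi_def)
  finally show ?thesis by (simp add: fourier_def mult.assoc)
qed

lemma fourier_U:
  assumes W: "integrable gauss W" and g: "holder_bd \<kappa> K g" "0 < \<kappa>"
    and rep: "\<And>z. complex_of_real (g z) = fourier c W z" and l: "0 < l"
  shows "complex_of_real (U l k g x) = fourier c (\<lambda>u. W u / symbol l k c u) x"
proof -
  interpret E: prob_space "expm l" using l by (rule prob_expm)
  interpret GE: pair_sigma_finite "gauss :: 'a measure" "expm l"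
    by (intro pair_sigma_finite.intro E.sigma_finite_measure_axioms sigma_finite_gauss)
  have [measurable]: "W \<in> borel_measurable borel"
    using borel_measurable_integrable[OF W] sets_gauss by (simp cong: measurable_cong_sets)
  let ?e = "\<lambda>u z. exp (\<i> * complex_of_real ((c *\<^sub>R u) \<bullet> z))"
  define b where "b u = psi (c *\<^sub>R u) - \<i> * of_real ((c *\<^sub>R u) \<bullet> k)" for u
  have [measurable]: "b \<in> borel_measurable borel" unfolding b_def by measurable
  have b: "0 \<le> Re (b u)" "of_real l + b u = symbol l k c u" for u
    using Re_psi_nonneg[of "c *\<^sub>R u"] by (auto simp: b_def symbol_def)
  \<comment> \<open>Truncating at time 0 changes nothing under \<open>expm l\<close>, and it keeps
    the exponential bounded by 1 at negative times, so that the majorant for Fubini holds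
    everywhere.\<close>
  let ?F = "\<lambda>u t. (?e u x * W u) * exp (- of_real (max 0 t) * b u)"
  have F: "complex_of_real (R t g (x + t *\<^sub>R k)) = (\<integral>u. ?F u t \<partial>gauss)" if "0 < t" for t
  proof -
    have "?e u (x + t *\<^sub>R k) * (W u * exp (- of_real t * psi (c *\<^sub>R u))) = ?F u t" for u
    proof -
      have "?e u (x + t *\<^sub>R k) * exp (- of_real t * psi (c *\<^sub>R u)) = ?e u x * exp (- of_real t * b u)"
        unfolding exp_add[symmetric] b_def by (rule arg_cong[where f=exp]) (simp add: inner_add_right algebra_simps)
      then show ?thesis using that by (simp add: mult_ac max_def)
    qed
    then show ?thesis unfolding fourier_R[OF W g rep less_imp_le[OF that]] fourier_def by (simp only:)
  qed
  have m: "(\<lambda>t. R t g (x + t *\<^sub>R k)) \<in> borel_measurable (expm l)"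
    using U_integrable[OF g l] by auto
  have "complex_of_real (U l k g x) = (\<integral>t. complex_of_real (R t g (x + t *\<^sub>R k)) \<partial>expm l) / of_real l"
    by (simp add: U_def)
  also have "(\<integral>t. complex_of_real (R t g (x + t *\<^sub>R k)) \<partial>expm l) = (\<integral>t. (\<integral>u. ?F u t \<partial>gauss) \<partial>expm l)"
  proof (rule integral_cong_AE)
    show "(\<lambda>t. complex_of_real (R t g (x + t *\<^sub>R k))) \<in> borel_measurable (expm l)" using m by measurable
    show "(\<lambda>t. \<integral>u. ?F u t \<partial>gauss) \<in> borel_measurable (expm l)"
      using GE.M1.sigma_finite_measure_axioms by measurable
    show "AE t in expm l. complex_of_real (R t g (x + t *\<^sub>R k)) = (\<integral>u. ?F u t \<partial>gauss)"
      using AE_expm_pos[OF l] by (auto elim!: eventually_mono simp: F)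
  qed
  also have "\<dots> = (\<integral>u. (\<integral>t. ?F u t \<partial>expm l) \<partial>gauss)"
  proof (rule GE.Fubini_product_bound)
    show "integrable gauss (\<lambda>u. norm (W u))" using W by simp
    show "integrable (expm l) (\<lambda>z. 1::real)" by simp
    show "norm (?F u t) \<le> norm (W u) * 1" for u t
      using b(1)[of u] by (simp add: norm_mult mult_left_le)
  qed measurable
  also have "\<dots> = (\<integral>u. (?e u x * W u) * (of_real l / symbol l k c u) \<partial>gauss)"
  proof (rule Bochner_Integration.integral_cong[OF refl])
    fix u
    have "(\<integral>t. exp (- of_real (max 0 t) * b u) \<partial>expm l)
        = (\<integral>t. exponential_density l t *\<^sub>R exp (- of_real (max 0 t) * b u) \<partial>lborel)"
      unfolding expm_def using exponential_density_nonneg[OF l] by (subst integral_density) auto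
    also have "\<dots> = (\<integral>t. of_real l * (indicator {0..} t *\<^sub>R exp (- of_real t * symbol l k c u)) \<partial>lborel)"
    proof (rule Bochner_Integration.integral_cong[OF refl])
      fix t
      have "exp (- of_real t * symbol l k c u) = exp (- of_real (t * l)) * exp (- of_real t * b u)"
        unfolding b(2)[symmetric] exp_add[symmetric] by (simp add: algebra_simps)
      then show "exponential_density l t *\<^sub>R exp (- of_real (max 0 t) * b u)
          = of_real l * (indicator {0..} t *\<^sub>R exp (- of_real t * symbol l k c u))"
        by (auto simp: exponential_density_def scaleR_conv_of_real exp_of_real[symmetric] split: split_indicator)
    qed
    also have "\<dots> = of_real l / symbol l k c u"
      by (simp only: integral_mult_right_zero exponential_laplace[OF less_le_trans[OF l Re_symbol]]) simp
    finally show "(\<integral>t. ?F u t \<partial>expm l) = (?e u x * W u) * (of_real l / symbol l k c u)"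
      by (simp only: integral_mult_right_zero)
  qed
  also have "\<dots> = of_real l * fourier c (\<lambda>u. W u / symbol l k c u) x"
    by (simp add: fourier_def integral_mult_right_zero[symmetric] mult_ac del: integral_mult_right_zero)
  finally show ?thesis using l by simp
qed


subsection \<open>The resolvent identity and solvability without drift\<close>

text \<open>Some positive exponent is enough here: it makes \<open>op\<close> an admissible argument
  of \<open>U\<close>, with a bound linear in \<open>K\<close> that survives limits. The exponent
  takes at most half of the gap \<open>1 + \<gamma> - \<alpha>\<close>, as \<open>gen_holder\<close>
  loses regularity strictly.\<close>

lemma op_holder:
  assumes \<gamma>: "0 < \<gamma>" "\<gamma> \<le> 1" "\<alpha> < 1 + \<gamma>"
  obtains \<kappa> C where "0 < \<kappa>"
    "\<And>K w w'. C1_bd \<gamma> K w w' \<Longrightarrow> holder_bd \<kappa> (C * K) (op \<nu> l k w w')"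
proof -
  define \<kappa> where "\<kappa> = min \<gamma> ((1 + \<gamma> - \<alpha>) / 2)"
  have \<kappa>: "0 < \<kappa>" "\<kappa> \<le> \<gamma>" "\<kappa> \<le> 1" "\<alpha> < 1 + \<gamma> - \<kappa>"
    using \<gamma> by (auto simp: \<kappa>_def min_def field_simps)
  define C where "C = 2 * \<bar>l\<bar> + 4 * mom (1 + \<gamma> - \<kappa>) + 4 * norm k"
  have "holder_bd \<kappa> (C * K) (op \<nu> l k w w')" if w: "C1_bd \<gamma> K w w'" for K w w'
  proof -
    have "holder_bd \<kappa> (\<bar>l\<bar> * (2 * K)) (\<lambda>x. l *\<^sub>R w x)"
      using \<kappa> by (intro holder_bd_cmult holder_bd_exponent[OF C1_bd_lipschitz[OF w \<gamma>(1)]])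
    moreover have "holder_bd \<kappa> (4 * K * mom (1 + \<gamma> - \<kappa>)) (gen \<nu> w w')"
      by (rule gen_holder[OF w \<gamma>(1) \<kappa>])
    moreover have "holder_bd \<kappa> (2 * norm k * (2 * K)) (\<lambda>x. k \<bullet> w' x)"
      using \<kappa> by (intro holder_bd_inner holder_bd_const holder_bd_exponent[OF C1_bdD(5)[OF w]]) auto
    ultimately have "holder_bd \<kappa> (\<bar>l\<bar> * (2 * K) + 4 * K * mom (1 + \<gamma> - \<kappa>) + 2 * norm k * (2 * K))
        (\<lambda>x. l *\<^sub>R w x - gen \<nu> w w' x - k \<bullet> w' x)"
      by (intro holder_bd_diff)
    then show ?thesis
      by (simp add: op_def[abs_def] C_def algebra_simps)
  qed
  then show ?thesis using that \<kappa>(1) by blast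
qed

lemma op_tendsto:
  assumes w: "\<And>n. C1_bd \<gamma> K (w n) (w' n)" and \<gamma>: "0 < \<gamma>" "\<alpha> < 1 + \<gamma>"
    and lim: "\<And>x. (\<lambda>n. w n x) \<longlonglongrightarrow> u x" "\<And>x. (\<lambda>n. w' n x) \<longlonglongrightarrow> u' x"
  shows "(\<lambda>n. op \<nu> l k (w n) (w' n) x) \<longlonglongrightarrow> op \<nu> l k u u' x"
  unfolding op_def by (intro tendsto_intros lim gen_tendsto[OF w \<gamma> lim])

lemma resolvent_op_limit:
  assumes w: "\<And>n. C1_bd \<gamma> K (w n) (w' n)" and \<gamma>: "0 < \<gamma>" "\<gamma> \<le> 1" "\<alpha> < 1 + \<gamma>" and l: "0 < l"
    and lim: "\<And>x. (\<lambda>n. w n x) \<longlonglongrightarrow> u x" "\<And>x. (\<lambda>n. w' n x) \<longlonglongrightarrow> u' x"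
    and U: "\<And>n. U l k (op \<nu> l k (w n) (w' n)) x = w n x"
  shows "U l k (op \<nu> l k u u') x = u x"
proof -
  obtain \<kappa> C where \<kappa>: "0 < \<kappa>" "\<And>K w w'. C1_bd \<gamma> K w w' \<Longrightarrow> holder_bd \<kappa> (C * K) (op \<nu> l k w w')"
    using op_holder[OF \<gamma>] by blast
  have "(\<lambda>n. U l k (op \<nu> l k (w n) (w' n)) x) \<longlonglongrightarrow> U l k (op \<nu> l k u u') x"
    by (rule U_tendsto[OF \<kappa>(2)[OF w] \<kappa>(1) l op_tendsto[OF w \<gamma>(1,3) lim]])
  then show ?thesis
    unfolding U using lim(1)[of x] LIMSEQ_unique by blast
qed

text \<open>After mollification \<open>w\<close> is a Fourier integral: the operator multiplies its
  coefficient by the symbol and \<open>U\<close> divides by it. The division is legitimate because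
  the real part of the symbol is at least \<open>l\<close>. The mollified functions keep the
  constant \<open>K\<close>, so the limit can be taken.\<close>

lemma resolvent_op_integrable:
  assumes w: "C1_bd \<gamma> K w w'" and \<gamma>: "0 < \<gamma>" "\<gamma> \<le> 1" "\<alpha> < 1 + \<gamma>" and l: "0 < l"
    and int: "integrable lborel w"
  shows "U l k (op \<nu> l k w w') x = w x"
proof (rule resolvent_op_limit[where w="\<lambda>n. mollify n w" and w'="\<lambda>n. mollify n w'", OF _ \<gamma> l])
  show C1: "C1_bd \<gamma> K (mollify n w) (mollify n w')" for n
    by (rule mollify_C1[OF w \<gamma>(1)])
  show "(\<lambda>n. mollify n w x) \<longlonglongrightarrow> w x" for x
    using C1_bdD(1)[OF w] by (intro mollify_tendsto[where K=K] C1_bd_continuous[OF w \<gamma>(1)]) auto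
  show "(\<lambda>n. mollify n w' x) \<longlonglongrightarrow> w' x" for x
    using C1_bdD(2)[OF w] by (intro mollify_tendsto[where K=K] C1_bd_continuous[OF w \<gamma>(1)]) auto
  show "U l k (op \<nu> l k (mollify n w) (mollify n w')) x = mollify n w x" for n
  proof -
    obtain \<kappa> C' where \<kappa>: "0 < \<kappa>" "\<And>K w w'. C1_bd \<gamma> K w w' \<Longrightarrow> holder_bd \<kappa> (C' * K) (op \<nu> l k w w')"
      using op_holder[OF \<gamma>] by blast
    obtain W C where W[measurable]: "W \<in> borel_measurable borel" and C: "\<And>u. norm (W u) \<le> C"
      and rep: "\<And>z. complex_of_real (mollify n w z) = fourier (- real (Suc n)) W z"
      using mollify_fourier[OF int, of n] by blast
    have C0: "0 \<le> C" using order_trans[OF norm_ge_zero C] .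
    define c where "c = - real (Suc n)"
    note rep = rep[folded c_def]
    have i: "integrable gauss (\<lambda>u. W u * symbol l k c u)"
    proof (rule integrable_gauss_quadratic)
      show "norm (W u * symbol l k c u) \<le> C * (\<bar>l\<bar> + 2 * mom 2 + \<bar>c\<bar> * norm k)
          + (C * (c\<^sup>2 * mom 2 + \<bar>c\<bar> * norm k)) * (norm u)\<^sup>2" for u
        using mult_mono[OF C symbol_bound C0 norm_ge_zero, of u l k c u] by (simp add: norm_mult algebra_simps)
    qed measurable
    have nz: "symbol l k c u \<noteq> 0" for u
      using Re_symbol[of l k c u] l by auto
    have "complex_of_real (U l k (op \<nu> l k (mollify n w) (mollify n w')) x)
        = fourier c (\<lambda>u. W u * symbol l k c u / symbol l k c u) x"
      by (rule fourier_U[OF i \<kappa>(2)[OF C1] \<kappa>(1) fourier_op[OF W C C1 \<gamma>(1) rep] l])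
    also have "\<dots> = complex_of_real (mollify n w x)"
      using nz by (simp add: rep)
    finally show ?thesis by (simp only: of_real_eq_iff)
  qed
qed

lemma integrable_bump_mult:
  fixes f :: "'a \<Rightarrow> real"
  assumes [measurable]: "f \<in> borel_measurable borel" and f: "\<And>x. \<bar>f x\<bar> \<le> K" and "0 < c"
  shows "integrable lborel (\<lambda>x. bump c 0 x * f x)"
proof (rule Bochner_Integration.integrable_bound[where f="\<lambda>x. K * exp (- c * (norm x)\<^sup>2)"])
  show "integrable lborel (\<lambda>x::'a. K * exp (- c * (norm x)\<^sup>2))"
    by (intro integrable_mult_right integrable_gaussian assms(3))
  show "(\<lambda>x. bump c 0 x * f x) \<in> borel_measurable lborel" unfolding bump_def by measurable
  show "AE x in lborel. norm (bump c 0 x * f x) \<le> norm (K * exp (- c * (norm x)\<^sup>2))"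
    using f order_trans[OF abs_ge_zero f] by (intro AE_I2) (auto simp: bump_def abs_mult mult_left_mono mult.commute)
qed

lemma bump_seq_tendsto:
  "(\<lambda>n. bump (1 / real (Suc n)) 0 x) \<longlonglongrightarrow> 1" "(\<lambda>n. bump_grad (1 / real (Suc n)) 0 x) \<longlonglongrightarrow> 0"
proof -
  have c: "(\<lambda>n. 1 / real (Suc n)) \<longlonglongrightarrow> 0" by (rule LIMSEQ_Suc[OF lim_1_over_n])
  have "(\<lambda>n. exp (- (1 / real (Suc n)) * (norm (x - 0))\<^sup>2)) \<longlonglongrightarrow> exp (- 0 * (norm (x - 0))\<^sup>2)"
    by (intro tendsto_intros c)
  then show b: "(\<lambda>n. bump (1 / real (Suc n)) 0 x) \<longlonglongrightarrow> 1" by (simp add: bump_def)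
  have "(\<lambda>n. (- 2 * (1 / real (Suc n)) * bump (1 / real (Suc n)) 0 x) *\<^sub>R (x - 0)) \<longlonglongrightarrow> (- 2 * 0 * 1) *\<^sub>R (x - 0)"
    by (intro tendsto_intros c b)
  then show "(\<lambda>n. bump_grad (1 / real (Suc n)) 0 x) \<longlonglongrightarrow> 0" by (simp add: bump_grad_def)
qed

lemma C1_bd_bump_seq:
  assumes "0 < \<gamma>" "\<gamma> \<le> 1"
  shows "C1_bd \<gamma> 12 (bump (1 / real (Suc n)) x0) (bump_grad (1 / real (Suc n)) x0)"
  using C1_bd_exponent[OF C1_bd_bump[of "1 / real (Suc n)" 1 x0] assms] by simp

text \<open>Multiplying by ever wider Gaussians makes \<open>w\<close> integrable. Their
  \<open>C1_bd\<close> constants stay at 12, and the gradients of the weights tend to 0, so the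
  limit returns \<open>w\<close> itself.\<close>

theorem resolvent_op:
  assumes w: "C1_bd \<gamma> K w w'" and \<gamma>: "0 < \<gamma>" "\<gamma> \<le> 1" "\<alpha> < 1 + \<gamma>" and l: "0 < l"
  shows "U l k (op \<nu> l k w w') x = w x"
proof -
  define b where "b n = bump (1 / real (Suc n)) (0::'a)" for n
  define b' where "b' n = bump_grad (1 / real (Suc n)) (0::'a)" for n
  have b: "C1_bd \<gamma> 12 (b n) (b' n)" for n
    unfolding b_def b'_def by (rule C1_bd_bump_seq[OF \<gamma>(1,2)])
  have b_lim: "(\<lambda>n. b n x) \<longlonglongrightarrow> 1" "(\<lambda>n. b' n x) \<longlonglongrightarrow> 0" for x
    unfolding b_def b'_def by (rule bump_seq_tendsto)+
  have C1: "C1_bd \<gamma> (8 * 12 * K) (\<lambda>x. b n x * w x) (\<lambda>x. b n x *\<^sub>R w' x + w x *\<^sub>R b' n x)" for n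
    by (rule C1_bd_mult[OF b w \<gamma>(1,2)])
  show ?thesis
  proof (rule resolvent_op_limit[OF C1 \<gamma> l])
    show "(\<lambda>n. b n x * w x) \<longlonglongrightarrow> w x" for x
      using tendsto_mult[OF b_lim(1) tendsto_const, of x "w x"] by simp
    show "(\<lambda>n. b n x *\<^sub>R w' x + w x *\<^sub>R b' n x) \<longlonglongrightarrow> w' x" for x
      using tendsto_add[OF tendsto_scaleR[OF b_lim(1) tendsto_const] tendsto_scaleR[OF tendsto_const b_lim(2)], of x "w' x" "w x"]
      by simp
    have "integrable lborel (\<lambda>x. b n x * w x)" for n
      unfolding b_def
      by (rule integrable_bump_mult[OF borel_measurable_continuous_onI[OF C1_bd_continuous(1)[OF w \<gamma>(1)]] C1_bdD(1)[OF w]]) simp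
    then show "U l k (op \<nu> l k (\<lambda>x. b n x * w x) (\<lambda>x. b n x *\<^sub>R w' x + w x *\<^sub>R b' n x)) x = b n x * w x" for n
      by (rule resolvent_op_integrable[OF C1 \<gamma> l])
  qed
qed

text \<open>Dividing by the symbol keeps the coefficient bounded, so \<open>U l 0 f\<close> is again
  a Fourier integral and hence differentiable; the size of the gradient then follows from the
  difference bounds. The extra \<open>1 / \<omega>\<close> pays for the sup norm of
  \<open>U l 0 f\<close>.\<close>

lemma resolvent_solves_fourier:
  assumes \<beta>: "0 < \<beta>" "\<beta> < 1" "1 < \<alpha> + \<beta>" "\<alpha> + \<beta> < 2" and \<omega>: "0 < \<omega>" "\<omega> \<le> l"
    and C: "schauder_const \<beta> \<omega> C" and f: "holder_bd \<beta> K f"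
    and W[measurable]: "W \<in> borel_measurable borel" and B: "\<And>u. norm (W u) \<le> B"
    and rep: "\<And>z. complex_of_real (f z) = fourier c W z"
  obtains w' where "C1_bd (\<alpha> + \<beta> - 1) ((C + 1 / \<omega>) * K) (U l 0 f) w'"
    "\<And>x. op \<nu> l 0 (U l 0 f) w' x = f x"
proof -
  have l: "0 < l" using \<omega> by simp
  have K: "0 \<le> K" using f by (rule holder_bd_nonneg)
  have C1: "1 \<le> C" using C by (simp add: schauder_const_def)
  define V where "V u = W u / symbol l 0 c u" for u
  have nz: "symbol l 0 c u \<noteq> 0" for u using Re_symbol[of l 0 c u] l by auto
  have V[measurable]: "V \<in> borel_measurable borel" unfolding V_def by measurable
  have B0: "0 \<le> B" using order_trans[OF norm_ge_zero B] .
  have Vb: "norm (V u) \<le> B / l" for u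
  proof -
    have "l \<le> norm (symbol l 0 c u)" using Re_symbol[of l 0 c u] complex_Re_le_cmod[of "symbol l 0 c u"] by linarith
    then show ?thesis unfolding V_def norm_divide using B B0 l by (intro frac_le) auto
  qed
  have "integrable gauss W"
    by (rule integrable_gauss_quadratic[OF W, where A=B and B=0]) (use B in auto)
  then have repU: "complex_of_real (U l 0 f x) = fourier c V x" for x
    unfolding V_def by (rule fourier_U[OF _ f \<beta>(1) rep l])
  have "\<exists>v. (U l 0 f has_derivative (\<lambda>h. v \<bullet> h)) (at x)" for x
  proof -
    have "fourier c V = (\<lambda>x. complex_of_real (U l 0 f x))" by (simp add: repU fun_eq_iff)
    then obtain D where D: "((\<lambda>x. complex_of_real (U l 0 f x)) has_derivative D) (at x)"
      using fourier_has_derivative[OF V Vb, of c x] by auto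
    have "(U l 0 f has_derivative (\<lambda>h. Re (D h))) (at x)"
      using bounded_linear.has_derivative[OF bounded_linear_Re D] by simp
    moreover from this obtain v where "(\<lambda>h. Re (D h)) = (\<lambda>h. v \<bullet> h)"
      using bounded_linear_real_inner[OF has_derivative_bounded_linear] by blast
    ultimately show ?thesis by auto
  qed
  then obtain w' where w': "\<And>x. (U l 0 f has_derivative (\<lambda>h. w' x \<bullet> h)) (at x)" by metis
  have CK: "C * K \<le> (C + 1 / \<omega>) * K" using K \<omega> by (intro mult_right_mono) auto
  have C1_bd: "C1_bd (\<alpha> + \<beta> - 1) ((C + 1 / \<omega>) * K) (U l 0 f) w'"
  proof (rule C1_bd_of_differences[OF w'])
    show "\<bar>U l 0 f x\<bar> \<le> (C + 1 / \<omega>) * K" for x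
    proof -
      have "\<bar>U l 0 f x\<bar> \<le> K / l" using holder_bdD(1)[OF f] l by (intro U_bound) auto
      also have "\<dots> \<le> K / \<omega>" using K \<omega> by (intro divide_left_mono) auto
      also have "\<dots> \<le> (C + 1 / \<omega>) * K" using K C1 by (simp add: algebra_simps)
      finally show ?thesis .
    qed
    show "\<bar>U l 0 f (x + h) - U l 0 f x\<bar> \<le> (C + 1 / \<omega>) * K * norm h" for x h
      by (rule order_trans[OF schauder_constD(1)[OF C \<omega>(2) f] mult_right_mono[OF CK norm_ge_zero]])
    show "\<bar>incr2 (U l 0 f) x \<eta> h\<bar>
        \<le> (C + 1 / \<omega>) * K * norm h * norm \<eta> powr (\<alpha> + \<beta> - 1)" for x h \<eta>
      by (rule order_trans[OF schauder_constD(2)[OF C \<omega>(2) f]]) (intro mult_right_mono CK norm_ge_zero powr_ge_zero)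
  qed (use \<beta> in simp)
  have "complex_of_real (op \<nu> l 0 (U l 0 f) w' x) = complex_of_real (f x)" for x
    using fourier_op[OF V Vb C1_bd _ repU, of l 0 x] \<beta> nz by (simp add: V_def rep)
  then show ?thesis using that[OF C1_bd] by (simp only: of_real_eq_iff)
qed

text \<open>Convergence of the gradients need not be assumed: the uniform constant \<open>D\<close>
  forces it through \<open>C1_bd_limit\<close>, and the operator is continuous along such
  sequences.\<close>

lemma resolvent_solves_limit:
  assumes \<beta>: "0 < \<beta>" "\<beta> < 1" "1 < \<alpha> + \<beta>" "\<alpha> + \<beta> < 2" and l: "0 < l"
    and f: "\<And>n. holder_bd \<beta> K (f n)" and lim: "\<And>x. (\<lambda>n. f n x) \<longlonglongrightarrow> g x"
    and sol: "\<And>n. \<exists>w'. C1_bd (\<alpha> + \<beta> - 1) D (U l 0 (f n)) w' \<and> (\<forall>x. op \<nu> l 0 (U l 0 (f n)) w' x = f n x)"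
  shows "\<exists>w'. C1_bd (\<alpha> + \<beta> - 1) D (U l 0 g) w' \<and> (\<forall>x. op \<nu> l 0 (U l 0 g) w' x = g x)"
proof -
  have \<theta>: "0 < \<alpha> + \<beta> - 1" "\<alpha> < 1 + (\<alpha> + \<beta> - 1)" using \<beta> by auto
  obtain w' where w': "\<And>n. C1_bd (\<alpha> + \<beta> - 1) D (U l 0 (f n)) (w' n)"
    "\<And>n x. op \<nu> l 0 (U l 0 (f n)) (w' n) x = f n x"
    using sol by metis
  have limU: "(\<lambda>n. U l 0 (f n) x) \<longlonglongrightarrow> U l 0 g x" for x
    by (rule U_tendsto[OF f \<beta>(1) l lim])
  obtain u' where u': "C1_bd (\<alpha> + \<beta> - 1) D (U l 0 g) u'" "\<And>x. (\<lambda>n. w' n x) \<longlonglongrightarrow> u' x"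
    using C1_bd_limit[OF w'(1) \<theta>(1) limU] by blast
  have "op \<nu> l 0 (U l 0 g) u' x = g x" for x
    using op_tendsto[OF w'(1) \<theta> limU u'(2), of l 0 x] lim[of x] LIMSEQ_unique unfolding w'(2) by blast
  then show ?thesis using u'(1) by blast
qed

text \<open>Two approximations are nested: mollification handles integrable \<open>f\<close>, and
  multiplication by wide Gaussians reduces a general \<open>f\<close> to that case. The weights have
  Hoelder constant 12 and the product rule doubles it, whence \<open>24 * D\<close>.\<close>

theorem resolvent_solves:
  assumes \<beta>: "0 < \<beta>" "\<beta> < 1" "1 < \<alpha> + \<beta>" "\<alpha> + \<beta> < 2" and \<omega>: "0 < \<omega>"
  obtains C where "0 \<le> C" "\<And>l K f. \<omega> \<le> l \<Longrightarrow> holder_bd \<beta> K f \<Longrightarrow>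
    \<exists>w w'. C1_bd (\<alpha> + \<beta> - 1) (C * K) w w' \<and> (\<forall>x. op \<nu> l 0 w w' x = f x)"
proof -
  obtain C where C: "schauder_const \<beta> \<omega> C" using ex_schauder_const[OF \<beta> \<omega>] by blast
  define D where "D = C + 1 / \<omega>"
  have D: "0 \<le> D" using C \<omega> by (simp add: D_def schauder_const_def)
  have int: "\<exists>w'. C1_bd (\<alpha> + \<beta> - 1) (D * K) (U l 0 f) w' \<and> (\<forall>x. op \<nu> l 0 (U l 0 f) w' x = f x)"
    if l: "\<omega> \<le> l" and f: "holder_bd \<beta> K f" and i: "integrable lborel f" for l K f
  proof (rule resolvent_solves_limit[OF \<beta>, where f="\<lambda>n. mollify n f"])
    show "0 < l" using l \<omega> by simp
    show h: "holder_bd \<beta> K (mollify n f)" for n by (rule mollify_holder[OF f \<beta>(1)])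
    show "(\<lambda>n. mollify n f x) \<longlonglongrightarrow> f x" for x
      using holder_bdD(1)[OF f] by (intro mollify_tendsto[where K=K] holder_bd_continuous[OF f \<beta>(1)])
    show "\<exists>w'. C1_bd (\<alpha> + \<beta> - 1) (D * K) (U l 0 (mollify n f)) w' \<and>
        (\<forall>x. op \<nu> l 0 (U l 0 (mollify n f)) w' x = mollify n f x)" for n
    proof -
      obtain W B where W: "W \<in> borel_measurable borel" "\<And>u. norm (W u) \<le> B"
        "\<And>z. complex_of_real (mollify n f z) = fourier (- real (Suc n)) W z"
        using mollify_fourier[OF i, of n] by blast
      show ?thesis
        using resolvent_solves_fourier[OF \<beta> \<omega> l C h W] unfolding D_def by blast
    qed
  qed
  have "\<exists>w'. C1_bd (\<alpha> + \<beta> - 1) (24 * D * K) (U l 0 f) w' \<and> (\<forall>x. op \<nu> l 0 (U l 0 f) w' x = f x)"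
    if l: "\<omega> \<le> l" and f: "holder_bd \<beta> K f" for l K f
  proof (rule resolvent_solves_limit[OF \<beta>, where f="\<lambda>n x. bump (1 / real (Suc n)) 0 x * f x"])
    show "0 < l" using l \<omega> by simp
    show h: "holder_bd \<beta> (2 * 12 * K) (\<lambda>x. bump (1 / real (Suc n)) 0 x * f x)" for n
    proof (rule holder_bd_mult[OF _ f])
      have "C1_bd 1 6 (bump (1 / real (Suc n)) (0::'a)) (bump_grad (1 / real (Suc n)) 0)"
        using C1_bd_bump[of "1 / real (Suc n)" 1 "0::'a"] by simp
      from holder_bd_exponent[OF C1_bd_lipschitz[OF this] \<beta>(1)] \<beta>
      show "holder_bd \<beta> 12 (bump (1 / real (Suc n)) (0::'a))" by simp
    qed
    show "(\<lambda>n. bump (1 / real (Suc n)) 0 x * f x) \<longlonglongrightarrow> f x" for x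
      using tendsto_mult[OF bump_seq_tendsto(1) tendsto_const, of x "f x"] by simp
    have "integrable lborel (\<lambda>x. bump (1 / real (Suc n)) 0 x * f x)" for n
      using holder_bdD(1)[OF f]
      by (intro integrable_bump_mult[where K=K] borel_measurable_continuous_onI[OF holder_bd_continuous[OF f \<beta>(1)]]) auto
    from int[OF l h this] show "\<exists>w'. C1_bd (\<alpha> + \<beta> - 1) (24 * D * K) (U l 0 (\<lambda>x. bump (1 / real (Suc n)) 0 x * f x)) w' \<and>
        (\<forall>x. op \<nu> l 0 (U l 0 (\<lambda>x. bump (1 / real (Suc n)) 0 x * f x)) w' x = bump (1 / real (Suc n)) 0 x * f x)" for n
      by (simp add: mult_ac)
  qed
  then show ?thesis using that[of "24 * D"] D by fastforce
qed

end

section \<open>The a priori estimate\<close>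

lemma dist_powr_le_of_small:
  assumes "0 < \<theta>" "\<theta> \<le> 1" "dist x y \<le> 1"
  shows "dist x y \<le> dist x y powr \<theta>"
  using powr_mono'[of \<theta> 1 "dist x y"] assms by simp

context levy_kernel
begin

text \<open>The constant \<open>D\<close> also bounds the lower-order terms created by the localization; the top-order
  term \<open>N\<close> comes with a factor that is small because \<open>b\<close> is nearly constant on the support scale
  of the bump.\<close>

lemma localized_estimate:
  assumes \<beta>: "0 < \<beta>" "\<beta> < 1" "1 < \<alpha> + \<beta>" "\<alpha> + \<beta> < 2" and \<omega>: "0 < \<omega>" and B: "0 < B"
  obtains D where "0 < D"
    "\<And>l b f v v' K M N V0 V1 x x0. \<omega> \<le> l \<Longrightarrow> holder_bd \<beta> B b \<Longrightarrow> holder_bd \<beta> K f \<Longrightarrow>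
      C1_bd (\<alpha> + \<beta> - 1) M v v' \<Longrightarrow> (\<And>x. l * v x - gen \<nu> v v' x - b x \<bullet> v' x = f x) \<Longrightarrow>
      (\<And>x. \<bar>v x\<bar> \<le> V0) \<Longrightarrow> (\<And>x. norm (v' x) \<le> V1) \<Longrightarrow> 0 \<le> N \<Longrightarrow>
      (\<And>x y. norm (v' x - v' y) \<le> N * dist x y powr (\<alpha> + \<beta> - 1)) \<Longrightarrow>
      norm (v' x - v' x0) \<le> (N / 4 + D * (K + V0 + V1)) * dist x x0 powr (\<alpha> + \<beta> - 1)"
proof -
  define \<theta> where "\<theta> = \<alpha> + \<beta> - 1"
  have \<theta>: "0 < \<theta>" "\<theta> \<le> 1" "\<alpha> < 1 + \<theta>" "\<beta> \<le> \<theta>" using \<beta> alpha by (auto simp: \<theta>_def)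
  have \<beta>': "0 < \<beta>" "\<beta> < 1" "\<alpha> < 2 - \<beta>" using \<beta> by auto
  obtain C where C: "schauder_const \<beta> \<omega> C" using ex_schauder_const[OF \<beta> \<omega>] by blast
  have C1: "1 \<le> C" using C by (simp add: schauder_const_def)
  \<comment> \<open>The radius at which the Schauder constant times the oscillation of the drift is
    at most \<open>1 / 4\<close>, the coefficient of \<open>N\<close> to be absorbed.\<close>
  define r where "r = min 1 ((1 / (4 * C * B)) powr (1 / \<beta>))"
  have r: "0 < r" "r \<le> 1" "C * B * r powr \<beta> \<le> 1 / 4"
  proof -
    have CB: "0 < C * B" using C1 B by simp
    show "0 < r" "r \<le> 1" using CB by (auto simp: r_def)
    then have "r powr \<beta> \<le> ((1 / (4 * C * B)) powr (1 / \<beta>)) powr \<beta>"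
      using \<beta> by (intro powr_mono2) (auto simp: r_def)
    also have "\<dots> = 1 / (4 * (C * B))" using \<beta> CB by (simp add: powr_powr mult.assoc)
    finally show "C * B * r powr \<beta> \<le> 1 / 4" using CB by (simp add: field_simps)
  qed
  define c where "c = 1 / r\<^sup>2"
  have c: "0 \<le> c" "1 \<le> c" using r by (auto simp: c_def power_le_one)
  define P where "P = 6 * c"
  have P: "1 \<le> P" using c by (simp add: P_def)
  define m where "m = mom (2 - \<beta>)"
  have m: "0 \<le> m" by (simp add: m_def mom_nonneg)
  define E where "E = 4 * P + (2 * B + 8 * P * B) + 16 * P * m + 16 * P * m + 16 * B * P"
  have E: "0 \<le> E" using P m B by (simp add: E_def)
  \<comment> \<open>\<open>C * E\<close> comes from the Schauder estimate, \<open>P\<close> from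
    passing back from the gradient of \<open>\<rho> * v\<close> to that of \<open>v\<close>, and 2
    from pairs of points at distance more than 1.\<close>
  define D where "D = C * E + P + 2"
  have D: "0 < D" using C1 E P by (simp add: D_def add_nonneg_pos)
  show thesis
  proof (rule that[OF D])
    fix l b f v v' K M N V0 V1 and x x0 :: 'a
    assume l: "\<omega> \<le> l" and b: "holder_bd \<beta> B b" and f: "holder_bd \<beta> K f"
      and v: "C1_bd (\<alpha> + \<beta> - 1) M v v'" and eq: "\<And>x. l * v x - gen \<nu> v v' x - b x \<bullet> v' x = f x"
      and V0: "\<And>x. \<bar>v x\<bar> \<le> V0" and V1: "\<And>x. norm (v' x) \<le> V1" and N: "0 \<le> N"
      and H: "\<And>x y. norm (v' x - v' y) \<le> N * dist x y powr (\<alpha> + \<beta> - 1)"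
    note v = v[folded \<theta>_def] and H = H[folded \<theta>_def]
    have l0: "0 < l" using l \<omega> by simp
    have pos: "0 \<le> V0" "0 \<le> V1" "0 \<le> K"
      using order_trans[OF abs_ge_zero V0] order_trans[OF norm_ge_zero V1] holder_bd_nonneg[OF f] by auto
    define V where "V = V0 + V1"
    have V: "0 \<le> V" using pos by (simp add: V_def)
    define \<rho> where "\<rho> = bump c x0"
    define \<rho>' where "\<rho>' = bump_grad c x0"
    define k where "k = b x0"
    have \<rho>1: "C1_bd 1 P \<rho> \<rho>'"
      unfolding \<rho>_def \<rho>'_def P_def by (rule C1_bd_bump) (use c in auto)
    have \<rho>\<theta>: "C1_bd \<theta> (2 * P) \<rho> \<rho>'" by (rule C1_bd_exponent[OF \<rho>1 \<theta>(1,2)])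
    have \<rho>lip: "holder_bd 1 P \<rho>" by (rule C1_bd_lipschitz[OF \<rho>1]) simp
    have \<rho>\<beta>: "holder_bd \<beta> (2 * P) \<rho>" using \<beta> by (intro holder_bd_exponent[OF \<rho>lip]) auto
    have vlip: "holder_bd 1 V v"
      unfolding holder_bd_def
    proof (intro conjI allI)
      show "norm (v x) \<le> V" for x using V0[of x] pos by (simp add: V_def)
      show "norm (v x - v y) \<le> V * dist x y powr 1" for x y
      proof -
        have "\<bar>v x - v y\<bar> \<le> V1 * norm (x - y)"
          by (rule abs_diff_le_gradient[OF convex_UNIV C1_bd_has_derivative[OF v \<theta>(1)] V1]) auto
        also have "\<dots> \<le> V * norm (x - y)" using pos by (intro mult_right_mono) (auto simp: V_def)
        finally show ?thesis by (simp add: dist_norm)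
      qed
    qed
    have v\<beta>: "holder_bd \<beta> (2 * V) v" using \<beta> by (intro holder_bd_exponent[OF vlip]) auto
    define w where "w x = \<rho> x * v x" for x
    define w' where "w' x = \<rho> x *\<^sub>R v' x + v x *\<^sub>R \<rho>' x" for x
    have w: "C1_bd \<theta> (8 * (2 * P) * M) w w'"
      unfolding w_def[abs_def] w'_def[abs_def] by (rule C1_bd_mult[OF \<rho>\<theta> v \<theta>(1,2)])
    define F where "F = op \<nu> l k w w'"
    \<comment> \<open>The equation for \<open>v\<close> has eliminated
      \<open>gen \<nu> v v'\<close>: what remains is Hoelder of exponent \<open>\<beta>\<close>,
      because the operator acts on \<open>\<rho>\<close> only and \<open>v\<close> enters the
      commutator as a Lipschitz function.\<close>
    have F_eq: "F = (\<lambda>x. \<rho> x * f x + (\<rho> x *\<^sub>R (b x - k)) \<bullet> v' x - v x * gen \<nu> \<rho> \<rho>' x - comm \<nu> \<rho> v x - v x * (k \<bullet> \<rho>' x))"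
    proof
      fix x
      show "F x = \<rho> x * f x + (\<rho> x *\<^sub>R (b x - k)) \<bullet> v' x - v x * gen \<nu> \<rho> \<rho>' x - comm \<nu> \<rho> v x - v x * (k \<bullet> \<rho>' x)"
        unfolding F_def op_def w_def[abs_def] w'_def[abs_def] gen_mult[OF \<rho>\<theta> v \<theta>(1,3)] eq[symmetric]
        by (simp add: inner_add_right inner_diff_left algebra_simps)
    qed
    have F: "holder_bd \<beta> (B * r powr \<beta> * N + E * (K + V0 + V1)) F"
    proof -
      have t1: "holder_bd \<beta> (2 * (2 * P) * K) (\<lambda>x. \<rho> x * f x)" by (rule holder_bd_mult[OF \<rho>\<beta> f])
      \<comment> \<open>The only term of top order. \<open>N\<close> is multiplied by the supremum
        of \<open>\<rho> x *\<^sub>R (b x - k)\<close>, which is small, while the Hoelder constant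
        of that factor, which is not small, meets only \<open>V1\<close>.\<close>
      have t2: "holder_bd \<beta> (B * r powr \<beta> * (N + 2 * V1) + 8 * P * B * V1) (\<lambda>x. (\<rho> x *\<^sub>R (b x - k)) \<bullet> v' x)"
      proof -
        have sup: "norm (\<rho> x *\<^sub>R (b x - k)) \<le> B * r powr \<beta>" for x
        proof -
          have "norm (\<rho> x *\<^sub>R (b x - k)) \<le> \<rho> x * (B * dist x x0 powr \<beta>)"
            using holder_bdD(2)[OF b, of x x0] bump_bounds(1)[of c x0 x]
            by (simp add: \<rho>_def k_def mult_left_mono)
          also have "\<dots> = B * (exp (- (1 / r\<^sup>2) * (dist x x0)\<^sup>2) * dist x x0 powr \<beta>)"
            by (simp add: \<rho>_def bump_def c_def dist_norm)
          also have "\<dots> \<le> B * r powr \<beta>"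
            using B \<beta> r by (intro mult_left_mono bump_weight_le) auto
          finally show ?thesis .
        qed
        have "holder_bd \<beta> (B + B) (\<lambda>x. b x - k)"
          unfolding k_def by (intro holder_bd_diff b holder_bd_const holder_bdD(1)[OF b])
        from holder_bdD(2)[OF holder_bd_scaleR[OF \<rho>\<beta> this]]
        have hol: "norm (\<rho> x *\<^sub>R (b x - k) - \<rho> y *\<^sub>R (b y - k)) \<le> (8 * P * B) * dist x y powr \<beta>" for x y
          by (simp add: mult_ac)
        have v'\<beta>: "norm (v' x - v' y) \<le> (N + 2 * V1) * dist x y powr \<beta>" for x y
        proof (cases "dist x y \<le> 1")
          case True
          have "norm (v' x - v' y) \<le> N * dist x y powr \<theta>" by (rule H)
          also have "\<dots> \<le> N * dist x y powr \<beta>"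
            using True \<theta> \<beta> N by (intro mult_left_mono powr_mono') auto
          also have "\<dots> \<le> (N + 2 * V1) * dist x y powr \<beta>"
            using pos by (intro mult_right_mono) auto
          finally show ?thesis .
        next
          case False
          have "norm (v' x - v' y) \<le> V1 + V1"
            by (rule order_trans[OF norm_triangle_ineq4 add_mono[OF V1 V1]])
          also have "\<dots> \<le> (N + 2 * V1) * 1" using N by simp
          also have "\<dots> \<le> (N + 2 * V1) * dist x y powr \<beta>"
            using False \<beta> N pos by (intro mult_left_mono ge_one_powr_ge_zero) auto
          finally show ?thesis .
        qed
        have rB: "0 \<le> B * r powr \<beta> * (N + 2 * V1)" "0 \<le> 8 * P * B * V1" using B N pos P by auto
        note bl = holder_bilinear[OF bounded_bilinear_inner Cauchy_Schwarz_ineq2[folded real_norm_def] sup hol V1 v'\<beta>]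
        show ?thesis
          unfolding holder_bd_def
        proof (intro conjI allI)
          have "B * r powr \<beta> * V1 \<le> B * r powr \<beta> * (N + 2 * V1)"
            using B N pos by (intro mult_left_mono) auto
          then show "norm ((\<rho> x *\<^sub>R (b x - k)) \<bullet> v' x) \<le> B * r powr \<beta> * (N + 2 * V1) + 8 * P * B * V1" for x
            using bl(1)[of x] rB(2) by linarith
          show "norm ((\<rho> x *\<^sub>R (b x - k)) \<bullet> v' x - (\<rho> y *\<^sub>R (b y - k)) \<bullet> v' y)
              \<le> (B * r powr \<beta> * (N + 2 * V1) + 8 * P * B * V1) * dist x y powr \<beta>" for x y
            by (rule bl(2))
        qed
      qed
      have "holder_bd \<beta> (4 * P * mom (1 + 1 - \<beta>)) (gen \<nu> \<rho> \<rho>')"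
        by (rule gen_holder[OF \<rho>1]) (use \<beta> in auto)
      from holder_bd_mult[OF v\<beta> this]
      have t3: "holder_bd \<beta> (2 * (2 * V) * (4 * P * m)) (\<lambda>x. v x * gen \<nu> \<rho> \<rho>' x)"
        by (simp add: m_def)
      have t4: "holder_bd \<beta> (16 * P * V * m) (comm \<nu> \<rho> v)"
        unfolding m_def by (rule comm_holder[OF \<rho>lip vlip \<beta>'])
      have "holder_bd \<beta> (2 * P) \<rho>'" using \<beta> by (intro holder_bd_exponent[OF C1_bdD(5)[OF \<rho>1]]) auto
      then have "holder_bd \<beta> (2 * B * (2 * P)) (\<lambda>x. k \<bullet> \<rho>' x)"
        unfolding k_def by (intro holder_bd_inner holder_bd_const holder_bdD(1)[OF b])
      from holder_bd_mult[OF v\<beta> this]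
      have t5: "holder_bd \<beta> (2 * (2 * V) * (2 * B * (2 * P))) (\<lambda>x. v x * (k \<bullet> \<rho>' x))" .
      have "holder_bd \<beta> (2 * (2 * P) * K + (B * r powr \<beta> * (N + 2 * V1) + 8 * P * B * V1)
          + 2 * (2 * V) * (4 * P * m) + 16 * P * V * m + 2 * (2 * V) * (2 * B * (2 * P))) F"
        unfolding F_eq by (intro holder_bd_diff holder_bd_add t1 t2 t3 t4 t5)
      then show ?thesis
      proof (rule holder_bd_mono)
        have "4 * P * K \<le> 4 * P * (K + V0 + V1)" using P pos by (intro mult_left_mono) auto
        moreover have "B * r powr \<beta> * (2 * V1) + 8 * P * B * V1 \<le> (2 * B + 8 * P * B) * (K + V0 + V1)"
        proof -
          have "r powr \<beta> \<le> 1" using r \<beta> powr_mono2[of \<beta> r 1] by simp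
          then have "B * r powr \<beta> * (2 * V1) \<le> B * 1 * (2 * V1)"
            using B pos by (intro mult_right_mono mult_left_mono) auto
          moreover have "(2 * B + 8 * P * B) * V1 \<le> (2 * B + 8 * P * B) * (K + V0 + V1)"
            using P B pos by (intro mult_left_mono) auto
          ultimately show ?thesis by (simp add: algebra_simps)
        qed
        moreover have "(16 * P * m + 16 * P * m + 16 * B * P) * V \<le> (16 * P * m + 16 * P * m + 16 * B * P) * (K + V0 + V1)"
          using P B m pos by (intro mult_left_mono) (auto simp: V_def)
        ultimately show "2 * (2 * P) * K + (B * r powr \<beta> * (N + 2 * V1) + 8 * P * B * V1)
          + 2 * (2 * V) * (4 * P * m) + 16 * P * V * m + 2 * (2 * V) * (2 * B * (2 * P))
          \<le> B * r powr \<beta> * N + E * (K + V0 + V1)"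
          by (simp add: E_def algebra_simps)
      qed
    qed
    define KF where "KF = B * r powr \<beta> * N + E * (K + V0 + V1)"
    \<comment> \<open>The constant \<open>M\<close> is consumed here: it makes the resolvent
      identity applicable to \<open>w\<close> and does not enter the bound
      \<open>KF\<close>.\<close>
    have Uw: "U l k F x = w x" for x
      unfolding F_def by (rule resolvent_op[OF w \<theta>(1,2,3) l0])
    have w'H: "norm (w' y - w' z) \<le> C * KF * dist y z powr \<theta>" for y z
    proof (rule gradient_holder_of_second_difference[OF C1_bd_has_derivative[OF w \<theta>(1)]])
      show "\<bar>incr2 w x \<eta> h\<bar> \<le> C * KF * norm h * norm \<eta> powr \<theta>" for x h \<eta>
        using schauder_constD(2)[OF C l F, of k x \<eta> h] unfolding Uw \<theta>_def KF_def by simp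
    qed
    have d_le: "dist x x0 \<le> dist x x0 powr \<theta>" if "dist x x0 \<le> 1"
      using \<theta> that by (intro dist_powr_le_of_small) auto
    show "norm (v' x - v' x0) \<le> (N / 4 + D * (K + V0 + V1)) * dist x x0 powr (\<alpha> + \<beta> - 1)"
    proof (cases "dist x x0 \<le> 1")
      case True
      \<comment> \<open>At the centre the bump is 1 and critical, so there the gradients of
        \<open>w\<close> and \<open>v\<close> coincide; away from it the correction is linear in the
        distance.\<close>
      have \<rho>0: "\<rho> x0 = 1" "\<rho>' x0 = 0" by (auto simp: \<rho>_def \<rho>'_def bump_center bump_grad_def)
      have "v' x - v' x0 = (w' x - w' x0) + ((\<rho> x0 - \<rho> x) *\<^sub>R v' x - v x *\<^sub>R (\<rho>' x - \<rho>' x0))"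
        by (simp add: w'_def \<rho>0 algebra_simps)
      also have "norm \<dots> \<le> C * KF * dist x x0 powr \<theta> + (P * dist x x0 * V1 + V0 * (P * dist x x0))"
      proof (intro norm_triangle_mono w'H)
        have "norm ((\<rho> x0 - \<rho> x) *\<^sub>R v' x) \<le> (P * dist x x0) * V1"
          unfolding norm_scaleR using holder_bdD(2)[OF \<rho>lip, of x0 x] P
          by (intro mult_mono V1) (auto simp: dist_commute)
        moreover have "norm (v x *\<^sub>R (\<rho>' x - \<rho>' x0)) \<le> V0 * (P * dist x x0)"
          unfolding norm_scaleR using C1_bdD(3)[OF \<rho>1, of x x0] pos
          by (intro mult_mono V0) auto
        ultimately show "norm ((\<rho> x0 - \<rho> x) *\<^sub>R v' x - v x *\<^sub>R (\<rho>' x - \<rho>' x0)) \<le> P * dist x x0 * V1 + V0 * (P * dist x x0)"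
          by (rule order_trans[OF norm_triangle_ineq4 add_mono])
      qed
      also have "P * dist x x0 * V1 + V0 * (P * dist x x0) = (P * (V0 + V1)) * dist x x0"
        by (simp add: algebra_simps)
      also have "\<dots> \<le> (P * (V0 + V1)) * dist x x0 powr \<theta>"
        using P pos d_le[OF True] by (intro mult_left_mono) auto
      also have "C * KF * dist x x0 powr \<theta> + (P * (V0 + V1)) * dist x x0 powr \<theta> = (C * KF + P * (V0 + V1)) * dist x x0 powr \<theta>"
        by (simp add: algebra_simps)
      also have "\<dots> \<le> (N / 4 + D * (K + V0 + V1)) * dist x x0 powr \<theta>"
      proof (intro mult_right_mono powr_ge_zero)
        have "C * B * r powr \<beta> * N \<le> 1 / 4 * N" using r N by (intro mult_right_mono) auto
        moreover have "P * (V0 + V1) \<le> (P + 2) * (K + V0 + V1)" using P pos by (intro mult_mono) auto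
        ultimately show "C * KF + P * (V0 + V1) \<le> N / 4 + D * (K + V0 + V1)"
          by (simp add: KF_def D_def algebra_simps)
      qed
      finally show ?thesis by (simp add: \<theta>_def)
    next
      case False
      have "norm (v' x - v' x0) \<le> 2 * V1 * 1"
        using norm_triangle_ineq4[of "v' x" "v' x0"] V1[of x] V1[of x0] by linarith
      also have "\<dots> \<le> 2 * V1 * dist x x0 powr \<theta>"
        using False \<theta> pos by (intro mult_left_mono ge_one_powr_ge_zero) auto
      also have "\<dots> \<le> (N / 4 + D * (K + V0 + V1)) * dist x x0 powr \<theta>"
      proof (intro mult_right_mono powr_ge_zero)
        have "2 * V1 \<le> D * (K + V0 + V1)"
          using pos C1 E P by (intro mult_mono) (auto simp: D_def)
        then show "2 * V1 \<le> N / 4 + D * (K + V0 + V1)" using N by linarith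
      qed
      finally show ?thesis by (simp add: \<theta>_def)
    qed
  qed
qed

text \<open>The maximum principle bounds \<open>v\<close> by \<open>K / \<omega>\<close>, and
  interpolation bounds the gradient by this and a small multiple of the Hoelder constant
  \<open>N\<close>. The localized estimate then replaces any valid \<open>N\<close> by
  \<open>N / 2 + A * K\<close>; iterating from the qualitative \<open>M\<close> leaves
  \<open>2 * A * K\<close> in the limit.\<close>

theorem a_priori_estimate:
  assumes \<beta>: "0 < \<beta>" "\<beta> < 1" "1 < \<alpha> + \<beta>" "\<alpha> + \<beta> < 2" and \<omega>: "0 < \<omega>" and B: "0 < B"
  obtains C where "0 < C"
    "\<And>l b f v v' K M. \<omega> \<le> l \<Longrightarrow> holder_bd \<beta> B b \<Longrightarrow> holder_bd \<beta> K f \<Longrightarrow>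
      C1_bd (\<alpha> + \<beta> - 1) M v v' \<Longrightarrow> (\<And>x. l * v x - gen \<nu> v v' x - b x \<bullet> v' x = f x) \<Longrightarrow>
      C1_bd (\<alpha> + \<beta> - 1) (C * K) v v'"
proof -
  define \<theta> where "\<theta> = \<alpha> + \<beta> - 1"
  have \<theta>: "0 < \<theta>" "\<theta> \<le> 1" "\<alpha> < 1 + \<theta>" using \<beta> by (auto simp: \<theta>_def)
  obtain D where D: "0 < D"
    "\<And>l b f v v' K M N V0 V1 x x0. \<omega> \<le> l \<Longrightarrow> holder_bd \<beta> B b \<Longrightarrow> holder_bd \<beta> K f \<Longrightarrow>
      C1_bd \<theta> M v v' \<Longrightarrow> (\<And>x. l * v x - gen \<nu> v v' x - b x \<bullet> v' x = f x) \<Longrightarrow>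
      (\<And>x. \<bar>v x\<bar> \<le> V0) \<Longrightarrow> (\<And>x. norm (v' x) \<le> V1) \<Longrightarrow> 0 \<le> N \<Longrightarrow>
      (\<And>x y. norm (v' x - v' y) \<le> N * dist x y powr \<theta>) \<Longrightarrow>
      norm (v' x - v' x0) \<le> (N / 4 + D * (K + V0 + V1)) * dist x x0 powr \<theta>"
    using localized_estimate[OF \<beta> \<omega> B, folded \<theta>_def] by blast
  \<comment> \<open>Chosen so that \<open>D * \<delta> powr \<theta> = 1 / 4\<close>: the share of
    \<open>N\<close> coming from interpolation adds to the \<open>N / 4\<close> of the localized
    estimate and makes \<open>N / 2\<close>.\<close>
  define \<delta> where "\<delta> = (1 / (4 * D)) powr (1 / \<theta>)"
  have \<delta>: "0 < \<delta>" "\<delta> powr \<theta> = 1 / (4 * D)" using D(1) \<theta> by (auto simp: \<delta>_def powr_powr)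
  define A where "A = D * (1 + 1 / \<omega> + 2 / (\<omega> * \<delta>))"
  have A: "0 < A" using D(1) \<omega> \<delta>(1) by (simp add: A_def add_pos_pos)
  define C where "C = 1 / \<omega> + (2 / (\<omega> * \<delta>) + 2 * A * \<delta> powr \<theta>) + 2 * A"
  have pos: "0 < 1 / \<omega>" "0 < 2 / (\<omega> * \<delta>)" "0 < 2 * A * \<delta> powr \<theta>" using \<omega> \<delta> A D(1) by auto
  have C: "0 < C" "1 / \<omega> \<le> C" "2 / (\<omega> * \<delta>) + 2 * A * \<delta> powr \<theta> \<le> C" "2 * A \<le> C"
    using pos A unfolding C_def by linarith+
  show thesis
  proof (rule that[OF C(1)])
    fix l b f v v' K M
    assume l: "\<omega> \<le> l" and b: "holder_bd \<beta> B b" and f: "holder_bd \<beta> K f"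
      and v: "C1_bd (\<alpha> + \<beta> - 1) M v v'" and eq: "\<And>x. l * v x - gen \<nu> v v' x - b x \<bullet> v' x = f x"
    note v = v[folded \<theta>_def]
    have l0: "0 < l" using l \<omega> by simp
    have K: "0 \<le> K" using f by (rule holder_bd_nonneg)
    have V0: "\<bar>v x\<bar> \<le> K / \<omega>" for x
    proof -
      have "l * \<bar>v x\<bar> \<le> K"
        using holder_bdD(1)[OF b] holder_bdD(1)[OF f] eq
        by (intro maximum_principle_abs[OF v \<theta> l0, where b=b and B=B and f=f]) auto
      moreover have "\<omega> * \<bar>v x\<bar> \<le> l * \<bar>v x\<bar>" using l by (intro mult_right_mono) auto
      ultimately show ?thesis using \<omega> by (simp add: field_simps)
    qed
    have V1: "norm (v' x) \<le> 2 * (K / \<omega>) / \<delta> + N * \<delta> powr \<theta>"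
      if "0 \<le> N" "\<And>x y. norm (v' x - v' y) \<le> N * dist x y powr \<theta>" for N x
      by (rule gradient_interpolation[OF \<delta>(1) V0 taylor_of_gradient_holder[OF C1_bd_has_derivative[OF v \<theta>(1)] that(2) \<theta>(1) that(1)]])
    have improve: "norm (v' x - v' y) \<le> (N / 2 + A * K) * dist x y powr \<theta>"
      if N: "0 \<le> N" "\<And>x y. norm (v' x - v' y) \<le> N * dist x y powr \<theta>" for N x y
    proof -
      have "norm (v' x - v' y) \<le> (N / 4 + D * (K + K / \<omega> + (2 * (K / \<omega>) / \<delta> + N * \<delta> powr \<theta>))) * dist x y powr \<theta>"
        by (rule D(2)[OF l b f v eq V0 V1[OF N] N])
      also have "N / 4 + D * (K + K / \<omega> + (2 * (K / \<omega>) / \<delta> + N * \<delta> powr \<theta>)) = N / 2 + A * K"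
        unfolding \<delta>(2) A_def using D(1) \<delta>(1) \<omega> by (simp add: field_simps)
      finally show ?thesis .
    qed
    have M: "0 \<le> M" using v by (rule C1_bd_nonneg)
    have iter: "norm (v' x - v' y) \<le> (M / 2 ^ n + 2 * A * K) * dist x y powr \<theta>" for n x y
    proof (induction n arbitrary: x y)
      case 0
      have "norm (v' x - v' y) \<le> M * dist x y powr \<theta>" by (rule C1_bdD(3)[OF v])
      also have "\<dots> \<le> (M / 2 ^ 0 + 2 * A * K) * dist x y powr \<theta>"
        using A K by (intro mult_right_mono) auto
      finally show ?case .
    next
      case (Suc n)
      have "0 \<le> M / 2 ^ n + 2 * A * K" using M A K by simp
      from improve[OF this Suc.IH, of x y] show ?case by (simp add: field_simps)
    qed
    have H: "norm (v' x - v' y) \<le> (2 * A * K) * dist x y powr \<theta>" for x y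
    proof (rule LIMSEQ_le_const)
      have "(\<lambda>n. (M * (1 / 2) ^ n + 2 * A * K) * dist x y powr \<theta>) \<longlonglongrightarrow> (M * 0 + 2 * A * K) * dist x y powr \<theta>"
        by (intro tendsto_intros LIMSEQ_realpow_zero) auto
      then show "(\<lambda>n. (M * (1 / 2) ^ n + 2 * A * K) * dist x y powr \<theta>) \<longlonglongrightarrow> (2 * A * K) * dist x y powr \<theta>"
        by simp
      show "\<exists>N. \<forall>n\<ge>N. norm (v' x - v' y) \<le> (M * (1 / 2) ^ n + 2 * A * K) * dist x y powr \<theta>"
        using iter[of x y] by (simp add: power_one_over)
    qed
    have AK: "0 \<le> 2 * A * K" using A K by simp
    show "C1_bd (\<alpha> + \<beta> - 1) (C * K) v v'"
      unfolding \<theta>_def[symmetric]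
    proof (rule C1_bdI[OF C1_bd_has_derivative[OF v \<theta>(1)] _ _ \<theta>(1)])
      show "\<bar>v x\<bar> \<le> C * K" for x
        using V0[of x] mult_right_mono[OF C(2) K] by simp
      show "holder_bd \<theta> (C * K) v'"
        unfolding holder_bd_def
      proof (intro conjI allI)
        have "2 * (K / \<omega>) / \<delta> + (2 * A * K) * \<delta> powr \<theta> = (2 / (\<omega> * \<delta>) + 2 * A * \<delta> powr \<theta>) * K"
          using \<omega> \<delta>(1) by (simp add: algebra_simps)
        then show "norm (v' x) \<le> C * K" for x
          using V1[OF AK H, of x] mult_right_mono[OF C(3) K] by linarith
        show "norm (v' x - v' y) \<le> C * K * dist x y powr \<theta>" for x y
          using H[of x y] mult_right_mono[OF mult_right_mono[OF C(4) K], of "dist x y powr \<theta>"] by simp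
      qed
    qed
  qed
qed

section \<open>Solvability by the method of continuity\<close>

text \<open>A Neumann series: the excess drift applied to each solution becomes the next right-hand
  side. \<open>small\<close> makes every step halve the Hoelder constant; the 4 is a 2 from lowering
  the gradient exponent to \<open>\<beta>\<close> times a 2 from the inner product. The sum of the
  constants \<open>C * K / 2 ^ n\<close> is \<open>2 * C * K\<close>.\<close>

lemma perturb_solvability:
  assumes \<beta>: "0 < \<beta>" "\<beta> < 1" "1 < \<alpha> + \<beta>" "\<alpha> + \<beta> < 2"
    and b: "holder_bd \<beta> B b" and C: "0 < C" and small: "C * (4 * \<bar>s - s0\<bar> * B) \<le> 1 / 2"
    and sol: "\<And>K f. holder_bd \<beta> K f \<Longrightarrow> \<exists>v v'. (\<forall>L. holder_bd \<beta> L f \<longrightarrow> C1_bd (\<alpha> + \<beta> - 1) (C * L) v v') \<and>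
      (\<forall>x. l * v x - gen \<nu> v v' x - (s0 *\<^sub>R b x) \<bullet> v' x = f x)"
    and f: "holder_bd \<beta> K f"
  shows "\<exists>v v'. C1_bd (\<alpha> + \<beta> - 1) (2 * C * K) v v' \<and> (\<forall>x. l * v x - gen \<nu> v v' x - (s *\<^sub>R b x) \<bullet> v' x = f x)"
proof -
  define \<theta> where "\<theta> = \<alpha> + \<beta> - 1"
  have \<theta>: "0 < \<theta>" "\<theta> \<le> 1" "\<alpha> < 1 + \<theta>" "\<beta> \<le> \<theta>" using \<beta> alpha by (auto simp: \<theta>_def)
  have K: "0 \<le> K" using f by (rule holder_bd_nonneg)
  obtain T T' where T: "\<And>L g. holder_bd \<beta> L g \<Longrightarrow> C1_bd \<theta> (C * L) (T g) (T' g)"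
    "\<And>L g x. holder_bd \<beta> L g \<Longrightarrow> l * T g x - gen \<nu> (T g) (T' g) x - (s0 *\<^sub>R b x) \<bullet> T' g x = g x"
  proof -
    have "\<forall>g. \<exists>v v'. (\<exists>L. holder_bd \<beta> L g) \<longrightarrow> (\<forall>L. holder_bd \<beta> L g \<longrightarrow> C1_bd \<theta> (C * L) v v') \<and>
      (\<forall>x. l * v x - gen \<nu> v v' x - (s0 *\<^sub>R b x) \<bullet> v' x = g x)"
      using sol unfolding \<theta>_def by blast
    then obtain T T' where "\<forall>g. (\<exists>L. holder_bd \<beta> L g) \<longrightarrow> (\<forall>L. holder_bd \<beta> L g \<longrightarrow> C1_bd \<theta> (C * L) (T g) (T' g)) \<and>
      (\<forall>x. l * T g x - gen \<nu> (T g) (T' g) x - (s0 *\<^sub>R b x) \<bullet> T' g x = g x)"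
      by metis
    then show ?thesis using that by blast
  qed
  define g where "g = rec_nat f (\<lambda>_ h x. (s - s0) * (b x \<bullet> T' h x))"
  have g0: "g 0 = f" and gS: "g (Suc n) = (\<lambda>x. (s - s0) * (b x \<bullet> T' (g n) x))" for n
    by (simp_all add: g_def)
  have g: "holder_bd \<beta> (K * (1 / 2) ^ n) (g n)" for n
  proof (induction n)
    case 0
    then show ?case using f by (simp add: g0)
  next
    case (Suc n)
    have "holder_bd \<beta> (2 * (C * (K * (1 / 2) ^ n))) (T' (g n))"
      by (rule holder_bd_exponent[OF C1_bdD(5)[OF T(1)[OF Suc]] \<beta>(1) \<theta>(4)])
    from holder_bd_cmult[OF holder_bd_inner[OF b this], of "s - s0"]
    have "holder_bd \<beta> (\<bar>s - s0\<bar> * (2 * B * (2 * (C * (K * (1 / 2) ^ n))))) (g (Suc n))"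
      by (simp add: gS)
    moreover have "\<bar>s - s0\<bar> * (2 * B * (2 * (C * (K * (1 / 2) ^ n)))) \<le> K * (1 / 2) ^ Suc n"
      using mult_right_mono[OF small, of "K * (1 / 2) ^ n"] K by (simp add: mult_ac)
    ultimately show ?case by (rule holder_bd_mono)
  qed
  note d = T(1)[OF g] and d_eq = T(2)[OF g]
  define v where "v n x = (\<Sum>i\<le>n. T (g i) x)" for n x
  define v' where "v' n x = (\<Sum>i\<le>n. T' (g i) x)" for n x
  have v: "C1_bd \<theta> (C * K * (2 - (1 / 2) ^ n)) (v n) (v' n)" for n
  proof (induction n)
    case 0
    then show ?case using d[of 0] by (simp add: v_def[abs_def] v'_def[abs_def])
  next
    case (Suc n)
    from C1_bd_add[OF Suc d[of "Suc n"] \<theta>(1)]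
    have "C1_bd \<theta> (C * K * (2 - (1 / 2) ^ n) + C * (K * (1 / 2) ^ Suc n)) (v (Suc n)) (v' (Suc n))"
      by (simp add: v_def[abs_def] v'_def[abs_def])
    then show ?case by (rule C1_bd_mono) (simp add: algebra_simps)
  qed
  have CK: "0 \<le> C * K" using C K by simp
  have v2: "C1_bd \<theta> (2 * C * K) (v n) (v' n)" for n
    by (rule C1_bd_mono[OF v]) (use mult_left_mono[OF _ CK, of "2 - (1 / 2) ^ n" 2] in simp)
  \<comment> \<open>The sums telescope: moving the drift from \<open>s0\<close> to \<open>s\<close>
    cancels every right-hand side except the first and leaves the next one as residual.\<close>
  have v_eq: "l * v n x - gen \<nu> (v n) (v' n) x - (s *\<^sub>R b x) \<bullet> v' n x = f x - g (Suc n) x" for n x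
  proof -
    have "l * v n x - gen \<nu> (v n) (v' n) x - (s0 *\<^sub>R b x) \<bullet> v' n x = (\<Sum>i\<le>n. g i x)"
    proof (induction n)
      case 0
      then show ?case using d_eq[of 0 x] by (simp add: v_def[abs_def] v'_def[abs_def])
    next
      case (Suc n)
      have "gen \<nu> (v (Suc n)) (v' (Suc n)) x = gen \<nu> (v n) (v' n) x + gen \<nu> (T (g (Suc n))) (T' (g (Suc n))) x"
        using gen_add[OF v d[of "Suc n"] \<theta>(1,3), of n x] by (simp add: v_def[abs_def] v'_def[abs_def])
      moreover have "v (Suc n) x = v n x + T (g (Suc n)) x" "v' (Suc n) x = v' n x + T' (g (Suc n)) x"
        by (simp_all add: v_def v'_def)
      ultimately show ?case using Suc d_eq[of "Suc n" x] by (simp add: inner_add_right algebra_simps)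
    qed
    also have "(\<Sum>i\<le>n. g i x) = f x + (s - s0) * (b x \<bullet> v' n x) - g (Suc n) x"
    proof (induction n)
      case 0
      then show ?case by (simp add: g0 gS v'_def)
    next
      case (Suc n)
      then show ?case by (simp add: gS v'_def inner_add_right algebra_simps)
    qed
    finally show ?thesis by (simp add: algebra_simps)
  qed
  have geo: "summable (\<lambda>n. C * (K * (1 / 2) ^ n))"
    by (intro summable_mult summable_geometric) simp
  have "summable (\<lambda>i. T (g i) x)" for x
    using C1_bdD(1)[OF d] by (intro summable_comparison_test'[OF geo, where N=0]) auto
  then have lim: "(\<lambda>n. v n x) \<longlonglongrightarrow> (\<Sum>i. T (g i) x)" for x
    unfolding v_def by (rule summable_LIMSEQ')
  obtain u' where u': "C1_bd \<theta> (2 * C * K) (\<lambda>x. \<Sum>i. T (g i) x) u'" "\<And>x. (\<lambda>n. v' n x) \<longlonglongrightarrow> u' x"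
    using C1_bd_limit[OF v2 \<theta>(1) lim] by blast
  have "l * (\<Sum>i. T (g i) x) - gen \<nu> (\<lambda>x. \<Sum>i. T (g i) x) u' x - (s *\<^sub>R b x) \<bullet> u' x = f x" for x
  proof (rule LIMSEQ_unique)
    show "(\<lambda>n. l * v n x - gen \<nu> (v n) (v' n) x - (s *\<^sub>R b x) \<bullet> v' n x)
        \<longlonglongrightarrow> l * (\<Sum>i. T (g i) x) - gen \<nu> (\<lambda>x. \<Sum>i. T (g i) x) u' x - (s *\<^sub>R b x) \<bullet> u' x"
      by (intro tendsto_intros lim u'(2) gen_tendsto[OF v2 \<theta>(1,3) lim u'(2)])
    have "(\<lambda>n. K * (1 / 2) ^ n) \<longlonglongrightarrow> K * 0" by (intro tendsto_intros LIMSEQ_realpow_zero) auto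
    then have K_lim: "(\<lambda>n. K * (1 / 2) ^ n) \<longlonglongrightarrow> 0" by simp
    have "(\<lambda>n. g n x) \<longlonglongrightarrow> 0"
      by (rule Lim_null_comparison[OF always_eventually K_lim]) (intro allI holder_bdD(1)[OF g])
    then have "(\<lambda>n. f x - g (Suc n) x) \<longlonglongrightarrow> f x - 0" by (intro tendsto_diff tendsto_const LIMSEQ_Suc)
    then show "(\<lambda>n. l * v n x - gen \<nu> (v n) (v' n) x - (s *\<^sub>R b x) \<bullet> v' n x) \<longlonglongrightarrow> f x"
      unfolding v_eq by simp
  qed
  then show ?thesis
    unfolding \<theta>_def[symmetric] by (intro exI[of _ "\<lambda>x. \<Sum>i. T (g i) x"] exI[of _ u'] conjI u'(1) allI)
qed

theorem drift_solvability:
  assumes \<beta>: "0 < \<beta>" "\<beta> < 1" "1 < \<alpha> + \<beta>" "\<alpha> + \<beta> < 2" and l: "0 < l"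
    and b: "holder_bd \<beta> B b" and f: "holder_bd \<beta> K f"
  shows "\<exists>v v' M. C1_bd (\<alpha> + \<beta> - 1) M v v' \<and> (\<forall>x. l * v x - gen \<nu> v v' x - b x \<bullet> v' x = f x)"
proof -
  define B' where "B' = B + 1"
  have B': "0 < B'" using holder_bd_nonneg[OF b] by (simp add: B'_def)
  have b': "holder_bd \<beta> B' b" by (rule holder_bd_mono[OF b]) (simp add: B'_def)
  have sb: "holder_bd \<beta> B' (\<lambda>x. s *\<^sub>R b x)" if "0 \<le> s" "s \<le> 1" for s
    using that B' by (intro holder_bd_mono[OF holder_bd_cmult[OF b']]) (simp add: mult_left_le_one_le)
  obtain C where C: "0 < C"
    "\<And>b f v v' K M. holder_bd \<beta> B' b \<Longrightarrow> holder_bd \<beta> K f \<Longrightarrow>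
      C1_bd (\<alpha> + \<beta> - 1) M v v' \<Longrightarrow> (\<And>x. l * v x - gen \<nu> v v' x - b x \<bullet> v' x = f x) \<Longrightarrow>
      C1_bd (\<alpha> + \<beta> - 1) (C * K) v v'"
    using a_priori_estimate[OF \<beta> l B'] by (metis order_refl)
  define solvable where "solvable s \<longleftrightarrow> (\<forall>K f. holder_bd \<beta> K f \<longrightarrow>
    (\<exists>v v' M. C1_bd (\<alpha> + \<beta> - 1) M v v' \<and> (\<forall>x. l * v x - gen \<nu> v v' x - (s *\<^sub>R b x) \<bullet> v' x = f x)))" for s
  have 0: "solvable 0"
  proof -
    obtain D where "\<And>K f. holder_bd \<beta> K f \<Longrightarrow>
        \<exists>w w'. C1_bd (\<alpha> + \<beta> - 1) (D * K) w w' \<and> (\<forall>x. op \<nu> l 0 w w' x = f x)"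
      using resolvent_solves[OF \<beta> l] by (metis order_refl)
    then show ?thesis unfolding solvable_def op_def by (simp add: inner_zero_left) blast
  qed
  \<comment> \<open>The step length depends only on the a priori constant and on the common Hoelder
    bound of all the drifts \<open>s *\<^sub>R b\<close>, so finitely many equal steps reach
    \<open>s = 1\<close>.\<close>
  define \<delta> where "\<delta> = 1 / (8 * C * B')"
  have \<delta>: "0 < \<delta>" using C(1) B' by (simp add: \<delta>_def)
  have step: "solvable s" if s0: "solvable s0" "0 \<le> s0" "s0 \<le> 1" and s: "\<bar>s - s0\<bar> \<le> \<delta>" for s s0
    unfolding solvable_def
  proof (intro allI impI)
    fix K and f :: "'a \<Rightarrow> real" assume f: "holder_bd \<beta> K f"
    have "4 * C * B' * \<bar>s - s0\<bar> \<le> 4 * C * B' * \<delta>" using s C(1) B' by (intro mult_left_mono) auto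
    also have "\<dots> = 1 / 2" using C(1) B' by (simp add: \<delta>_def)
    finally have small: "C * (4 * \<bar>s - s0\<bar> * B') \<le> 1 / 2" by (simp add: mult_ac)
    \<comment> \<open>\<open>solvable\<close> records no quantitative bound. The a priori estimate
      restores the same constant \<open>C\<close> before each step, so the doubled constant of the
      Neumann series does not accumulate.\<close>
    have sol: "\<exists>v v'. (\<forall>L. holder_bd \<beta> L f \<longrightarrow> C1_bd (\<alpha> + \<beta> - 1) (C * L) v v') \<and>
      (\<forall>x. l * v x - gen \<nu> v v' x - (s0 *\<^sub>R b x) \<bullet> v' x = f x)" if hf: "holder_bd \<beta> K f" for K f
    proof -
      obtain v v' M where v: "C1_bd (\<alpha> + \<beta> - 1) M v v'"
        "\<And>x. l * v x - gen \<nu> v v' x - (s0 *\<^sub>R b x) \<bullet> v' x = f x"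
        using s0(1) hf unfolding solvable_def by blast
      have "C1_bd (\<alpha> + \<beta> - 1) (C * L) v v'" if "holder_bd \<beta> L f" for L
        by (rule C(2)[OF sb[OF s0(2,3)] that v])
      then show ?thesis using v(2) by blast
    qed
    have "\<exists>v v'. C1_bd (\<alpha> + \<beta> - 1) (2 * C * K) v v' \<and> (\<forall>x. l * v x - gen \<nu> v v' x - (s *\<^sub>R b x) \<bullet> v' x = f x)"
      by (rule perturb_solvability[OF \<beta> b' C(1) small sol f])
    then show "\<exists>v v' M. C1_bd (\<alpha> + \<beta> - 1) M v v' \<and> (\<forall>x. l * v x - gen \<nu> v v' x - (s *\<^sub>R b x) \<bullet> v' x = f x)"
      by blast
  qed
  have "solvable (min 1 (real n * \<delta>))" for n
  proof (induction n)
    case 0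
    then show ?case using \<open>solvable 0\<close> by simp
  next
    case (Suc n)
    show ?case
      by (rule step[OF Suc]) (use \<delta> in \<open>auto simp: min_def algebra_simps\<close>)
  qed
  moreover obtain n where "1 / \<delta> \<le> real n" using real_arch_simple by blast
  then have "min 1 (real n * \<delta>) = 1" using \<delta> by (simp add: min_def field_simps)
  ultimately have "solvable 1" by metis
  then show ?thesis using f unfolding solvable_def by simp
qed

end

section \<open>Gradients and Hoelder norms\<close>

lemma grad_eq:
  fixes g :: "'a::euclidean_space \<Rightarrow> real"
  assumes "(g has_derivative (\<lambda>h. D \<bullet> h)) (at x)"
  shows "grad g x = D"
  unfolding grad_def
proof (rule the_equality)
  show "GDERIV g x :> D" using assms by (simp add: gderiv_def inner_commute)
  fix D' assume "GDERIV g x :> D'"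
  then have "(g has_derivative (\<lambda>h. D' \<bullet> h)) (at x)" by (simp add: gderiv_def inner_commute)
  then have "(\<lambda>h. D' \<bullet> h) = (\<lambda>h. D \<bullet> h)" by (rule has_derivative_unique[OF _ assms])
  then have "D' \<bullet> h = D \<bullet> h" for h by metis
  then have "(D' - D) \<bullet> (D' - D) = 0" by (simp add: inner_diff_left)
  then show "D' = D" by simp
qed

lemma grad_has_derivative:
  fixes g :: "'a::euclidean_space \<Rightarrow> real"
  assumes "g differentiable (at x)"
  shows "(g has_derivative (\<lambda>h. grad g x \<bullet> h)) (at x)"
proof -
  obtain G where G: "(g has_derivative G) (at x)" using assms by (auto simp: differentiable_def)
  obtain D where "G = (\<lambda>h. D \<bullet> h)"
    using bounded_linear_real_inner[OF has_derivative_bounded_linear[OF G]] by blast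
  with G grad_eq[of g D x] show ?thesis by simp
qed

lemma norm_le_sup_norm: "bounded (range g) \<Longrightarrow> norm (g x) \<le> sup_norm g"
  unfolding sup_norm_def by (rule cSUP_upper) (auto simp: bounded_iff bdd_above_def)

lemma sup_norm_le: "(\<And>x. norm (g x) \<le> K) \<Longrightarrow> sup_norm g \<le> K"
  unfolding sup_norm_def by (rule cSUP_least) auto

lemma Cb_holder_holder_bd:
  fixes g :: "'a::euclidean_space \<Rightarrow> 'b::real_normed_vector"
  assumes "g \<in> Cb_holder \<theta>"
  shows "holder_bd \<theta> (holder_norm \<theta> g) g"
  unfolding holder_bd_def
proof (intro conjI allI)
  have bdd: "bdd_above (holder_quotients \<theta> g)" and bnd: "bounded (range g)"
    using assms by (auto simp: Cb_holder_def bcontfun_def)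
  have quot: "norm (g x - g y) / dist x y powr \<theta> \<le> holder_seminorm \<theta> g" if "x \<noteq> y" for x y
    unfolding holder_seminorm_def using that by (intro cSup_upper bdd) (auto simp: holder_quotients_def)
  \<comment> \<open>Two distinct points are needed for the set of quotients to be nonempty, which
    makes the seminorm nonnegative.\<close>
  obtain e :: 'a where "e \<in> Basis" using nonempty_Basis by blast
  then have "e \<noteq> 0" by auto
  then have semi: "0 \<le> holder_seminorm \<theta> g"
    by (intro order_trans[OF _ quot[of e 0]]) auto
  have sup: "norm (g x) \<le> sup_norm g" for x using bnd by (rule norm_le_sup_norm)
  then show "norm (g x) \<le> holder_norm \<theta> g" for x
    using semi by (simp add: holder_norm_def add_increasing2)
  show "norm (g x - g y) \<le> holder_norm \<theta> g * dist x y powr \<theta>" for x y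
  proof (cases "x = y")
    case False
    then have "norm (g x - g y) \<le> holder_seminorm \<theta> g * dist x y powr \<theta>"
      using quot[OF False] by (simp add: field_simps)
    also have "\<dots> \<le> holder_norm \<theta> g * dist x y powr \<theta>"
      using order_trans[OF norm_ge_zero sup] by (intro mult_right_mono) (auto simp: holder_norm_def)
    finally show ?thesis .
  qed simp
qed

lemma holder_bd_Cb_holder:
  fixes g :: "'a::euclidean_space \<Rightarrow> 'b::real_normed_vector"
  assumes g: "holder_bd \<theta> K g" "0 < \<theta>"
  shows "g \<in> Cb_holder \<theta>" "holder_seminorm \<theta> g \<le> K"
proof -
  have le: "q \<le> K" if "q \<in> holder_quotients \<theta> g" for q
    using that holder_bdD(2)[OF g(1)] by (auto simp: holder_quotients_def field_simps)
  then show "g \<in> Cb_holder \<theta>"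
    using holder_bd_bcontfun[OF g] by (auto simp: Cb_holder_def bdd_above_def)
  obtain e :: 'a where "e \<in> Basis" using nonempty_Basis by blast
  then have "e \<noteq> 0" by auto
  then have "holder_quotients \<theta> g \<noteq> {}" by (auto simp: holder_quotients_def)
  then show "holder_seminorm \<theta> g \<le> K"
    unfolding holder_seminorm_def using le by (rule cSup_least)
qed

lemma Cb_1_holder_C1_bd:
  assumes v: "v \<in> Cb_1_holder \<theta>" and \<theta>: "0 < \<theta>"
  shows "C1_bd \<theta> (sup_norm v + holder_norm \<theta> (grad v)) v (grad v)"
proof (rule C1_bdI[OF _ _ _ \<theta>])
  show "(v has_derivative (\<lambda>h. grad v x \<bullet> h)) (at x)" for x
    using v by (intro grad_has_derivative) (simp add: Cb_1_holder_def C1_def)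
  have h: "holder_bd \<theta> (holder_norm \<theta> (grad v)) (grad v)"
    using v by (intro Cb_holder_holder_bd) (simp add: Cb_1_holder_def)
  have "bounded (range v)" using v by (auto simp: Cb_1_holder_def Cb_holder_def bcontfun_def)
  from norm_le_sup_norm[OF this] have s: "\<bar>v x\<bar> \<le> sup_norm v" for x by simp
  then show "\<bar>v x\<bar> \<le> sup_norm v + holder_norm \<theta> (grad v)" for x
    using holder_bd_nonneg[OF h] by (simp add: add_increasing2)
  show "holder_bd \<theta> (sup_norm v + holder_norm \<theta> (grad v)) (grad v)"
    using order_trans[OF abs_ge_zero s] by (intro holder_bd_mono[OF h]) simp
qed

lemma C1_bd_Cb_1_holder:
  assumes v: "C1_bd \<theta> K v v'" and \<theta>: "0 < \<theta>" "\<theta> \<le> 1"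
  shows "v \<in> Cb_1_holder \<theta>" "grad v = v'"
proof -
  note D = C1_bd_has_derivative[OF v \<theta>(1)]
  show g: "grad v = v'" using grad_eq[OF D] by (simp add: fun_eq_iff)
  have "v \<in> C1"
    using D C1_bd_continuous(2)[OF v \<theta>(1)] by (auto simp: C1_def g differentiable_def)
  moreover have "v \<in> Cb_holder \<theta>"
    by (rule holder_bd_Cb_holder[OF holder_bd_exponent[OF C1_bd_lipschitz[OF v \<theta>(1)] \<theta>] \<theta>(1)])
  moreover have "grad v \<in> Cb_holder \<theta>"
    unfolding g by (rule holder_bd_Cb_holder[OF C1_bdD(5)[OF v] \<theta>(1)])
  ultimately show "v \<in> Cb_1_holder \<theta>" by (simp add: Cb_1_holder_def)
qed

section \<open>The semigroup of a Levy process\<close>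

text \<open>(H2) controls the truncated power on the unit ball; outside it the truncated power
  equals 1, and so does the integrand in the definition of a Levy measure.\<close>

lemma jump_measure_of_levy_measure:
  fixes \<nu> :: "'a::euclidean_space measure"
  assumes \<nu>: "levy_measure \<nu>" and \<alpha>: "1 \<le> \<alpha>" "\<alpha> < 2" and H2: "levy_H2 \<nu> \<alpha>"
  shows "jump_measure \<nu> \<alpha>"
proof -
  have sets: "sets \<nu> = sets borel" and sf: "sigma_finite_measure \<nu>"
    and two: "(\<integral>\<^sup>+ z. ennreal (min 1 ((norm z)\<^sup>2)) \<partial>\<nu>) < \<infinity>"
    using \<nu> by (auto simp: levy_measure_def)
  note [measurable_cong] = sets
  have "integrable \<nu> (trunc_powr \<sigma>)" if \<sigma>: "\<alpha> < \<sigma>" for \<sigma>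
  proof (rule integrableI_bounded)
    show "trunc_powr \<sigma> \<in> borel_measurable \<nu>" by measurable
    have "(\<integral>\<^sup>+ x. ennreal (norm (trunc_powr \<sigma> x)) \<partial>\<nu>)
        \<le> (\<integral>\<^sup>+ x. ennreal (norm x powr \<sigma>) * indicator (cball 0 1) x + ennreal (min 1 ((norm x)\<^sup>2)) \<partial>\<nu>)"
    proof (rule nn_integral_mono)
      fix x :: 'a
      show "ennreal (norm (trunc_powr \<sigma> x)) \<le> ennreal (norm x powr \<sigma>) * indicator (cball 0 1) x + ennreal (min 1 ((norm x)\<^sup>2))"
      proof (cases "norm x \<le> 1")
        case True
        then show ?thesis using \<sigma> \<alpha> by (simp add: trunc_powr_simps)
      next
        case False
        then have "1 \<le> (norm x)\<^sup>2" by simp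
        then show ?thesis using False \<sigma> \<alpha> by (simp add: trunc_powr_simps)
      qed
    qed
    also have "\<dots> = (\<integral>\<^sup>+ x\<in>cball 0 1. ennreal (norm x powr \<sigma>) \<partial>\<nu>) + (\<integral>\<^sup>+ z. ennreal (min 1 ((norm z)\<^sup>2)) \<partial>\<nu>)"
    proof (rule nn_integral_add)
      have [measurable]: "cball 0 1 \<in> sets (borel :: 'a measure)" by (intro borel_closed closed_cball)
      show "(\<lambda>x. ennreal (norm x powr \<sigma>) * indicator (cball 0 1) x) \<in> borel_measurable \<nu>" by measurable
    qed measurable
    also have "\<dots> < \<infinity>" using H2 \<sigma> two by (simp add: levy_H2_def)
    finally show "(\<integral>\<^sup>+ x. ennreal (norm (trunc_powr \<sigma> x)) \<partial>\<nu>) < \<infinity>" .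
  qed
  then show ?thesis
    by (intro jump_measure.intro jump_measure_axioms.intro sf sets \<alpha>)
qed

text \<open>\<open>L (s + t)\<close> is almost surely the sum of the increments over the intervals
  from 0 to \<open>s\<close> and from \<open>s\<close> to \<open>s + t\<close>. They are independent
  with the laws of \<open>L s\<close> and \<open>L t\<close>, so the double integral is an
  expectation over their joint law.\<close>

lemma levy_process_semigroup:
  fixes L :: "real \<Rightarrow> 'w \<Rightarrow> 'a::euclidean_space" and g :: "'a \<Rightarrow> real"
  assumes L: "levy_process M L" and st: "0 < s" "0 < t" and g: "g \<in> bcontfun"
  shows "(\<integral>y. (\<integral>z. g (x + y + z) \<partial>distr M borel (L t)) \<partial>distr M borel (L s)) = (\<integral>y. g (x + y) \<partial>distr M borel (L (s + t)))"
proof -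
  interpret prob_space M using L by (simp add: levy_process_def)
  have [measurable]: "L r \<in> borel_measurable M" if "0 \<le> r" for r
    using L that by (simp add: levy_process_def)
  have m: "L s \<in> borel_measurable M" "L t \<in> borel_measurable M" "L (s + t) \<in> borel_measurable M" "L 0 \<in> borel_measurable M"
    using st by auto
  note [measurable] = m bcontfun_measurable[OF g]
  define X where "X \<omega> = L s \<omega> - L 0 \<omega>" for \<omega>
  define Y where "Y \<omega> = L (s + t) \<omega> - L s \<omega>" for \<omega>
  have mXY [measurable]: "X \<in> borel_measurable M" "Y \<in> borel_measurable M"
    unfolding X_def[abs_def] Y_def[abs_def] by measurable
  \<comment> \<open>Only the three times 0, \<open>s\<close> and \<open>s + t\<close> matter: the
    two increments are those with index 0 and 1, and later values of the sequence are
    irrelevant.\<close>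
  define \<tau> where "\<tau> i = (if i = 0 then 0 else if i = 1 then s else s + t)" for i :: nat
  have "indep_vars (\<lambda>_. borel) (\<lambda>i \<omega>. L (\<tau> (Suc i)) \<omega> - L (\<tau> i) \<omega>) {..<2::nat}"
  proof -
    have "0 \<le> \<tau> 0 \<and> (\<forall>i<2. \<tau> i < \<tau> (Suc i))"
      using st by (auto simp: \<tau>_def less_2_cases_iff)
    then show ?thesis using L by (simp add: levy_process_def)
  qed
  from indep_var_restrict[OF this, of "{0}" "{1}"]
  have ind: "indep_var (\<Pi>\<^sub>M i\<in>{0}. borel) (\<lambda>\<omega>. restrict (\<lambda>i. L (\<tau> (Suc i)) \<omega> - L (\<tau> i) \<omega>) {0})
      (\<Pi>\<^sub>M i\<in>{1}. borel) (\<lambda>\<omega>. restrict (\<lambda>i. L (\<tau> (Suc i)) \<omega> - L (\<tau> i) \<omega>) {1::nat})"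
    by simp
  have "indep_var borel ((\<lambda>f. f 0) \<circ> (\<lambda>\<omega>. restrict (\<lambda>i. L (\<tau> (Suc i)) \<omega> - L (\<tau> i) \<omega>) {0}))
      borel ((\<lambda>f. f 1) \<circ> (\<lambda>\<omega>. restrict (\<lambda>i. L (\<tau> (Suc i)) \<omega> - L (\<tau> i) \<omega>) {1::nat}))"
    by (rule indep_var_compose[OF ind]) (auto intro!: measurable_component_singleton)
  then have XY: "indep_var borel X borel Y"
    by (simp add: comp_def \<tau>_def X_def[abs_def] Y_def[abs_def])
  then have prod: "distr M borel X \<Otimes>\<^sub>M distr M borel Y = distr M (borel \<Otimes>\<^sub>M borel) (\<lambda>\<omega>. (X \<omega>, Y \<omega>))"
    by (simp add: indep_var_distribution_eq)
  have AE0: "AE \<omega> in M. L 0 \<omega> = 0" using L by (simp add: levy_process_def)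
  have dX: "distr M borel X = distr M borel (L s)"
  proof (rule distr_cong_AE[OF refl])
    show "AE \<omega> in M. X \<omega> = L s \<omega>" using AE0 by eventually_elim (simp add: X_def)
  qed auto
  have dY: "distr M borel Y = distr M borel (L t)"
    using L st by (simp add: levy_process_def Y_def[abs_def])
  interpret PX: prob_space "distr M borel X" by (rule prob_space_distr) simp
  interpret PY: prob_space "distr M borel Y" by (rule prob_space_distr) simp
  interpret P: pair_sigma_finite "distr M borel X" "distr M borel Y" ..
  obtain K where K: "\<And>x. norm (g x) \<le> K" using g by (auto simp: bcontfun_def bounded_iff)
  interpret PP: pair_prob_space "distr M borel X" "distr M borel Y" ..
  have int: "integrable (distr M borel X \<Otimes>\<^sub>M distr M borel Y) (\<lambda>(y, z). g (x + y + z))"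
    by (rule PP.integrable_const_bound[where B=K]) (use K in auto)
  have "(\<integral>y. (\<integral>z. g (x + y + z) \<partial>distr M borel Y) \<partial>distr M borel X)
      = (\<integral>p. (case p of (y, z) \<Rightarrow> g (x + y + z)) \<partial>(distr M borel X \<Otimes>\<^sub>M distr M borel Y))"
    using P.integral_fst'[OF int] by simp
  also have "\<dots> = (\<integral>\<omega>. g (x + X \<omega> + Y \<omega>) \<partial>M)"
    unfolding prod by (subst integral_distr) auto
  also have "\<dots> = (\<integral>\<omega>. g (x + L (s + t) \<omega>) \<partial>M)"
  proof (rule integral_cong_AE)
    show "AE \<omega> in M. g (x + X \<omega> + Y \<omega>) = g (x + L (s + t) \<omega>)"
      using AE0 by eventually_elim (simp add: X_def Y_def)
  qed measurable
  also have "\<dots> = (\<integral>y. g (x + y) \<partial>distr M borel (L (s + t)))"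
    by (subst integral_distr) auto
  finally show ?thesis unfolding dX dY .
qed

text \<open>Stochastic continuity is turned into continuity of expectations: increments of size at
  most \<open>\<epsilon>\<close> cost \<open>K * \<epsilon> powr \<kappa>\<close>, and the event of
  larger ones costs \<open>2 * K\<close> times its probability.\<close>

lemma levy_process_continuous:
  fixes L :: "real \<Rightarrow> 'w \<Rightarrow> 'a::euclidean_space" and g :: "'a \<Rightarrow> real"
  assumes L: "levy_process M L" and g: "holder_bd \<kappa> K g" "0 < \<kappa>"
  shows "continuous_on UNIV (\<lambda>t. \<integral>y. g (x + y) \<partial>distr M borel (L (max 0 t)))"
proof -
  interpret prob_space M using L by (simp add: levy_process_def)
  have m [measurable]: "L (max 0 r) \<in> borel_measurable M" for r
    using L by (simp add: levy_process_def)
  have [measurable]: "g \<in> borel_measurable borel"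
    using holder_bd_continuous[OF g] by (rule borel_measurable_continuous_onI)
  have K: "0 \<le> K" using g(1) by (rule holder_bd_nonneg)
  let ?I = "\<lambda>t. \<integral>\<omega>. g (x + L (max 0 t) \<omega>) \<partial>M"
  have eq: "(\<integral>y. g (x + y) \<partial>distr M borel (L (max 0 t))) = ?I t" for t
    by (subst integral_distr) auto
  have int: "integrable M (\<lambda>\<omega>. g (x + L (max 0 t) \<omega>))" for t
    by (rule integrable_const_bound[where B=K]) (use holder_bdD(1)[OF g(1)] in auto)
  let ?A = "\<lambda>\<epsilon> t s. {\<omega> \<in> space M. norm (L (max 0 s) \<omega> - L (max 0 t) \<omega>) > \<epsilon>}"
  have bound: "\<bar>?I s - ?I t\<bar> \<le> K * \<epsilon> powr \<kappa> + 2 * K * measure M (?A \<epsilon> t s)" if \<epsilon>: "0 < \<epsilon>" for \<epsilon> s t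
  proof -
    have A [measurable]: "?A \<epsilon> t s \<in> sets M" by measurable
    have "?I s - ?I t = (\<integral>\<omega>. g (x + L (max 0 s) \<omega>) - g (x + L (max 0 t) \<omega>) \<partial>M)"
      using int by simp
    also have "\<bar>\<dots>\<bar> \<le> (\<integral>\<omega>. \<bar>g (x + L (max 0 s) \<omega>) - g (x + L (max 0 t) \<omega>)\<bar> \<partial>M)"
      using integral_norm_bound[of M "\<lambda>\<omega>. g (x + L (max 0 s) \<omega>) - g (x + L (max 0 t) \<omega>)"] by simp
    also have "\<dots> \<le> (\<integral>\<omega>. K * \<epsilon> powr \<kappa> + 2 * K * indicator (?A \<epsilon> t s) \<omega> \<partial>M)"
    proof (rule integral_mono)
      show "integrable M (\<lambda>\<omega>. \<bar>g (x + L (max 0 s) \<omega>) - g (x + L (max 0 t) \<omega>)\<bar>)" using int by simp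
      show "integrable M (\<lambda>\<omega>. K * \<epsilon> powr \<kappa> + 2 * K * indicator (?A \<epsilon> t s) \<omega>)"
        by (intro Bochner_Integration.integrable_add integrable_const integrable_mult_right integrable_real_indicator[OF A])
           (simp add: emeasure_eq_measure)
      fix \<omega> assume \<omega>: "\<omega> \<in> space M"
      show "\<bar>g (x + L (max 0 s) \<omega>) - g (x + L (max 0 t) \<omega>)\<bar> \<le> K * \<epsilon> powr \<kappa> + 2 * K * indicator (?A \<epsilon> t s) \<omega>"
      proof (cases "\<omega> \<in> ?A \<epsilon> t s")
        case True
        have "0 \<le> K * \<epsilon> powr \<kappa>" using K by simp
        moreover have "\<bar>g (x + L (max 0 s) \<omega>) - g (x + L (max 0 t) \<omega>)\<bar> \<le> 2 * K"
          using holder_bdD(1)[OF g(1), of "x + L (max 0 s) \<omega>"] holder_bdD(1)[OF g(1), of "x + L (max 0 t) \<omega>"]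
          by (simp add: abs_le_iff)
        ultimately have "\<bar>g (x + L (max 0 s) \<omega>) - g (x + L (max 0 t) \<omega>)\<bar> \<le> K * \<epsilon> powr \<kappa> + 2 * K * 1"
          by linarith
        then show ?thesis using True by simp
      next
        case False
        then have "norm (L (max 0 s) \<omega> - L (max 0 t) \<omega>) \<le> \<epsilon>" using \<omega> by simp
        then have "K * norm (L (max 0 s) \<omega> - L (max 0 t) \<omega>) powr \<kappa> \<le> K * \<epsilon> powr \<kappa>"
          using K g(2) by (intro mult_left_mono powr_mono2) auto
        then show ?thesis
          using False holder_bdD(2)[OF g(1), of "x + L (max 0 s) \<omega>" "x + L (max 0 t) \<omega>"] by (simp add: dist_norm)
      qed
    qed
    also have "\<dots> = (\<integral>\<omega>. K * \<epsilon> powr \<kappa> \<partial>M) + (\<integral>\<omega>. 2 * K * indicator (?A \<epsilon> t s) \<omega> \<partial>M)"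
      by (intro Bochner_Integration.integral_add integrable_const integrable_mult_right integrable_real_indicator[OF A])
         (simp add: emeasure_eq_measure)
    also have "\<dots> = K * \<epsilon> powr \<kappa> + 2 * K * measure M (?A \<epsilon> t s)"
      unfolding integral_mult_right_zero Bochner_Integration.integral_indicator sets.Int_space_eq2[OF A]
      by (simp add: prob_space)
    finally show ?thesis .
  qed
  have prob_lim: "((\<lambda>s. measure M (?A \<epsilon> t s)) \<longlongrightarrow> 0) (at t)" if \<epsilon>: "0 < \<epsilon>" for \<epsilon> t
  proof -
    let ?h = "\<lambda>s. measure M {\<omega> \<in> space M. norm (L s \<omega> - L (max 0 t) \<omega>) > \<epsilon>}"
    have "(?h \<longlongrightarrow> 0) (at (max 0 t) within {0..})"
      using L \<epsilon> by (simp add: levy_process_def)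
    \<comment> \<open>\<open>?h\<close> vanishes at the limit point itself, so the one-sided limit
      at time 0 is a continuity statement and can be composed with \<open>max 0\<close>, which also
      covers negative times.\<close>
    then have "continuous (at (max 0 t) within {0..}) ?h"
      using \<epsilon> by (simp add: continuous_within)
    then have h: "continuous (at (max 0 t) within range (max 0)) ?h"
      by (rule continuous_within_subset) auto
    have "isCont (max 0) t" by (intro continuous_intros)
    then have "continuous (at t) (?h \<circ> max 0)"
      by (rule continuous_within_compose[OF _ h])
    then show ?thesis using \<epsilon> by (simp add: continuous_within comp_def)
  qed
  have "isCont ?I t" for t
    unfolding isCont_def
  proof (rule tendstoI)
    fix e :: real assume e: "0 < e"
    define \<epsilon> where "\<epsilon> = (e / (2 * (K + 1))) powr (1 / \<kappa>)"
    have \<epsilon>: "0 < \<epsilon>" "\<epsilon> powr \<kappa> = e / (2 * (K + 1))"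
      using e K g(2) by (auto simp: \<epsilon>_def powr_powr)
    have 1: "K * \<epsilon> powr \<kappa> \<le> e / 2"
      unfolding \<epsilon>(2) using e K by (simp add: field_simps)
    have "\<forall>\<^sub>F s in at t. measure M (?A \<epsilon> t s) < e / (4 * (K + 1))"
      using order_tendstoD(2)[OF prob_lim[OF \<epsilon>(1)], of "e / (4 * (K + 1))" t] e K by simp
    then show "\<forall>\<^sub>F s in at t. dist (?I s) (?I t) < e"
    proof eventually_elim
      case (elim s)
      have "2 * K * measure M (?A \<epsilon> t s) \<le> 2 * (K + 1) * measure M (?A \<epsilon> t s)"
        by (intro mult_right_mono) auto
      also have "\<dots> < 2 * (K + 1) * (e / (4 * (K + 1)))"
        using elim K by (intro mult_strict_left_mono) auto
      also have "\<dots> = e / 2"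
      proof -
        have "2 * q * (e / (4 * q)) = e / 2" if "0 < q" for q :: real using that by simp
        from this[of "K + 1"] show ?thesis using K by simp
      qed
      finally show ?case using bound[OF \<epsilon>(1), of s t] 1 by (simp add: dist_real_def)
    qed
  qed
  then show ?thesis unfolding eq by (simp add: continuous_on_eq_continuous_at)
qed

text \<open>Negative times receive the law at time 0. The gradient bound of (H1) becomes the
  Lipschitz bound of the kernel by the mean value inequality.\<close>

lemma levy_kernel_of_process:
  fixes L :: "real \<Rightarrow> 'w \<Rightarrow> 'a::euclidean_space"
  assumes L: "pure_jump_levy_process M L \<nu>" and \<alpha>: "1 \<le> \<alpha>" "\<alpha> < 2"
    and H1: "levy_H1 M L \<alpha>" and H2: "levy_H2 \<nu> \<alpha>"
  obtains c0 where "levy_kernel \<nu> \<alpha> (\<lambda>t. distr M borel (L (max 0 t))) c0"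
proof -
  have LP: "levy_process M L" and \<nu>: "levy_measure \<nu>"
    and ch: "\<And>t u. 0 \<le> t \<Longrightarrow> (LINT \<omega>|M. exp (\<i> * of_real (u \<bullet> L t \<omega>))) = exp (- of_real t * levy_exponent \<nu> u)"
    using L by (auto simp: pure_jump_levy_process_def)
  interpret prob_space M using LP by (simp add: levy_process_def)
  have m: "L t \<in> borel_measurable M" if "0 \<le> t" for t
    using LP that by (simp add: levy_process_def)
  have m' [measurable]: "L (max 0 t) \<in> borel_measurable M" for t by (rule m) simp
  obtain c0 where c0: "0 < c0" "\<And>t f. 0 < t \<Longrightarrow> t \<le> 1 \<Longrightarrow> f \<in> bcontfun \<Longrightarrow>
      sup_norm (grad (levy_semigroup M L t f)) \<le> c0 * t powr (- 1 / \<alpha>) * sup_norm f"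
    using H1 by (auto simp: levy_H1_def)
  have "levy_kernel \<nu> \<alpha> (\<lambda>t. distr M borel (L (max 0 t))) c0"
  proof (intro levy_kernel.intro levy_kernel_axioms.intro)
    show "jump_measure \<nu> \<alpha>" by (rule jump_measure_of_levy_measure[OF \<nu> \<alpha> H2])
    show "prob_space (distr M borel (L (max 0 t)))" for t by (rule prob_space_distr) simp
    show "sets (distr M borel (L (max 0 t))) = sets borel" for t by simp
    show "(\<integral>y. (\<integral>z. g (x + y + z) \<partial>distr M borel (L (max 0 t))) \<partial>distr M borel (L (max 0 s)))
        = (\<integral>y. g (x + y) \<partial>distr M borel (L (max 0 (s + t))))"
      if "0 < s" "0 < t" "g \<in> bcontfun" for s t x and g :: "'a \<Rightarrow> real"
      using levy_process_semigroup[OF LP that, of x] that by simp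
    show "continuous_on UNIV (\<lambda>t. \<integral>y. g (x + y) \<partial>distr M borel (L (max 0 t)))"
      if "0 < \<kappa>" "holder_bd \<kappa> K g" for \<kappa> K x and g :: "'a \<Rightarrow> real"
      by (rule levy_process_continuous[OF LP that(2,1)])
    show "(\<integral>y. exp (\<i> * of_real (u \<bullet> y)) \<partial>distr M borel (L (max 0 t))) = exp (- of_real t * levy_exponent \<nu> u)"
      if "0 \<le> t" for t u
      using ch[OF that, of u] that m[OF that] by (subst integral_distr) (auto simp: max_def)
    show "0 \<le> c0" using c0(1) by simp
    show "\<bar>(\<integral>y. g (x + h + y) \<partial>distr M borel (L (max 0 t))) - (\<integral>y. g (x + y) \<partial>distr M borel (L (max 0 t)))\<bar>
        \<le> c0 * t powr (- 1 / \<alpha>) * K * norm h"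
      if t: "0 < t" "t \<le> 1" and g: "g \<in> bcontfun" and K: "\<And>x. \<bar>g x\<bar> \<le> K" for t K x h and g :: "'a \<Rightarrow> real"
    proof -
      let ?R = "levy_semigroup M L t g"
      have [measurable]: "g \<in> borel_measurable borel" using g by (rule bcontfun_measurable)
      have eq: "(\<integral>y. g (z + y) \<partial>distr M borel (L (max 0 t))) = ?R z" for z
        using t m[of t] by (subst integral_distr) (auto simp: levy_semigroup_def max_def)
      have R: "?R \<in> Cb_1" using H1 t(1) g by (auto simp: levy_H1_def)
      have "norm (grad ?R z) \<le> c0 * t powr (- 1 / \<alpha>) * K" for z
      proof -
        have "norm (grad ?R z) \<le> sup_norm (grad ?R)"
          using R by (intro norm_le_sup_norm) (simp add: Cb_1_def)
        also have "\<dots> \<le> c0 * t powr (- 1 / \<alpha>) * sup_norm g" by (rule c0(2)[OF t g])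
        also have "\<dots> \<le> c0 * t powr (- 1 / \<alpha>) * K"
          using c0(1) K by (intro mult_left_mono sup_norm_le) auto
        finally show ?thesis .
      qed
      moreover have "(?R has_derivative (\<lambda>h. grad ?R z \<bullet> h)) (at z)" for z
        using R by (intro grad_has_derivative) (simp add: Cb_1_def C1_def)
      ultimately have "\<bar>?R (x + h) - ?R x\<bar> \<le> c0 * t powr (- 1 / \<alpha>) * K * norm (x + h - x)"
        by (intro abs_diff_le_gradient[OF convex_UNIV]) auto
      then show ?thesis unfolding eq by simp
    qed
  qed
  then show ?thesis by (rule that)
qed

section \<open>Assembly in the norms of the statement\<close>

theorem theorem4p3:
  fixes M :: "'w measure"
    and L :: "real \<Rightarrow> 'w \<Rightarrow> real ^ 'd::finite"
    and \<nu> :: "(real ^ 'd) measure"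
    and \<alpha> \<beta> :: real
    and b :: "real ^ 'd \<Rightarrow> real ^ 'd"
  assumes L: "pure_jump_levy_process M L \<nu>"
    and \<alpha>: "1 \<le> \<alpha>" "\<alpha> < 2"
    and H1: "levy_H1 M L \<alpha>"
    and H2: "levy_H2 \<nu> \<alpha>"
    and \<beta>: "0 < \<beta>" "\<beta> < 1" "1 < \<alpha> + \<beta>" "\<alpha> + \<beta> < 2"
    and b: "b \<in> Cb_holder \<beta>"
  shows "(\<forall>lam>0. \<forall>f\<in>Cb_holder \<beta>. \<exists>!v. resolvent_solution \<nu> b (\<alpha> + \<beta> - 1) lam f v) \<and>
    (\<forall>\<omega>>0. \<exists>c>0. \<forall>lam\<ge>\<omega>. \<forall>f\<in>Cb_holder \<beta>. \<forall>v. resolvent_solution \<nu> b (\<alpha> + \<beta> - 1) lam f v \<longrightarrow>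
       lam * sup_norm v + holder_seminorm (\<alpha> + \<beta> - 1) (grad v) \<le> c * holder_norm \<beta> f) \<and>
    (\<forall>f\<in>Cb_holder \<beta>. \<forall>v. (\<forall>lam>0. resolvent_solution \<nu> b (\<alpha> + \<beta> - 1) lam f (v lam)) \<longrightarrow>
       ((\<lambda>lam. sup_norm (grad (v lam))) \<longlongrightarrow> 0) at_top)"
proof -
  obtain c0 where "levy_kernel \<nu> \<alpha> (\<lambda>t. distr M borel (L (max 0 t))) c0"
    using levy_kernel_of_process[OF L \<alpha> H1 H2] by blast
  then interpret levy_kernel \<nu> \<alpha> "\<lambda>t. distr M borel (L (max 0 t))" c0 .
  define \<theta> where "\<theta> = \<alpha> + \<beta> - 1"
  have \<theta>: "0 < \<theta>" "\<theta> \<le> 1" "\<alpha> < 1 + \<theta>" using \<beta> by (auto simp: \<theta>_def)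
  \<comment> \<open>The \<open>+ 1\<close> provides the strictly positive bound that the a priori
    estimate asks for, even when the drift vanishes.\<close>
  define B where "B = holder_norm \<beta> b + 1"
  have b0: "holder_bd \<beta> (holder_norm \<beta> b) b" by (rule Cb_holder_holder_bd[OF b])
  have B: "0 < B" using holder_bd_nonneg[OF b0] by (simp add: B_def)
  have bB: "holder_bd \<beta> B b" by (rule holder_bd_mono[OF b0]) (simp add: B_def)
  have sol: "C1_bd \<theta> (sup_norm v + holder_norm \<theta> (grad v)) v (grad v)"
      "\<And>x. lam * v x - gen \<nu> v (grad v) x - b x \<bullet> grad v x = f x"
    if "resolvent_solution \<nu> b \<theta> lam f v" for lam f v
    using that Cb_1_holder_C1_bd[OF _ \<theta>(1)] by (auto simp: resolvent_solution_def levy_generator_eq_gen)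
  have max: "lam * \<bar>v x\<bar> \<le> K"
    if "0 < lam" "resolvent_solution \<nu> b \<theta> lam f v" "\<And>x. \<bar>f x\<bar> \<le> K" for lam f v K x
    by (rule maximum_principle_abs[OF sol(1)[OF that(2)] \<theta> that(1) holder_bdD(1)[OF bB] sol(2)[OF that(2)] that(3)])
  have fK: "\<bar>f x\<bar> \<le> holder_norm \<beta> f" if "f \<in> Cb_holder \<beta>" for f :: "real ^ 'd \<Rightarrow> real" and x
    using holder_bdD(1)[OF Cb_holder_holder_bd[OF that], of x] by simp

  have ex: "\<exists>v. resolvent_solution \<nu> b \<theta> lam f v" if lam: "0 < lam" and f: "f \<in> Cb_holder \<beta>" for lam f
  proof -
    obtain v v' K where v: "C1_bd \<theta> K v v'" "\<And>x. lam * v x - gen \<nu> v v' x - b x \<bullet> v' x = f x"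
      using drift_solvability[OF \<beta> lam bB Cb_holder_holder_bd[OF f]] unfolding \<theta>_def by blast
    show ?thesis
      using v C1_bd_Cb_1_holder[OF v(1) \<theta>(1,2)]
      by (intro exI[of _ v]) (simp add: resolvent_solution_def levy_generator_eq_gen)
  qed
  have uniq: "v = u" if "0 < lam" and v: "resolvent_solution \<nu> b \<theta> lam f v" and u: "resolvent_solution \<nu> b \<theta> lam f u"
    for lam f u v
  proof
    fix x
    \<comment> \<open>The difference of two solutions solves the equation with right-hand side 0,
      and the maximum principle accepts it with any finite \<open>C1_bd\<close> constant.\<close>
    note C1 = C1_bd_add[OF sol(1)[OF v] C1_bd_cmult[OF sol(1)[OF u] \<theta>(1), of "- 1"] \<theta>(1)]
    have "lam * \<bar>v x + - 1 * u x\<bar> \<le> 0"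
    proof (rule maximum_principle_abs[OF C1 \<theta> that(1) holder_bdD(1)[OF bB], where f="\<lambda>_. 0"])
      show "lam * (v x + - 1 * u x) - gen \<nu> (\<lambda>x. v x + - 1 * u x) (\<lambda>x. grad v x + - 1 *\<^sub>R grad u x) x
          - b x \<bullet> (grad v x + - 1 *\<^sub>R grad u x) = 0" for x
        using sol(2)[OF v, of x] sol(2)[OF u, of x]
        by (subst gen_add[OF sol(1)[OF v] C1_bd_cmult[OF sol(1)[OF u] \<theta>(1)] \<theta>(1,3)])
           (simp only: gen_cmult, simp add: inner_diff_right algebra_simps)
    qed simp
    then show "v x = u x" using that(1) by (simp add: mult_le_0_iff)
  qed

  have est: "\<exists>C>0. \<forall>lam\<ge>\<omega>. \<forall>f\<in>Cb_holder \<beta>. \<forall>v. resolvent_solution \<nu> b \<theta> lam f v \<longrightarrow>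
      C1_bd \<theta> (C * holder_norm \<beta> f) v (grad v)" if \<omega>: "0 < \<omega>" for \<omega>
  proof -
    obtain C where C: "0 < C"
      "\<And>l b f v v' K M. \<omega> \<le> l \<Longrightarrow> holder_bd \<beta> B b \<Longrightarrow> holder_bd \<beta> K f \<Longrightarrow> C1_bd \<theta> M v v' \<Longrightarrow>
        (\<And>x. l * v x - gen \<nu> v v' x - b x \<bullet> v' x = f x) \<Longrightarrow> C1_bd \<theta> (C * K) v v'"
      using a_priori_estimate[OF \<beta> \<omega> B] unfolding \<theta>_def by blast
    show ?thesis
    proof (intro exI[of _ C] conjI allI impI ballI)
      fix lam f v assume lam: "\<omega> \<le> lam" and f: "f \<in> Cb_holder \<beta>" and v: "resolvent_solution \<nu> b \<theta> lam f v"
      show "C1_bd \<theta> (C * holder_norm \<beta> f) v (grad v)"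
        by (rule C(2)[OF lam bB Cb_holder_holder_bd[OF f] sol(1)[OF v] sol(2)[OF v]])
    qed (rule C(1))
  qed

  show ?thesis
    unfolding \<theta>_def[symmetric]
  proof (intro conjI allI impI ballI)
    show "\<exists>!v. resolvent_solution \<nu> b \<theta> lam f v" if "0 < lam" "f \<in> Cb_holder \<beta>" for lam f
      using ex[OF that] uniq[OF that(1)] by blast
    show "\<exists>c>0. \<forall>lam\<ge>\<omega>. \<forall>f\<in>Cb_holder \<beta>. \<forall>v. resolvent_solution \<nu> b \<theta> lam f v \<longrightarrow>
       lam * sup_norm v + holder_seminorm \<theta> (grad v) \<le> c * holder_norm \<beta> f" if \<omega>: "0 < \<omega>" for \<omega>
    proof -
      obtain C where C: "0 < C" "\<And>lam f v. \<omega> \<le> lam \<Longrightarrow> f \<in> Cb_holder \<beta> \<Longrightarrow> resolvent_solution \<nu> b \<theta> lam f v \<Longrightarrow>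
          C1_bd \<theta> (C * holder_norm \<beta> f) v (grad v)"
        using est[OF \<omega>] by blast
      show ?thesis
      \<comment> \<open>The 1 comes from the maximum principle, which bounds
        \<open>lam * sup_norm v\<close> by the supremum of \<open>f\<close> without loss;
        \<open>C\<close> pays for the gradient seminorm.\<close>
      proof (intro exI[of _ "1 + C"] conjI allI impI ballI)
        fix lam f v
        assume lam: "\<omega> \<le> lam" and f: "f \<in> Cb_holder \<beta>" and v: "resolvent_solution \<nu> b \<theta> lam f v"
        have lam0: "0 < lam" using lam \<omega> by simp
        have "norm (v x) \<le> holder_norm \<beta> f / lam" for x
          using max[OF lam0 v fK[OF f], of x] lam0 by (simp add: field_simps)
        then have "sup_norm v \<le> holder_norm \<beta> f / lam" by (rule sup_norm_le)
        then have "lam * sup_norm v \<le> holder_norm \<beta> f" using lam0 by (simp add: field_simps)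
        moreover have "holder_seminorm \<theta> (grad v) \<le> C * holder_norm \<beta> f"
          by (rule holder_bd_Cb_holder(2)[OF C1_bdD(5)[OF C(2)[OF lam f v]] \<theta>(1)])
        ultimately show "lam * sup_norm v + holder_seminorm \<theta> (grad v) \<le> (1 + C) * holder_norm \<beta> f"
          by (simp add: algebra_simps)
      qed (use C(1) in simp)
    qed
    show "((\<lambda>lam. sup_norm (grad (v lam))) \<longlongrightarrow> 0) at_top"
      if f: "f \<in> Cb_holder \<beta>" and v: "\<forall>lam>0. resolvent_solution \<nu> b \<theta> lam f (v lam)" for f v
    proof -
      \<comment> \<open>Only large \<open>lam\<close> matter in the limit, so the uniform gradient
        bound is taken at the threshold \<open>\<omega> = 1\<close>.\<close>
      obtain C where C: "0 < C" "\<And>lam f v. 1 \<le> lam \<Longrightarrow> f \<in> Cb_holder \<beta> \<Longrightarrow> resolvent_solution \<nu> b \<theta> lam f v \<Longrightarrow>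
          C1_bd \<theta> (C * holder_norm \<beta> f) v (grad v)"
        using est[of 1] by auto
      define K where "K = holder_norm \<beta> f"
      \<comment> \<open>Interpolation between \<open>K / lam\<close> and the Hoelder bound of the gradient at scale
        \<open>lam powr (- 1 / 2)\<close>.\<close>
      have le: "norm (grad (v lam) x) \<le> 2 * K * lam powr (- 1 / 2) + C * K * lam powr (- \<theta> / 2)" if lam: "1 \<le> lam" for lam x
      proof -
        have lam0: "0 < lam" using lam by simp
        note V = C(2)[OF lam f v[rule_format, OF lam0], folded K_def]
        have vb: "\<bar>v lam x\<bar> \<le> K / lam" for x
          using max[OF lam0 v[rule_format, OF lam0] fK[OF f], of x] lam0 by (simp add: K_def field_simps)
        have "norm (grad (v lam) x) \<le> 2 * (K / lam) / lam powr (- 1 / 2) + C * K * (lam powr (- 1 / 2)) powr \<theta>"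
          by (rule gradient_interpolation[OF _ vb C1_bdD(4)[OF V]]) (use lam0 in simp)
        also have "(lam powr (- 1 / 2)) powr \<theta> = lam powr (- \<theta> / 2)" by (simp add: powr_powr)
        also have "2 * (K / lam) / lam powr (- 1 / 2) = 2 * K * lam powr (- 1 / 2)"
        proof -
          have "lam powr (- 1 / 2) * lam powr (- 1 / 2) = lam powr (- 1)" by (simp add: powr_add[symmetric])
          then have "1 / lam = lam powr (- 1 / 2) * lam powr (- 1 / 2)" using lam0 by (simp add: powr_minus_divide)
          then have "K / lam = K * (lam powr (- 1 / 2) * lam powr (- 1 / 2))" by (metis times_divide_eq_right mult_1_right)
          then show ?thesis using lam0 by simp
        qed
        finally show ?thesis .
      qed
      have "((\<lambda>lam. 2 * K * lam powr (- 1 / 2) + C * K * lam powr (- \<theta> / 2)) \<longlongrightarrow> 2 * K * 0 + C * K * 0) at_top"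
        by (intro tendsto_intros tendsto_neg_powr filterlim_ident) (use \<theta> in auto)
      then have lim: "((\<lambda>lam. 2 * K * lam powr (- 1 / 2) + C * K * lam powr (- \<theta> / 2)) \<longlongrightarrow> 0) at_top" by simp
      \<comment> \<open>\<open>sup_norm\<close> is a bare supremum, so even its sign depends on
        boundedness of the gradient, which \<open>le\<close> supplies.\<close>
      have ge: "0 \<le> sup_norm (grad (v lam))" if lam: "1 \<le> lam" for lam
      proof -
        have "bounded (range (grad (v lam)))" using le[OF lam] by (auto intro: boundedI)
        from norm_le_sup_norm[OF this, of 0] show ?thesis using norm_ge_zero order_trans by blast
      qed
      show ?thesis
      proof (rule tendsto_sandwich[OF _ _ tendsto_const lim])
        show "\<forall>\<^sub>F lam in at_top. 0 \<le> sup_norm (grad (v lam))"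
          using eventually_ge_at_top[of 1] by eventually_elim (rule ge)
        show "\<forall>\<^sub>F lam in at_top. sup_norm (grad (v lam)) \<le> 2 * K * lam powr (- 1 / 2) + C * K * lam powr (- \<theta> / 2)"
          using eventually_ge_at_top[of 1] by eventually_elim (rule sup_norm_le[OF le])
      qed
    qed
  qed
qed

end
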